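(* Let $\theta,\sigma>0$ and let $u$ be the solution of the stochastic heat equation $\mathrm{d}u(t,x)=\theta u_{xx}(t,x)\,\mathrm{d}t+\sigma\,\mathrm{d}W(t,x)$, $x\in\mathbb R$, $t>0$, $u(0,x)=0$, namely $u(t,x)=\sigma\int_0^t\int_{\mathbb R}p_{t-s}(x-y)\,W(\mathrm ds,\mathrm dy)$ with $p_s(z)=(4\pi\theta s)^{-1/2}e^{-z^2/(4\theta s)}$, where $W$ is a space-time white noise. Fix $x\in\mathbb R$ and $0<c<d<\infty$, let $t_i=c+(d-c)i/n$, $i=0,\dots,n$, and define $$\widehat\theta_{n,x}=\frac{3(d-c)\sigma^4}{\pi\sum_{i=1}^n(u(t_i,x)-u(t_{i-1},x))^4},\qquad \widehat\sigma^2_{n,x}=\sqrt{\frac{\theta\pi}{3(d-c)}\sum_{i=1}^n(u(t_i,x)-u(t_{i-1},x))^4}.$$ Then, as $n\to\infty$, $\widehat\theta_{n,x}\to\theta$ almost surely, $\widehat\sigma^2_{n,x}\to\sigma^2$ almost surely, and $$\sqrt n(\widehat\theta_{n,x}-\theta)\xrightarrow{\mathcal D}\mathcal N\Big(0,\tfrac19\theta^2\check\sigma^2\Big),\qquad \sqrt n(\widehat\sigma^2_{n,x}-\sigma^2)\xrightarrow{\mathcal D}\mathcal N\Big(0,\tfrac1{36}\sigma^4\check\sigma^2\Big),$$ where $\check\sigma^2=72\check\sigma_2^2+24\check\sigma_4^2$, $\check\sigma_l^2=\lim_{n\to\infty}\frac1n\sum_{i=1}^n\sum_{j=1}^n r^l(|i-j|)$,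 and $r(m)=\tfrac12\big(|m+1|^{1/2}+|m-1|^{1/2}-2|m|^{1/2}\big)$ is the correlation function of the unit increments of a fractional Brownian motion with Hurst index $1/4$.
   Context: The statement for $\widehat\theta_{n,x}$ is with $\sigma$ regarded as known, that for $\widehat\sigma^2_{n,x}$ with $\theta$ regarded as known. $\xrightarrow{\mathcal D}$ denotes convergence in distribution. *)

theory Defs
  imports "HOL-Probability.Probability"
begin

definition heat_kernel :: "real \<Rightarrow> real \<Rightarrow> real \<Rightarrow> real" where
  "heat_kernel \<theta> s z = (4 * pi * \<theta> * s) powr (-1/2) * exp (- z\<^sup>2 / (4 * \<theta> * s))"

definition sq_int :: "(real \<times> real \<Rightarrow> real) \<Rightarrow> bool" where
  "sq_int f \<longleftrightarrow> f \<in> borel_measurable lborel \<and> integrable lborel (\<lambda>z. (f z)\<^sup>2)"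

text \<open>Space-time white noise on R x R, given as the isonormal Gaussian process
  (Wiener integral) f \<mapsto> W(f) = int f dW over L^2(R x R): W is a.s. linear and
  each W(f) is centred Gaussian with variance int f^2 (degenerate at 0 if int f^2 = 0).\<close>
definition white_noise :: "'a measure \<Rightarrow> ((real \<times> real \<Rightarrow> real) \<Rightarrow> 'a \<Rightarrow> real) \<Rightarrow> bool" where
  "white_noise M W \<longleftrightarrow> prob_space M \<and>
     (\<forall>f. sq_int f \<longrightarrow> W f \<in> borel_measurable M \<and>
        (if (\<integral>z. (f z)\<^sup>2 \<partial>lborel) = 0 then (AE \<omega> in M. W f \<omega> = 0)
         else distributed M lborel (W f) (normal_density 0 (sqrt (\<integral>z. (f z)\<^sup>2 \<partial>lborel))))) \<and>
     (\<forall>f g a b. sq_int f \<longrightarrow> sq_int g \<longrightarrow>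
        (AE \<omega> in M. W (\<lambda>z. a * f z + b * g z) \<omega> = a * W f \<omega> + b * W g \<omega>))"

definition she_solution ::
  "real \<Rightarrow> real \<Rightarrow> ((real \<times> real \<Rightarrow> real) \<Rightarrow> 'a \<Rightarrow> real) \<Rightarrow> real \<Rightarrow> real \<Rightarrow> 'a \<Rightarrow> real" where
  "she_solution \<theta> \<sigma> W t x = (\<lambda>\<omega>. \<sigma> * W (\<lambda>(s, y). if 0 \<le> s \<and> s < t then heat_kernel \<theta> (t - s) (x - y) else 0) \<omega>)"

definition quartic_var ::
  "(real \<Rightarrow> real \<Rightarrow> 'a \<Rightarrow> real) \<Rightarrow> real \<Rightarrow> real \<Rightarrow> real \<Rightarrow> nat \<Rightarrow> 'a \<Rightarrow> real" where
  "quartic_var u x c d n \<omega> =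
     (\<Sum>i=1..n. (u (c + (d - c) * real i / real n) x \<omega> - u (c + (d - c) * real (i - 1) / real n) x \<omega>) ^ 4)"

definition theta_hat ::
  "(real \<Rightarrow> real \<Rightarrow> 'a \<Rightarrow> real) \<Rightarrow> real \<Rightarrow> real \<Rightarrow> real \<Rightarrow> real \<Rightarrow> nat \<Rightarrow> 'a \<Rightarrow> real" where
  "theta_hat u \<sigma> x c d n \<omega> = 3 * (d - c) * \<sigma> ^ 4 / (pi * quartic_var u x c d n \<omega>)"

definition sigma2_hat ::
  "(real \<Rightarrow> real \<Rightarrow> 'a \<Rightarrow> real) \<Rightarrow> real \<Rightarrow> real \<Rightarrow> real \<Rightarrow> real \<Rightarrow> nat \<Rightarrow> 'a \<Rightarrow> real" where
  "sigma2_hat u \<theta> x c d n \<omega> = sqrt (\<theta> * pi / (3 * (d - c)) * quartic_var u x c d n \<omega>)"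

text \<open>Correlation of unit increments of fBm with Hurst index 1/4.\<close>
definition fbm_corr :: "real \<Rightarrow> real" where
  "fbm_corr m = (\<bar>m + 1\<bar> powr (1/2) + \<bar>m - 1\<bar> powr (1/2) - 2 * \<bar>m\<bar> powr (1/2)) / 2"

definition sigma_check_l :: "nat \<Rightarrow> real" where
  "sigma_check_l l = lim (\<lambda>n. (1 / real n) *
      (\<Sum>i=1..n. \<Sum>j=1..n. fbm_corr \<bar>real i - real j\<bar> ^ l))"

definition sigma_check :: real where
  "sigma_check = 72 * sigma_check_l 2 + 24 * sigma_check_l 4"

end

theory Submission
  imports Defs
begin

text \<open>The covariance of the solution in time is proportional to \<open>sqrt (t + s) - sqrt \<bar>t - s\<bar>\<close>. Hence the
  normalised increments form a Gaussian array \<open>X i\<close> whose covariance \<open>C i j\<close> is \<open>r (i - j)\<close> up to an error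
  \<open>O(n powr (-3/2))\<close>, and \<open>\<bar>r\<bar>\<close> is summable. For
  \<open>F = (1 / sqrt n) (\<Sum>i. X i ^ 4 - 3 (C i i)\<^sup>2)\<close> Gaussian integration by parts gives a Stein identity
  \<open>E (F \<Phi>(F)) = E (G \<Phi>'(F))\<close> with an explicit polynomial \<open>G\<close>, and a covariance bound for monomials
  shows that \<open>Var G = O(1/n)\<close>. With \<open>\<Phi> x = x ^ 3\<close> this bounds \<open>E F ^ 4\<close>, which makes the fourth moments of
  \<open>F / sqrt n\<close> summable and yields almost sure convergence. With \<open>\<Phi> x = exp (\<i> t x)\<close> the characteristic
  function of \<open>F\<close> satisfies \<open>\<phi>' = - t s \<phi> + o(1)\<close> for \<open>s = lim E G\<close>, whence the central limit
  theorem; the estimators are smooth functions of \<open>F / sqrt n\<close>.\<close>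

text \<open>The solution starts from 0, so its increments are not stationary: the term
  \<open>sqrt (t + s)\<close> perturbs the covariance of the fractional increments, and
  \<open>C i i\<close> differs from 1. Because \<open>c > 0\<close>, this term is smooth on the
  observation window, and that is where the small error comes from. \<open>F\<close> is centred by
  its exact means \<open>3 (C i i)\<^sup>2\<close>; passing to the mean 3 costs a deterministic
  drift that tends to 0. The variances of \<open>F / sqrt n\<close> are only \<open>O(1/n)\<close>,
  hence not summable; this is why fourth moments appear. The covariance matrix may be singular, so a
  joint density need not exist; independence is read off from characteristic functions instead. The
  weights 72 and 24 reflect \<open>x ^ 4 = H4 x + 6 * H2 x + 3\<close> in Hermite polynomials:
  standard variables with correlation \<open>r\<close> have fourth powers with covariance
  \<open>36 * 2 * r ^ 2 + 24 * r ^ 4\<close>. With \<open>S = (\<Sum>i. X i ^ 4) / (3 * n)\<close>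
  the estimators are \<open>\<theta> / S\<close> and \<open>\<sigma>\<^sup>2 * sqrt S\<close>. Their
  derivatives \<open>- \<theta>\<close> and \<open>\<sigma>\<^sup>2 / 2\<close> at
  \<open>S = 1\<close>, together with the factor 1/3 in \<open>S\<close>, produce 1/9 and
  1/36.\<close>

section \<open>Independence from characteristic functions\<close>

text \<open>Adding a constant makes the weight a probability density, so that Levy uniqueness applies.\<close>
lemma (in prob_space) weighted_char_unique:
  fixes Y :: "'a \<Rightarrow> real" and \<zeta> :: "'a \<Rightarrow> complex"
  assumes Y[measurable]: "Y \<in> borel_measurable M" and \<zeta>[measurable]: "\<zeta> \<in> borel_measurable M"
    and bd: "\<And>w. cmod (\<zeta> w) \<le> B"
    and zero: "\<And>b::real. (\<integral>w. \<zeta> w * iexp (b * Y w) \<partial>M) = 0"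
    and A[measurable]: "A \<in> sets borel"
  shows "(\<integral>w. \<zeta> w * indicator A (Y w) \<partial>M) = 0"
proof -
  have real_case: "(\<integral>w. z w * indicator A (Y w) \<partial>M) = 0"
    if z[measurable]: "z \<in> borel_measurable M" and zb: "\<And>w. \<bar>z w\<bar> \<le> B"
      and z0: "\<And>b::real. (\<integral>w. complex_of_real (z w) * iexp (b * Y w) \<partial>M) = 0" for z :: "'a \<Rightarrow> real"
  proof -
    \<comment> \<open>\<open>B\<close> may be 0; the shift keeps the divisor positive.\<close>
    define D where "D = B + 1"
    have "0 \<le> B" using zb[of undefined] by linarith
    then have D: "D > 0" "\<And>w. \<bar>z w\<bar> \<le> D" using zb by (auto simp: D_def intro: order_trans[OF zb])
    have iz: "integrable M z" using zb by (intro integrable_const_bound[of _ B]) auto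
    have ize: "integrable M (\<lambda>w. complex_of_real (z w) * iexp (b * Y w))" for b
      using zb by (intro integrable_const_bound[of _ B]) (auto simp: norm_mult)
    have ie: "integrable M (\<lambda>w. iexp (b * Y w))" for b
      by (intro integrable_const_bound[of _ 1]) auto
    \<comment> \<open>The hypothesis at frequency 0 says that the weight has integral 0, so
      \<open>g\<close> below has total mass 1.\<close>
    have Ez: "(\<integral>w. z w \<partial>M) = 0"
      using z0[of 0] by simp
    define g where "g w = 1 + z w / D" for w
    have w0: "g w \<ge> 0" for w using D(2)[of w] D(1) by (simp add: g_def field_simps)
    have [measurable]: "g \<in> borel_measurable M" unfolding g_def by measurable
    have iw: "integrable M g" unfolding g_def using iz by auto
    have Ew: "(\<integral>w. g w \<partial>M) = 1" unfolding g_def using iz Ez by (simp add: prob_space)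
    define N where "N = density M (\<lambda>w. ennreal (g w))"
    interpret N: prob_space N
      by (rule prob_spaceI) (simp add: N_def emeasure_density nn_integral_eq_integral[OF iw] w0 Ew)
    have YN[measurable]: "Y \<in> borel_measurable N" unfolding N_def by simp
    have rd1: "real_distribution (distr N borel Y)" by (rule N.real_distribution_distr) simp
    have rd2: "real_distribution (distr M borel Y)" by (rule real_distribution_distr) simp
    have "char (distr N borel Y) t = char (distr M borel Y) t" for t
    proof -
      have "char (distr N borel Y) t = (\<integral>w. iexp (t * Y w) \<partial>N)"
        unfolding char_def by (subst integral_distr) auto
      also have "\<dots> = (\<integral>w. g w *\<^sub>R iexp (t * Y w) \<partial>M)"
        unfolding N_def by (subst integral_density) (auto simp: w0)
      also have "\<dots> = (\<integral>w. iexp (t * Y w) + (1/D) * (complex_of_real (z w) * iexp (t * Y w)) \<partial>M)"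
        by (intro Bochner_Integration.integral_cong refl) (simp add: g_def scaleR_conv_of_real field_simps)
      also have "\<dots> = (\<integral>w. iexp (t * Y w) \<partial>M)"
        using ie ize z0 by (subst Bochner_Integration.integral_add) auto
      also have "\<dots> = char (distr M borel Y) t"
        unfolding char_def by (subst integral_distr) auto
      finally show ?thesis .
    qed
    then have eq: "distr N borel Y = distr M borel Y"
      by (intro Levy_uniqueness[OF rd1 rd2] ext)
    have "(\<integral>w. indicator A (Y w) \<partial>N) = (\<integral>w. indicator A (Y w) \<partial>M :: real)"
    proof -
      have "(\<integral>w. indicator A (Y w) \<partial>N) = (\<integral>y. indicator A y \<partial>distr N borel Y :: real)"
        by (subst integral_distr) auto
      also have "\<dots> = (\<integral>w. indicator A (Y w) \<partial>M)" unfolding eq by (subst integral_distr) auto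
      finally show ?thesis .
    qed
    also have "(\<integral>w. indicator A (Y w) \<partial>N) = (\<integral>w. g w * indicator A (Y w) \<partial>M)"
      unfolding N_def by (subst integral_density) (auto simp: w0)
    also have "\<dots> = (\<integral>w. indicator A (Y w) + (1/D) * (z w * indicator A (Y w)) \<partial>M)"
      by (intro Bochner_Integration.integral_cong refl) (simp add: g_def field_simps)
    also have "\<dots> = (\<integral>w. indicator A (Y w) \<partial>M) + (1/D) * (\<integral>w. z w * indicator A (Y w) \<partial>M)"
    proof -
      have "integrable M (\<lambda>w. z w * indicator A (Y w))"
        using zb by (intro integrable_const_bound[of _ B]) (auto simp: abs_mult indicator_def \<open>0\<le>B\<close>)
      moreover have "integrable M (\<lambda>w. indicator A (Y w) :: real)"
        by (intro integrable_const_bound[of _ 1]) (auto simp: indicator_def)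
      ultimately show ?thesis by simp
    qed
    finally show ?thesis using D(1) by simp
  qed
  have re: "(\<integral>w. Re (\<zeta> w) * indicator A (Y w) \<partial>M) = 0"
    if \<zeta>[measurable]: "\<zeta> \<in> borel_measurable M" and bd: "\<And>w. cmod (\<zeta> w) \<le> B"
      and zero: "\<And>b::real. (\<integral>w. \<zeta> w * iexp (b * Y w) \<partial>M) = 0" for \<zeta> :: "'a \<Rightarrow> complex"
  proof (rule real_case)
    fix b :: real
    have i1: "integrable M (\<lambda>w. \<zeta> w * iexp (b * Y w))" for b
      using bd by (intro integrable_const_bound[of _ B]) (auto simp: norm_mult)
    \<comment> \<open>Conjugation turns the hypothesis at \<open>- b\<close> into the one for
      \<open>cnj \<zeta>\<close> at \<open>b\<close>, so the real part of the weight inherits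
      it.\<close>
    have cnj_eq: "cnj (\<zeta> w) * iexp (b * Y w) = cnj (\<zeta> w * iexp ((-b) * Y w))" for w
      by (simp add: exp_cnj)
    have i2: "integrable M (\<lambda>w. cnj (\<zeta> w) * iexp (b * Y w))"
      unfolding cnj_eq by (rule integrable_cnj[OF i1])
    have cnj0: "(\<integral>w. cnj (\<zeta> w) * iexp (b * Y w) \<partial>M) = 0"
      unfolding cnj_eq by (subst Bochner_Integration.integral_cnj) (simp only: zero complex_cnj_zero)
    have "(\<integral>w. complex_of_real (Re (\<zeta> w)) * iexp (b * Y w) \<partial>M)
      = (\<integral>w. (1/2) * (\<zeta> w * iexp (b * Y w) + cnj (\<zeta> w) * iexp (b * Y w)) \<partial>M)"
      by (intro Bochner_Integration.integral_cong refl) (simp flip: distrib_right add: complex_add_cnj)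
    also have "\<dots> = 0"
      by (simp only: integral_mult_right_zero Bochner_Integration.integral_add[OF i1 i2] zero cnj0 add_0_right mult_zero_right)
    finally show "(\<integral>w. complex_of_real (Re (\<zeta> w)) * iexp (b * Y w) \<partial>M) = 0" .
  qed (use bd abs_Re_le_cmod order_trans in \<open>auto, blast\<close>)
  \<comment> \<open>The imaginary part is the real part of \<open>- \<i> * \<zeta>\<close>, which
    satisfies the same hypotheses.\<close>
  have im: "(\<integral>w. Im (\<zeta> w) * indicator A (Y w) \<partial>M) = 0"
    using re[of "\<lambda>w. - \<i> * \<zeta> w"] bd zero by (simp add: norm_mult mult.assoc)
  have "integrable M (\<lambda>w. \<zeta> w * indicator A (Y w))"
  proof -
    have "0 \<le> B" using bd norm_ge_zero order_trans by blast
    then show ?thesis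
      using bd by (intro integrable_const_bound[of _ B]) (auto simp: norm_mult indicator_def)
  qed
  then show ?thesis
    using re[OF \<zeta> bd zero] im
    by (intro complex_eqI) (simp_all flip: integral_Re integral_Im add: indicator_def of_bool_def if_distrib cong: if_cong)
qed

text \<open>One-dimensional uniqueness suffices: the exponentials in the \<open>Y j\<close> are
  traded for indicators one coordinate at a time, all other factors serving as the bounded complex
  weight of \<open>weighted_char_unique\<close>. The exponential in \<open>X\<close> is treated
  last. This yields factorisation on boxes, which generate the product sigma-algebra and are stable
  under intersection.\<close>

lemma (in prob_space) char_indep_product:
  fixes X :: "'a \<Rightarrow> real" and Y :: "'i \<Rightarrow> 'a \<Rightarrow> real"
  assumes J: "finite J" and X[measurable]: "X \<in> borel_measurable M"
    and Y[measurable]: "\<And>j. j \<in> J \<Longrightarrow> Y j \<in> borel_measurable M"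
    and char: "\<And>a b. (\<integral>w. iexp (a * X w + (\<Sum>j\<in>J. b j * Y j w)) \<partial>M)
       = (\<integral>w. iexp (a * X w) \<partial>M) * (\<integral>w. iexp (\<Sum>j\<in>J. b j * Y j w) \<partial>M)"
  shows "distr M (borel \<Otimes>\<^sub>M PiM J (\<lambda>_. borel)) (\<lambda>w. (X w, \<lambda>j\<in>J. Y j w))
    = distr M borel X \<Otimes>\<^sub>M distr M (PiM J (\<lambda>_. borel)) (\<lambda>w. \<lambda>j\<in>J. Y j w)"
proof -
  define YY where "YY = (\<lambda>w. \<lambda>j\<in>J. Y j w)"
  have YY[measurable]: "YY \<in> measurable M (PiM J (\<lambda>_. borel))" unfolding YY_def by measurable
  have box: "\<P>(w in M. X w \<in> B \<and> YY w \<in> Pi\<^sub>E J A) = \<P>(w in M. X w \<in> B) * \<P>(w in M. YY w \<in> Pi\<^sub>E J A)"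
    if A: "\<And>j. j \<in> J \<Longrightarrow> A j \<in> sets borel" and B[measurable]: "B \<in> sets borel" for A and B :: "real set"
  proof -
    have [measurable]: "(\<lambda>w. indicator (A j) (Y j w) :: complex) \<in> borel_measurable M" if "j \<in> J" for j
      using A[OF that] Y[OF that] by measurable
    define cx where "cx a = (\<integral>w. iexp (a * X w) \<partial>M)" for a
    have cx: "cmod (cx a) \<le> 1" for a
      unfolding cx_def by (rule order_trans[OF integral_norm_bound]) (simp add: prob_space)
    let ?z = "\<lambda>a S b w. ((iexp (a * X w) - cx a) * (\<Prod>j\<in>S. indicator (A j) (Y j w))) * iexp (\<Sum>j\<in>J. b j * Y j w)"
    \<comment> \<open>The frequencies \<open>b\<close> stay universally quantified: inserting the
      indicator of coordinate \<open>k\<close> uses the identity for every shift of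
      \<open>b k\<close>.\<close>
    have iter: "\<forall>b. (\<integral>w. ?z a S b w \<partial>M) = 0"
      if "finite S" "S \<subseteq> J" for S a
      using that
    proof (induction S rule: finite_induct)
      case empty
      have "(\<integral>w. (iexp (a * X w) - cx a) * iexp (\<Sum>j\<in>J. b j * Y j w) \<partial>M) = 0" for b
      proof -
        have "(\<integral>w. (iexp (a * X w) - cx a) * iexp (\<Sum>j\<in>J. b j * Y j w) \<partial>M)
          = (\<integral>w. iexp (a * X w + (\<Sum>j\<in>J. b j * Y j w)) - cx a * iexp (\<Sum>j\<in>J. b j * Y j w) \<partial>M)"
          by (intro Bochner_Integration.integral_cong refl) (simp add: algebra_simps exp_add)
        also have "\<dots> = 0"
        proof (subst Bochner_Integration.integral_diff)
          show "integrable M (\<lambda>w. iexp (a * X w + (\<Sum>j\<in>J. b j * Y j w)))"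
            by (intro integrable_const_bound[of _ 1]) (auto simp del: of_real_sum)
          show "integrable M (\<lambda>w. cx a * iexp (\<Sum>j\<in>J. b j * Y j w))"
            by (intro integrable_const_bound[of _ "cmod (cx a)"]) (auto simp: norm_mult simp del: of_real_sum)
        qed (simp only: char integral_mult_right_zero cx_def, simp)
        finally show ?thesis .
      qed
      then show ?case by simp
    next
      case (insert k S)
      show ?case
      proof
        fix b
        define \<zeta> where "\<zeta> = (\<lambda>w. ?z a S b w)"
        have k: "k \<in> J" "S \<subseteq> J" "A k \<in> sets borel" using insert.prems A by auto
        have [measurable]: "\<zeta> \<in> borel_measurable M"
          unfolding \<zeta>_def using k(2) by (measurable, auto)
        have "cmod (\<Prod>j\<in>S. indicator (A j) (Y j w)) \<le> 1" for w
          unfolding prod_norm[symmetric] by (intro prod_le_1) (auto simp: indicator_def)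
        moreover have "cmod (iexp (a * X w) - cx a) \<le> 2" for w
          by (rule order_trans[OF norm_triangle_ineq4]) (use cx[of a] in auto)
        ultimately have "cmod (\<zeta> w) \<le> 2 * 1 * 1" for w
          unfolding \<zeta>_def norm_mult by (intro mult_mono) (auto simp del: of_real_sum)
        then have bdz: "cmod (\<zeta> w) \<le> 2" for w by simp
        have zz: "(\<integral>w. \<zeta> w * iexp (\<beta> * Y k w) \<partial>M) = 0" for \<beta>
        proof -
          have "(\<Sum>j\<in>J. (b(k := b k + \<beta>)) j * Y j w) = (\<Sum>j\<in>J. b j * Y j w) + \<beta> * Y k w" for w
          proof -
            have "(\<Sum>j\<in>J. (b(k := b k + \<beta>)) j * Y j w) = (\<Sum>j\<in>J. b j * Y j w + (if j = k then \<beta> * Y k w else 0))"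
              by (intro sum.cong) (auto simp: algebra_simps)
            then show ?thesis using k J by (simp add: sum.distrib)
          qed
          then have "(\<integral>w. \<zeta> w * iexp (\<beta> * Y k w) \<partial>M) = (\<integral>w. ((iexp (a * X w) - cx a) * (\<Prod>j\<in>S. indicator (A j) (Y j w)))
             * iexp (\<Sum>j\<in>J. (b(k := b k + \<beta>)) j * Y j w) \<partial>M)"
            unfolding \<zeta>_def by (intro Bochner_Integration.integral_cong refl) (simp only: of_real_add distrib_left exp_add mult.assoc)
          also have "\<dots> = 0" using insert.IH k(2) by blast
          finally show ?thesis .
        qed
        have "(\<integral>w. \<zeta> w * indicator (A k) (Y k w) \<partial>M) = 0"
          by (rule weighted_char_unique[OF Y[OF k(1)] _ bdz zz k(3)]) measurable
        then show "(\<integral>w. ?z a (insert k S) b w \<partial>M) = 0"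
          using insert.hyps by (simp add: \<zeta>_def mult_ac del: of_real_sum)
      qed
    qed
    define I where "I w = (\<Prod>j\<in>J. indicator (A j) (Y j w) :: complex)" for w
    have [measurable]: "I \<in> borel_measurable M" unfolding I_def by measurable
    have I1: "cmod (I w) \<le> 1" for w
      unfolding I_def prod_norm[symmetric] by (intro prod_le_1) (auto simp: indicator_def)
    have Iint: "integrable M I" using I1 by (intro integrable_const_bound[of _ 1]) auto
    have IX: "integrable M (\<lambda>w. iexp (a * X w) * I w)" for a
      using I1 by (intro integrable_const_bound[of _ 1]) (auto simp: norm_mult)
    define p where "p = (\<integral>w. I w \<partial>M)"
    have p1: "cmod p \<le> 1"
      unfolding p_def by (rule order_trans[OF integral_norm_bound])
        (rule integral_le_const, use Iint I1 in auto)
    \<comment> \<open>With all indicators in \<open>Y\<close> in place the roles change: the centred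
      product \<open>I - p\<close> is now the weight, and \<open>X\<close> is the variable of the
      exponential.\<close>
    have "(\<integral>w. (I w - p) * iexp (a * X w) \<partial>M) = 0" for a
    proof -
      have "(\<integral>w. (iexp (a * X w) - cx a) * I w \<partial>M) = 0"
        using iter[OF J, of a, THEN spec, of "\<lambda>_. 0"] by (simp add: I_def)
      moreover have "(\<integral>w. (iexp (a * X w) - cx a) * I w \<partial>M) = (\<integral>w. iexp (a * X w) * I w \<partial>M) - cx a * p"
        using IX Iint by (simp add: left_diff_distrib p_def)
      moreover have "(\<integral>w. (I w - p) * iexp (a * X w) \<partial>M) = (\<integral>w. iexp (a * X w) * I w - p * iexp (a * X w) \<partial>M)"
        by (simp add: algebra_simps)
      moreover have "\<dots> = (\<integral>w. iexp (a * X w) * I w \<partial>M) - p * cx a"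
        using IX by (subst Bochner_Integration.integral_diff) (auto simp: cx_def intro!: integrable_mult_right integrable_const_bound[of _ 1])
      ultimately show ?thesis by simp
    qed
    moreover have "cmod (I w - p) \<le> 2" for w
      by (rule order_trans[OF norm_triangle_ineq4]) (use I1[of w] p1 in auto)
    ultimately have "(\<integral>w. (I w - p) * indicator B (X w) \<partial>M) = 0"
      by (intro weighted_char_unique[where B=2]) auto
    moreover have IB: "integrable M (\<lambda>w. I w * indicator B (X w))"
      using I1 by (intro integrable_const_bound[of _ 1]) (auto simp: norm_mult indicator_def)
    moreover have "integrable M (\<lambda>w. indicator B (X w) :: complex)"
      by (intro integrable_const_bound[of _ 1]) (auto simp: norm_mult indicator_def)
    ultimately have *: "(\<integral>w. I w * indicator B (X w) \<partial>M) = p * (\<integral>w. indicator B (X w) \<partial>M)"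
      by (simp add: left_diff_distrib)
    have Ieq: "I w = complex_of_real (indicator {w\<in>space M. YY w \<in> Pi\<^sub>E J A} w)" if "w \<in> space M" for w
    proof (cases "\<forall>j\<in>J. Y j w \<in> A j")
      case True
      then show ?thesis using that by (auto simp: I_def YY_def)
    next
      case False
      then obtain j where "j \<in> J" "Y j w \<notin> A j" by blast
      then have "I w = 0" unfolding I_def using J by (intro prod_zero bexI[of _ j]) auto
      then show ?thesis using \<open>j \<in> J\<close> \<open>Y j w \<notin> A j\<close> by (auto simp: YY_def PiE_iff indicator_def)
    qed
    have YA: "{w\<in>space M. YY w \<in> Pi\<^sub>E J A} \<in> sets M"
      using sets_PiM_I_finite[OF J, of A "\<lambda>_. borel"] A by measurable
    have "p = complex_of_real (\<P>(w in M. YY w \<in> Pi\<^sub>E J A))"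
      unfolding p_def using YA by (subst Bochner_Integration.integral_cong[OF refl Ieq]) auto
    moreover have "(\<integral>w. indicator B (X w) \<partial>M) = complex_of_real (\<P>(w in M. X w \<in> B))"
    proof -
      have "(\<integral>w. indicator B (X w) \<partial>M) = (\<integral>w. complex_of_real (indicator {w\<in>space M. X w \<in> B} w) \<partial>M)"
        by (intro Bochner_Integration.integral_cong refl) (auto simp: indicator_def)
      then show ?thesis by simp
    qed
    moreover have "(\<integral>w. I w * indicator B (X w) \<partial>M) = complex_of_real (\<P>(w in M. X w \<in> B \<and> YY w \<in> Pi\<^sub>E J A))"
    proof -
      have eq: "{w\<in>space M. X w \<in> B \<and> YY w \<in> Pi\<^sub>E J A} = {w\<in>space M. X w \<in> B} \<inter> {w\<in>space M. YY w \<in> Pi\<^sub>E J A}" by auto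
      have "(\<integral>w. I w * indicator B (X w) \<partial>M) = (\<integral>w. complex_of_real (indicator {w\<in>space M. X w \<in> B \<and> YY w \<in> Pi\<^sub>E J A} w) \<partial>M)"
        by (intro Bochner_Integration.integral_cong refl) (auto simp: indicator_def Ieq)
      then show ?thesis using YA by (simp add: eq)
    qed
    ultimately have "complex_of_real (\<P>(w in M. X w \<in> B \<and> YY w \<in> Pi\<^sub>E J A)) =
       complex_of_real (\<P>(w in M. X w \<in> B) * \<P>(w in M. YY w \<in> Pi\<^sub>E J A))"
      using * by (simp add: mult.commute)
    then show ?thesis by (simp only: of_real_eq_iff)
  qed
  interpret DX: prob_space "distr M borel X" by (rule prob_space_distr) simp
  interpret DY: prob_space "distr M (PiM J (\<lambda>_. borel)) YY" by (rule prob_space_distr) simp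
  have rect: "\<P>(w in M. X w \<in> B \<and> YY w \<in> A) = \<P>(w in M. X w \<in> B) * \<P>(w in M. YY w \<in> A)"
    if B[measurable]: "B \<in> sets borel" and A[measurable]: "A \<in> sets (PiM J (\<lambda>_. borel))" for A and B :: "real set"
  proof -
    \<comment> \<open>For fixed \<open>B\<close> both sides are finite measures in \<open>A\<close>,
      so agreement on boxes is enough.\<close>
    define P where "P = distr (density M (\<lambda>w. indicator B (X w))) (PiM J (\<lambda>_. borel)) YY"
    define Q where "Q = density (distr M (PiM J (\<lambda>_. borel)) YY) (\<lambda>_. ennreal (\<P>(w in M. X w \<in> B)))"
    have emP: "emeasure P A = ennreal (\<P>(w in M. X w \<in> B \<and> YY w \<in> A))" if [measurable]: "A \<in> sets (PiM J (\<lambda>_. borel))" for A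
    proof -
      have "emeasure P A = (\<integral>\<^sup>+w. indicator B (X w) * indicator (YY -` A \<inter> space M) w \<partial>M)"
        unfolding P_def by (subst emeasure_distr) (auto simp: emeasure_density)
      also have "\<dots> = (\<integral>\<^sup>+w. indicator {w\<in>space M. X w \<in> B \<and> YY w \<in> A} w \<partial>M)"
        by (intro nn_integral_cong) (auto simp: indicator_def)
      finally show ?thesis by (simp add: emeasure_eq_measure)
    qed
    have emQ: "emeasure Q A = ennreal (\<P>(w in M. X w \<in> B) * \<P>(w in M. YY w \<in> A))" if [measurable]: "A \<in> sets (PiM J (\<lambda>_. borel))" for A
    proof -
      have "{w\<in>space M. YY w \<in> A} = YY -` A \<inter> space M" by auto
      then show ?thesis unfolding Q_def
        by (subst emeasure_density) (auto simp: nn_integral_cmult_indicator emeasure_distr emeasure_eq_measure ennreal_mult)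
    qed
    have "P = Q"
    proof (rule measure_eqI_PiM_finite[OF J])
      show "sets P = sets (PiM J (\<lambda>_. borel :: real measure))" "sets Q = sets (PiM J (\<lambda>_. borel :: real measure))" by (auto simp: P_def Q_def)
      show "emeasure P (Pi\<^sub>E J A) = emeasure Q (Pi\<^sub>E J A)" if "\<And>i. i \<in> J \<Longrightarrow> A i \<in> sets borel" for A
        using that box[OF that B] by (subst emP emQ, auto intro!: sets_PiM_I_finite J)+
      show "range (\<lambda>_::nat. Pi\<^sub>E J (\<lambda>_. UNIV :: real set)) \<subseteq> prod_algebra J (\<lambda>_. borel)"
        using J by (auto intro!: prod_algebraI_finite)
      show "(\<Union>i::nat. Pi\<^sub>E J (\<lambda>_. UNIV)) = space (PiM J (\<lambda>_. borel :: real measure))" by (auto simp: space_PiM)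
      show "emeasure P (Pi\<^sub>E J (\<lambda>_. UNIV)) \<noteq> \<infinity>" for i :: nat
        by (subst emP) (auto intro!: sets_PiM_I_finite J)
    qed
    then have "emeasure P A = emeasure Q A" by simp
    then show ?thesis by (simp add: emP emQ)
  qed
  have "distr M borel X \<Otimes>\<^sub>M distr M (PiM J (\<lambda>_. borel)) YY = distr M (borel \<Otimes>\<^sub>M PiM J (\<lambda>_. borel)) (\<lambda>w. (X w, YY w))"
  proof (rule pair_measure_eqI)
    fix B A assume "B \<in> sets (distr M borel X)" "A \<in> sets (distr M (PiM J (\<lambda>_. borel :: real measure)) YY)"
    then have [measurable]: "B \<in> sets borel" "A \<in> sets (PiM J (\<lambda>_. borel :: real measure))" by auto
    have eq: "X -` B \<inter> space M = {w\<in>space M. X w \<in> B}" "YY -` A \<inter> space M = {w\<in>space M. YY w \<in> A}"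
      "(\<lambda>w. (X w, YY w)) -` (B \<times> A) \<inter> space M = {w\<in>space M. X w \<in> B \<and> YY w \<in> A}" by auto
    show "emeasure (distr M borel X) B * emeasure (distr M (PiM J (\<lambda>_. borel)) YY) A
      = emeasure (distr M (borel \<Otimes>\<^sub>M PiM J (\<lambda>_. borel)) (\<lambda>w. (X w, YY w))) (B \<times> A)"
      by (simp add: emeasure_distr eq emeasure_eq_measure rect flip: ennreal_mult)
  qed (auto intro: DX.sigma_finite_measure_axioms DY.sigma_finite_measure_axioms cong: sets_pair_measure_cong)
  then show ?thesis by (simp add: YY_def)
qed

section \<open>Gaussian integration by parts\<close>

text \<open>Integrating \<open>h\<close> over unit windows \<open>[x, x + 1]\<close> and then over \<open>x\<close> gives, by Fubini, both
  \<open>\<integral> h\<close> and \<open>\<integral> (H (x + 1) - H x) dx = 0\<close>; so no decay of \<open>H\<close> at infinity has to be assumed.\<close>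
lemma integral_derivative_eq_0:
  fixes H h :: "real \<Rightarrow> real"
  assumes deriv: "\<And>x. (H has_real_derivative h x) (at x)" and cont: "continuous_on UNIV h"
    and iH: "integrable lborel H" and ih: "integrable lborel h"
  shows "(\<integral>x. h x \<partial>lborel) = 0"
proof -
  have [measurable]: "h \<in> borel_measurable borel" using cont by (rule borel_measurable_continuous_onI)
  \<comment> \<open>The window condition \<open>x \<le> y \<le> x + 1\<close> is written as
    \<open>x \<in> {y-1..y}\<close>, so that integrating over \<open>x\<close> first returns
    \<open>h y\<close>.\<close>
  have int: "integrable (lborel \<Otimes>\<^sub>M lborel) (\<lambda>(y, x). h y * indicator {y-1..y} x)"
  proof (rule lborel_pair.Fubini_integrable)
    have "(\<lambda>(y, x). h y * indicator {(y, x). y - 1 \<le> x \<and> x \<le> y} (y, x)) \<in> borel_measurable (lborel \<Otimes>\<^sub>M lborel)"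
      by measurable
    then show "(\<lambda>(y, x). h y * indicator {y-1..y} x) \<in> borel_measurable (lborel \<Otimes>\<^sub>M lborel)"
      by (rule measurable_cong[THEN iffD1, rotated]) (auto simp: indicator_def)
    have "(\<integral>x. norm (h y * indicator {y-1..y} x) \<partial>lborel) = \<bar>h y\<bar>" for y
      by (simp add: abs_mult)
    then show "integrable lborel (\<lambda>y. \<integral>x. norm (case (y, x) of (y, x) \<Rightarrow> h y * indicator {y-1..y} x) \<partial>lborel)"
      using ih by simp
    show "AE y in lborel. integrable lborel (\<lambda>x. case (y, x) of (y, x) \<Rightarrow> h y * indicator {y-1..y} x)"
      by simp
  qed
  have FTC: "(\<integral>y. h y * indicator {y-1..y} x \<partial>lborel) = H (x + 1) - H x" for x
  proof -
    have "(\<integral>y. h y * indicator {y-1..y} x \<partial>lborel) = (\<integral>y. h y * indicator {x..x+1} y \<partial>lborel)"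
      by (intro Bochner_Integration.integral_cong refl) (auto simp: indicator_def)
    also have "\<dots> = H (x + 1) - H x"
      using deriv continuous_on_subset[OF cont]
      by (intro integral_FTC_atLeastAtMost[where f=h and F=H, unfolded real_scaleR_def mult.commute[of "indicator _ _"], simplified])
        (auto simp: has_real_derivative_iff_has_vector_derivative intro: has_vector_derivative_at_within)
    finally show ?thesis .
  qed
  have "(\<integral>y. h y \<partial>lborel) = (\<integral>y. (\<integral>x. h y * indicator {y-1..y} x \<partial>lborel) \<partial>lborel)"
    by simp
  also have "\<dots> = (\<integral>x. (\<integral>y. h y * indicator {y-1..y} x \<partial>lborel) \<partial>lborel)"
    using lborel_pair.Fubini_integral[OF int] by simp
  also have "\<dots> = (\<integral>x. H (1 + 1 * x) - H x \<partial>lborel)"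
    by (simp add: FTC add.commute)
  also have "\<dots> = 0"
    using lborel_integral_real_affine[of 1 H 1] lborel_integrable_real_affine[OF iH, of 1 1] iH
    by (subst Bochner_Integration.integral_diff) auto
  finally show ?thesis .
qed

text \<open>The density \<open>?n\<close> has derivative \<open>- x * ?n x / s\<^sup>2\<close>, so
  \<open>?n * f\<close> is an integrable primitive of the difference of the two integrands, divided
  by \<open>s\<^sup>2\<close>.\<close>

lemma normal_density_integration_by_parts:
  fixes f f' :: "real \<Rightarrow> real"
  assumes s: "s > 0" and deriv: "\<And>x. (f has_real_derivative f' x) (at x)" and cont: "continuous_on UNIV f'"
    and i1: "integrable lborel (\<lambda>x. normal_density 0 s x * (x * f x))"
    and i2: "integrable lborel (\<lambda>x. normal_density 0 s x * f x)"
    and i3: "integrable lborel (\<lambda>x. normal_density 0 s x * f' x)"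
  shows "(\<integral>x. normal_density 0 s x * (x * f x) \<partial>lborel) = s\<^sup>2 * (\<integral>x. normal_density 0 s x * f' x \<partial>lborel)"
proof -
  let ?n = "normal_density 0 s"
  have dn: "(?n has_real_derivative - ?n x * x / s\<^sup>2) (at x)" for x
    unfolding normal_density_def using s
    by (auto intro!: derivative_eq_intros simp: field_simps power2_eq_square)
  have cf: "continuous_on UNIV f" by (rule DERIV_continuous_on) (rule has_field_derivative_at_within[OF deriv])
  have cn: "continuous_on UNIV ?n" by (rule DERIV_continuous_on) (rule has_field_derivative_at_within[OF dn])
  have "(\<integral>x. ?n x * f' x - (1 / s\<^sup>2) * (?n x * (x * f x)) \<partial>lborel) = 0"
  proof (rule integral_derivative_eq_0)
    show "((\<lambda>x. ?n x * f x) has_real_derivative ?n x * f' x - (1 / s\<^sup>2) * (?n x * (x * f x))) (at x)" for x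
      by (rule derivative_eq_intros dn deriv refl)+ (simp add: field_simps)
    show "continuous_on UNIV (\<lambda>x. ?n x * f' x - (1 / s\<^sup>2) * (?n x * (x * f x)))"
      by (intro continuous_intros cf cn cont)
  qed (use i1 i2 i3 in auto)
  then show ?thesis using i1 i3 s
    by (subst (asm) Bochner_Integration.integral_diff) (auto simp: field_simps)
qed

section \<open>Finite Gaussian families given by their characteristic functions\<close>

lemma char_normal_density:
  assumes s: "s > 0"
  shows "char (density lborel (normal_density 0 s)) t = complex_of_real (exp (- (s\<^sup>2 * t\<^sup>2) / 2))"
proof -
  let ?N = "std_normal_distribution"
  interpret N: real_distribution ?N by (rule real_dist_normal_dist)
  have "distributed ?N lborel (\<lambda>x. x) std_normal_density"
    unfolding distributed_def by (auto simp: distr_id2)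
  from N.normal_density_affine[OF this _ , of s 0] s
  have "distributed ?N lborel (\<lambda>x. s * x) (normal_density 0 s)" by (simp add: distributed_def)
  then have eq: "density lborel (normal_density 0 s) = distr ?N lborel (\<lambda>x. s * x)"
    by (simp add: distributed_def)
  have "char (density lborel (normal_density 0 s)) t = (\<integral>x. iexp ((t * s) * x) \<partial>?N)"
    unfolding eq char_def by (subst integral_distr) (auto simp: mult_ac)
  also have "\<dots> = complex_of_real (exp (- ((t * s)\<^sup>2) / 2))"
    using fun_cong[OF char_std_normal_distribution, of "t * s"] by (simp add: char_def)
  finally show ?thesis by (simp add: power_mult_distrib mult.commute)
qed

lemma real_distribution_normal_density: "s > 0 \<Longrightarrow> real_distribution (density lborel (normal_density 0 s))"
  using prob_space_normal_density[of s 0] by (simp add: real_distribution_def real_distribution_axioms_def)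

locale gaussian_family = prob_space M for M :: "'a measure" +
  fixes J :: "'i set" and X :: "'i \<Rightarrow> 'a \<Rightarrow> real" and C :: "'i \<Rightarrow> 'i \<Rightarrow> real"
  assumes finite_J: "finite J"
    and X_measurable[measurable]: "\<And>j. j \<in> J \<Longrightarrow> X j \<in> borel_measurable M"
    and C_sym: "\<And>i j. i \<in> J \<Longrightarrow> j \<in> J \<Longrightarrow> C i j = C j i"
    and C_pos: "\<And>i. i \<in> J \<Longrightarrow> C i i > 0"
    and char_comb: "\<And>a. (\<integral>w. iexp (\<Sum>j\<in>J. a j * X j w) \<partial>M)
      = of_real (exp (- (\<Sum>i\<in>J. \<Sum>j\<in>J. a i * a j * C i j) / 2))"
begin

lemma distr_X:
  assumes i: "i \<in> J"
  shows "distr M borel (X i) = density lborel (normal_density 0 (sqrt (C i i)))"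
proof (rule Levy_uniqueness)
  note C = C_pos[OF i]
  show "real_distribution (distr M borel (X i))" using i by (intro real_distribution_distr) auto
  show "real_distribution (density lborel (normal_density 0 (sqrt (C i i))))"
    using C by (intro real_distribution_normal_density) auto
  show "char (distr M borel (X i)) = char (density lborel (normal_density 0 (sqrt (C i i))))"
  proof
    fix t :: real
    define a where "a = (\<lambda>j. if j = i then t else 0)"
    have "char (distr M borel (X i)) t = (\<integral>w. iexp (t * X i w) \<partial>M)"
      unfolding char_def using i by (subst integral_distr) auto
    also have "\<dots> = (\<integral>w. iexp (\<Sum>j\<in>J. a j * X j w) \<partial>M)"
    proof -
      have "(\<Sum>j\<in>J. a j * X j w) = t * X i w" for w
        using i finite_J by (simp add: a_def if_distrib[of "\<lambda>z. z * _"] cong: if_cong)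
      then show ?thesis by simp
    qed
    also have "\<dots> = of_real (exp (- (\<Sum>k\<in>J. \<Sum>j\<in>J. a k * a j * C k j) / 2))" by (rule char_comb)
    also have "(\<Sum>k\<in>J. \<Sum>j\<in>J. a k * a j * C k j) = C i i * t\<^sup>2"
    proof -
      have "(\<Sum>k\<in>J. \<Sum>j\<in>J. a k * a j * C k j) = (\<Sum>k\<in>J. if k = i then (\<Sum>j\<in>J. if j = i then t * t * C i i else 0) else 0)"
        by (intro sum.cong refl) (auto simp: a_def intro!: sum.cong)
      then show ?thesis using i finite_J by (simp add: power2_eq_square)
    qed
    finally show "char (distr M borel (X i)) t = char (density lborel (normal_density 0 (sqrt (C i i)))) t"
      using C by (simp add: char_normal_density)
  qed
qed

text \<open>\<open>X i\<close> is independent of the residuals \<open>X j - (C i j / C i i) X i\<close>; freezing these reduces the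
  claim to one dimension.\<close>
lemma integration_by_parts:
  assumes i: "i \<in> J"
    and \<psi>[measurable]: "\<psi> \<in> borel_measurable (PiM J (\<lambda>_. borel))"
    and D[measurable]: "D \<in> borel_measurable (PiM J (\<lambda>_. borel))"
    and deriv: "\<And>y x. ((\<lambda>x. \<psi> (\<lambda>j\<in>J. y j + x * C i j)) has_real_derivative D (\<lambda>j\<in>J. y j + x * C i j)) (at x)"
    and cont: "\<And>y. continuous_on UNIV (\<lambda>x. D (\<lambda>j\<in>J. y j + x * C i j))"
    and i1: "integrable M (\<lambda>w. X i w * \<psi> (\<lambda>j\<in>J. X j w))"
    and i2: "integrable M (\<lambda>w. \<psi> (\<lambda>j\<in>J. X j w))"
    and i3: "integrable M (\<lambda>w. D (\<lambda>j\<in>J. X j w))"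
  shows "(\<integral>w. X i w * \<psi> (\<lambda>j\<in>J. X j w) \<partial>M) = (\<integral>w. D (\<lambda>j\<in>J. X j w) \<partial>M)"
proof -
  define v where "v = C i i"
  have v: "v > 0" using C_pos[OF i] by (simp add: v_def)
  have [measurable]: "X i \<in> borel_measurable M" using i by measurable
  define Y where "Y j w = X j w - (C i j / v) * X i w" for j w
  define YY where "YY = (\<lambda>w. \<lambda>j\<in>J. Y j w)"
  have Ym[measurable]: "Y j \<in> borel_measurable M" if "j \<in> J" for j unfolding Y_def using that by measurable
  have [measurable]: "YY \<in> measurable M (PiM J (\<lambda>_. borel))" unfolding YY_def by measurable
  define N where "N = distr M (PiM J (\<lambda>_. borel)) YY"
  define G where "G = density lborel (normal_density 0 (sqrt v))"
  have setsN[measurable_cong]: "sets N = sets (PiM J (\<lambda>_. borel))" by (simp add: N_def)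
  have setsG[measurable_cong]: "sets G = sets borel" by (simp add: G_def)
  interpret N: prob_space N unfolding N_def by (rule prob_space_distr) simp
  interpret G: prob_space G unfolding G_def using v by (intro prob_space_normal_density) auto
  interpret GN: pair_prob_space G N ..
  have quad: "(\<Sum>k\<in>J. \<Sum>j\<in>J. (if k = i then a else 0) * (if j = i then a' else 0) * C k j) = a * a' * v" for a a'
  proof -
    have "(\<Sum>k\<in>J. \<Sum>j\<in>J. (if k = i then a else 0) * (if j = i then a' else 0) * C k j)
      = (\<Sum>k\<in>J. if k = i then (\<Sum>j\<in>J. if j = i then a * a' * C i i else 0) else 0)"
      by (intro sum.cong refl) (auto intro!: sum.cong)
    then show ?thesis using i finite_J by (simp add: v_def)
  qed
  \<comment> \<open>The correction \<open>e\<close> at index \<open>i\<close> rewrites a combination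
    of residuals as one of the \<open>X j\<close>. Completing the square leaves no term that mixes
    \<open>a\<close> and \<open>b\<close>, which is the independence of \<open>X i\<close> and the
    residuals.\<close>
  have charXY: "(\<integral>w. iexp (a * X i w + (\<Sum>j\<in>J. b j * Y j w)) \<partial>M)
      = of_real (exp (- (a\<^sup>2 * v + ((\<Sum>k\<in>J. \<Sum>j\<in>J. b k * b j * C k j) - (\<Sum>j\<in>J. b j * C i j)\<^sup>2 / v)) / 2))" for a b
  proof -
    define m where "m = (\<Sum>j\<in>J. b j * C i j)"
    define e where "e = (\<lambda>j. if j = i then a - m / v else 0)"
    have lin: "a * X i w + (\<Sum>j\<in>J. b j * Y j w) = (\<Sum>j\<in>J. (b j + e j) * X j w)" for w
    proof -
      have "(\<Sum>j\<in>J. e j * X j w) = (a - m / v) * X i w"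
        using i finite_J by (simp add: e_def if_distrib[of "\<lambda>z. z * _"] cong: if_cong)
      moreover have "(\<Sum>j\<in>J. b j * Y j w) = (\<Sum>j\<in>J. b j * X j w) - m / v * X i w"
        by (simp add: Y_def m_def right_diff_distrib sum_subtractf sum_divide_distrib sum_distrib_left sum_distrib_right mult_ac)
      ultimately show ?thesis by (simp add: algebra_simps sum.distrib)
    qed
    have s1: "(\<Sum>k\<in>J. \<Sum>j\<in>J. b k * e j * C k j) = (a - m / v) * m"
    proof -
      have "(\<Sum>j\<in>J. b k * e j * C k j) = b k * (a - m / v) * C i k" if "k \<in> J" for k
      proof -
        have "(\<Sum>j\<in>J. b k * e j * C k j) = (\<Sum>j\<in>J. if j = i then b k * (a - m / v) * C k i else 0)"
          by (intro sum.cong) (auto simp: e_def)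
        then show ?thesis using i that finite_J C_sym[of k i] by simp
      qed
      then have "(\<Sum>k\<in>J. \<Sum>j\<in>J. b k * e j * C k j) = (\<Sum>k\<in>J. b k * (a - m / v) * C i k)" by simp
      also have "\<dots> = (a - m / v) * m"
        unfolding m_def sum_distrib_left by (intro sum.cong) (auto simp: mult_ac)
      finally show ?thesis .
    qed
    have s2: "(\<Sum>k\<in>J. \<Sum>j\<in>J. e k * b j * C k j) = (a - m / v) * m"
      unfolding s1[symmetric] by (subst sum.swap) (auto intro!: sum.cong simp: C_sym)
    have s3: "(\<Sum>k\<in>J. \<Sum>j\<in>J. e k * e j * C k j) = (a - m / v)\<^sup>2 * v"
      unfolding e_def quad by (simp add: power2_eq_square)
    have "(\<Sum>k\<in>J. \<Sum>j\<in>J. (b k + e k) * (b j + e j) * C k j)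
      = (\<Sum>k\<in>J. \<Sum>j\<in>J. b k * b j * C k j) + 2 * ((a - m / v) * m) + (a - m / v)\<^sup>2 * v"
      by (simp add: distrib_left distrib_right sum.distrib s1 s2 s3)
    also have "\<dots> = a\<^sup>2 * v + ((\<Sum>k\<in>J. \<Sum>j\<in>J. b k * b j * C k j) - m\<^sup>2 / v)"
      using v by (simp add: power2_eq_square field_simps)
    finally show ?thesis unfolding lin char_comb m_def by simp
  qed
  have "distr M (borel \<Otimes>\<^sub>M PiM J (\<lambda>_. borel)) (\<lambda>w. (X i w, YY w)) = distr M borel (X i) \<Otimes>\<^sub>M N"
    unfolding YY_def N_def
  proof (rule char_indep_product[OF finite_J])
    fix a b
    show "(\<integral>w. iexp (a * X i w + (\<Sum>j\<in>J. b j * Y j w)) \<partial>M)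
       = (\<integral>w. iexp (a * X i w) \<partial>M) * (\<integral>w. iexp (\<Sum>j\<in>J. b j * Y j w) \<partial>M)"
      using charXY[of a "\<lambda>_. 0"] charXY[of 0 b] unfolding charXY[of a b]
      by (simp add: exp_add add_divide_distrib diff_divide_distrib flip: of_real_mult)
        (simp flip: exp_add add: algebra_simps)
  qed simp_all
  then have joint: "distr M (borel \<Otimes>\<^sub>M PiM J (\<lambda>_. borel)) (\<lambda>w. (X i w, YY w)) = G \<Otimes>\<^sub>M N"
    using distr_X[OF i] by (simp add: G_def v_def)
  have sGN[measurable_cong]: "sets (G \<Otimes>\<^sub>M N) = sets (borel \<Otimes>\<^sub>M PiM J (\<lambda>_. borel))"
    unfolding joint[symmetric] by simp
  \<comment> \<open>With frozen residuals \<open>y\<close> the vector is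
    \<open>y j + (x / v) * C i j\<close>. It moves in the direction of the covariance row
    \<open>C i\<close> at speed \<open>1 / v\<close>; this factor cancels the variance
    \<open>v\<close> of the one-dimensional formula.\<close>
  define \<Psi> where "\<Psi> x y = \<psi> (\<lambda>j\<in>J. y j + x / v * C i j)" for x y
  define \<Delta> where "\<Delta> x y = D (\<lambda>j\<in>J. y j + x / v * C i j)" for x y
  have mm: "(\<lambda>p. \<lambda>j\<in>J. snd p j + fst p / v * C i j) \<in> measurable (borel \<Otimes>\<^sub>M PiM J (\<lambda>_. borel)) (PiM J (\<lambda>_. borel))"
    by measurable
  have m1[measurable]: "(\<lambda>p. \<Psi> (fst p) (snd p)) \<in> borel_measurable (borel \<Otimes>\<^sub>M PiM J (\<lambda>_. borel))"
    unfolding \<Psi>_def using measurable_compose[OF mm \<psi>] by simp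
  have m2[measurable]: "(\<lambda>p. \<Delta> (fst p) (snd p)) \<in> borel_measurable (borel \<Otimes>\<^sub>M PiM J (\<lambda>_. borel))"
    unfolding \<Delta>_def using measurable_compose[OF mm D] by simp
  have bk: "(\<lambda>j\<in>J. YY w j + X i w * C i j / v) = (\<lambda>j\<in>J. X j w)" for w
    by (auto simp: YY_def Y_def)
  have tr: "integrable (G \<Otimes>\<^sub>M N) h \<longleftrightarrow> integrable M (\<lambda>w. h (X i w, YY w))"
      "integral\<^sup>L (G \<Otimes>\<^sub>M N) h = (\<integral>w. h (X i w, YY w) \<partial>M)"
    if [measurable]: "h \<in> borel_measurable (borel \<Otimes>\<^sub>M PiM J (\<lambda>_. borel))" for h :: "real \<times> ('i \<Rightarrow> real) \<Rightarrow> real"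
    unfolding joint[symmetric] by (simp_all add: integrable_distr_eq integral_distr)
  have j1: "integrable (G \<Otimes>\<^sub>M N) (\<lambda>(x, y). x * \<Psi> x y)"
    using i1 by (subst tr) (auto simp: case_prod_beta \<Psi>_def bk)
  have j2: "integrable (G \<Otimes>\<^sub>M N) (\<lambda>(x, y). \<Psi> x y)"
    using i2 by (subst tr) (auto simp: case_prod_beta \<Psi>_def bk)
  have j3: "integrable (G \<Otimes>\<^sub>M N) (\<lambda>(x, y). \<Delta> x y)"
    using i3 by (subst tr) (auto simp: case_prod_beta \<Delta>_def bk)
  have sx: "(\<lambda>x. h (x, y)) \<in> borel_measurable borel" if "y \<in> space N" "h \<in> borel_measurable (borel \<Otimes>\<^sub>M PiM J (\<lambda>_. borel))" for y and h :: "real \<times> ('i \<Rightarrow> real) \<Rightarrow> real"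
    using that by (intro measurable_compose[OF measurable_Pair2' that(2)]) (auto simp: N_def)
  \<comment> \<open>Integrability over the product gives integrable sections only for almost every
    \<open>y\<close>.\<close>
  have inner: "AE y in N. (\<integral>x. x * \<Psi> x y \<partial>G) = (\<integral>x. \<Delta> x y \<partial>G)"
    using GN.AE_integrable_snd[OF j1] GN.AE_integrable_snd[OF j2] GN.AE_integrable_snd[OF j3] AE_space
  proof eventually_elim
    case (elim y)
    have [measurable]: "(\<lambda>x. \<Psi> x y) \<in> borel_measurable borel" "(\<lambda>x. \<Delta> x y) \<in> borel_measurable borel"
      using sx[OF elim(4) m1] sx[OF elim(4) m2] by auto
    have iG: "integrable G h \<longleftrightarrow> integrable lborel (\<lambda>x. normal_density 0 (sqrt v) x * h x)"
      if "h \<in> borel_measurable borel" for h :: "real \<Rightarrow> real"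
      unfolding G_def using that by (subst integrable_density) auto
    have i1': "integrable G (\<lambda>x. x * \<Psi> x y)" and i2': "integrable G (\<lambda>x. \<Psi> x y)" and i3': "integrable G (\<lambda>x. \<Delta> x y)"
      using elim(1-3) by (simp_all only: split_conv)
    have "(\<integral>x. normal_density 0 (sqrt v) x * (x * \<Psi> x y) \<partial>lborel) = (sqrt v)\<^sup>2 * (\<integral>x. normal_density 0 (sqrt v) x * (\<Delta> x y / v) \<partial>lborel)"
    proof (rule normal_density_integration_by_parts)
      show "((\<lambda>x. \<Psi> x y) has_real_derivative \<Delta> x y / v) (at x)" for x
      proof -
        have "((\<lambda>x. x / v) has_real_derivative 1 / v) (at x)"
          using v by (auto intro!: derivative_eq_intros)
        from DERIV_chain2[where f="\<lambda>x. \<psi> (\<lambda>j\<in>J. y j + x * C i j)" and g="\<lambda>x. x / v", OF deriv this]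
        show ?thesis unfolding \<Psi>_def \<Delta>_def by simp
      qed
      have "continuous_on UNIV (\<lambda>x. \<Delta> x y)"
        unfolding \<Delta>_def
      proof (rule continuous_on_compose2[OF cont[of y]])
        show "continuous_on UNIV (\<lambda>x. x / v)" using v by (intro continuous_on_divide continuous_on_id continuous_on_const) auto
      qed auto
      then show "continuous_on UNIV (\<lambda>x. \<Delta> x y / v)"
        using v by (intro continuous_on_divide continuous_on_const) auto
      show "integrable lborel (\<lambda>x. normal_density 0 (sqrt v) x * (x * \<Psi> x y))"
        by (rule iG[THEN iffD1, OF _ i1'], measurable)
      show "integrable lborel (\<lambda>x. normal_density 0 (sqrt v) x * \<Psi> x y)"
        by (rule iG[THEN iffD1, OF _ i2'], measurable)
      have "integrable lborel (\<lambda>x. normal_density 0 (sqrt v) x * \<Delta> x y)"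
        by (rule iG[THEN iffD1, OF _ i3'], measurable)
      then show "integrable lborel (\<lambda>x. normal_density 0 (sqrt v) x * (\<Delta> x y / v))" by simp
    qed (use v in simp)
    moreover have "(\<integral>x. x * \<Psi> x y \<partial>G) = (\<integral>x. normal_density 0 (sqrt v) x * (x * \<Psi> x y) \<partial>lborel)"
      unfolding G_def by (subst integral_density) auto
    moreover have "(\<integral>x. \<Delta> x y \<partial>G) = (\<integral>x. normal_density 0 (sqrt v) x * \<Delta> x y \<partial>lborel)"
      unfolding G_def by (subst integral_density) auto
    moreover have "(\<integral>x. normal_density 0 (sqrt v) x * (\<Delta> x y / v) \<partial>lborel) = (\<integral>x. normal_density 0 (sqrt v) x * \<Delta> x y \<partial>lborel) / v"
      by simp
    ultimately show ?case using v by simp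
  qed
  have "(\<integral>w. X i w * \<psi> (\<lambda>j\<in>J. X j w) \<partial>M) = integral\<^sup>L (G \<Otimes>\<^sub>M N) (\<lambda>(x, y). x * \<Psi> x y)"
    by (subst tr) (auto simp: case_prod_beta \<Psi>_def bk)
  also have "\<dots> = (\<integral>y. (\<integral>x. x * \<Psi> x y \<partial>G) \<partial>N)" using GN.integral_snd[OF j1] by simp
  also have "\<dots> = (\<integral>y. (\<integral>x. \<Delta> x y \<partial>G) \<partial>N)"
  proof (rule integral_cong_AE[OF _ _ inner])
    show "(\<lambda>y. \<integral>x. x * \<Psi> x y \<partial>G) \<in> borel_measurable N" "(\<lambda>y. \<integral>x. \<Delta> x y \<partial>G) \<in> borel_measurable N"
      using GN.integrable_snd[OF j1] GN.integrable_snd[OF j3] by auto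
  qed
  also have "\<dots> = integral\<^sup>L (G \<Otimes>\<^sub>M N) (\<lambda>(x, y). \<Delta> x y)" using GN.integral_snd[OF j3] by simp
  also have "\<dots> = (\<integral>w. D (\<lambda>j\<in>J. X j w) \<partial>M)"
    by (subst tr) (auto simp: case_prod_beta \<Delta>_def bk)
  finally show ?thesis .
qed

end

section \<open>Mixed moments of Gaussian families\<close>

text \<open>Unlike integrability, this property passes to products, and bounded measurable functions
  have it. Integrability of polynomials in Gaussian variables times bounded functions can thus be
  read off from the form of the term.\<close>

definition all_moments :: "'a measure \<Rightarrow> ('a \<Rightarrow> real) \<Rightarrow> bool" where
  "all_moments M Z \<longleftrightarrow> Z \<in> borel_measurable M \<and> (\<forall>k::nat. integrable M (\<lambda>w. \<bar>Z w\<bar> ^ k))"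

lemma all_moments_integrable: "all_moments M Z \<Longrightarrow> integrable M Z"
  unfolding all_moments_def by (elim conjE allE[of _ 1]) (auto intro: integrable_abs_cancel)

lemma integrable_between:
  fixes f g :: "'a \<Rightarrow> real"
  assumes "f \<in> borel_measurable M" "\<And>x. 0 \<le> f x" "\<And>x. f x \<le> g x" "integrable M g"
  shows "integrable M f"
proof (rule Bochner_Integration.integrable_bound[OF assms(4,1)])
  have "norm (f x) \<le> norm (g x)" for x using assms(2,3)[of x] by simp
  then show "AE x in M. norm (f x) \<le> norm (g x)" by simp
qed

lemma all_moments_mult[intro]:
  assumes "all_moments M Z" "all_moments M W"
  shows "all_moments M (\<lambda>w. Z w * W w)"
  unfolding all_moments_def
proof (intro conjI allI)
  have [measurable]: "Z \<in> borel_measurable M" "W \<in> borel_measurable M" using assms by (auto simp: all_moments_def)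
  show "(\<lambda>w. Z w * W w) \<in> borel_measurable M" by measurable
  fix k :: nat
  have le: "\<bar>Z w * W w\<bar> ^ k \<le> \<bar>Z w\<bar> ^ (2 * k) + \<bar>W w\<bar> ^ (2 * k)" for w
  proof -
    have "a * b \<le> a\<^sup>2 + b\<^sup>2" for a b :: real
    proof -
      have "a\<^sup>2 + b\<^sup>2 - a * b = ((a - b)\<^sup>2 + a\<^sup>2 + b\<^sup>2) / 2" by (simp add: power2_eq_square field_simps)
      also have "\<dots> \<ge> 0" by simp
      finally show ?thesis by simp
    qed
    from this[of "\<bar>Z w\<bar> ^ k" "\<bar>W w\<bar> ^ k"] show ?thesis
      by (simp add: abs_mult power_mult_distrib mult.commute flip: power_mult)
  qed
  have int: "integrable M (\<lambda>w. \<bar>Z w\<bar> ^ (2 * k) + \<bar>W w\<bar> ^ (2 * k))"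
    using assms by (auto simp: all_moments_def)
  show "integrable M (\<lambda>w. \<bar>Z w * W w\<bar> ^ k)"
    by (rule integrable_between[OF _ _ le int]) auto
qed

lemma all_moments_add[intro]:
  assumes "all_moments M Z" "all_moments M W"
  shows "all_moments M (\<lambda>w. Z w + W w)"
  unfolding all_moments_def
proof (intro conjI allI)
  have [measurable]: "Z \<in> borel_measurable M" "W \<in> borel_measurable M" using assms by (auto simp: all_moments_def)
  show "(\<lambda>w. Z w + W w) \<in> borel_measurable M" by measurable
  fix k :: nat
  have le: "\<bar>Z w + W w\<bar> ^ k \<le> 2 ^ k * (\<bar>Z w\<bar> ^ k + \<bar>W w\<bar> ^ k)" for w
  proof -
    have "\<bar>Z w + W w\<bar> ^ k \<le> (2 * max \<bar>Z w\<bar> \<bar>W w\<bar>) ^ k" by (intro power_mono) auto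
    also have "\<dots> \<le> 2 ^ k * (\<bar>Z w\<bar> ^ k + \<bar>W w\<bar> ^ k)"
      by (auto simp: power_mult_distrib max_def)
    finally show ?thesis .
  qed
  have int: "integrable M (\<lambda>w. 2 ^ k * (\<bar>Z w\<bar> ^ k + \<bar>W w\<bar> ^ k))"
    using assms by (auto simp: all_moments_def)
  show "integrable M (\<lambda>w. \<bar>Z w + W w\<bar> ^ k)"
    by (rule integrable_between[OF _ _ le int]) auto
qed

context prob_space
begin

lemma all_moments_bounded:
  assumes "Z \<in> borel_measurable M" "\<And>w. \<bar>Z w\<bar> \<le> B" shows "all_moments M Z"
  unfolding all_moments_def
proof (intro conjI allI)
  show "integrable M (\<lambda>w. \<bar>Z w\<bar> ^ k)" for k
    using assms by (intro integrable_const_bound[of _ "B ^ k"]) (auto simp: power_abs intro!: power_mono)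
qed fact

lemma all_moments_const[intro, simp]: "all_moments M (\<lambda>w. c)"
  by (rule all_moments_bounded[of _ "\<bar>c\<bar>"]) auto

lemma all_moments_power[intro]: "all_moments M Z \<Longrightarrow> all_moments M (\<lambda>w. Z w ^ (k::nat))"
  by (induction k) auto

lemma all_moments_diff[intro]: "all_moments M Z \<Longrightarrow> all_moments M W \<Longrightarrow> all_moments M (\<lambda>w. Z w - W w)"
  using all_moments_add[of M Z "\<lambda>w. (-1) * W w"] all_moments_mult[of M "\<lambda>_. -1" W] by auto

lemma all_moments_sum[intro]: "(\<And>i. i \<in> I \<Longrightarrow> all_moments M (Z i)) \<Longrightarrow> all_moments M (\<lambda>w. \<Sum>i\<in>I. Z i w)"
  by (induction I rule: infinite_finite_induct) auto

end

text \<open>Induction step of the moment bounds: integration by parts replaces a moment of degree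
  \<open>n\<close> by \<open>n - 1\<close> moments of degree \<open>n - 2\<close>, each with a
  covariance factor of size at most \<open>B\<close>. For \<open>n < 2\<close> the left side is 0,
  so truncated subtraction does no harm.\<close>

lemma factorial_power_step:
  fixes B :: real
  assumes B: "B \<ge> 1"
  shows "real (n - 1) * (B * (fact (n - 2) * B ^ (n - 2))) \<le> fact n * B ^ n"
proof (cases "n \<ge> 2")
  case True
  define p where "p = n - 2"
  have p: "n = Suc (Suc p)" using True by (simp add: p_def)
  have "real (n - 1) * (B * (fact (n - 2) * B ^ (n - 2))) = (real (Suc p) * fact p) * B ^ Suc p" by (simp add: p)
  also have "\<dots> \<le> fact (Suc (Suc p)) * B ^ Suc (Suc p)"
    using B by (intro mult_mono power_increasing) (auto simp: fact_Suc intro!: mult_right_mono)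
  finally show ?thesis by (simp only: p)
next
  case False
  then have "n - 1 = 0" by simp
  then show ?thesis using B by simp
qed

lemma DERIV_mult4:
  fixes p q r s :: "real \<Rightarrow> real"
  assumes "(p has_real_derivative p') (at x)" "(q has_real_derivative q') (at x)"
    "(r has_real_derivative r') (at x)" "(s has_real_derivative s') (at x)"
  shows "((\<lambda>x. p x * q x * r x * s x) has_real_derivative
    p' * q x * r x * s x + p x * q' * r x * s x + p x * q x * r' * s x + p x * q x * r x * s') (at x)"
  by (rule derivative_eq_intros assms refl)+ (simp add: algebra_simps)

context gaussian_family
begin

lemma all_moments_X[intro]:
  assumes i: "i \<in> J" shows "all_moments M (X i)"
proof -
  have [measurable]: "X i \<in> borel_measurable M" using i by measurable
  have "integrable M (\<lambda>w. \<bar>X i w\<bar> ^ k)" for k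
  proof -
    have "integrable (distr M borel (X i)) (\<lambda>x. \<bar>x\<bar> ^ k)"
      unfolding distr_X[OF i] using integrable_normal_moment_abs[of "sqrt (C i i)" 0 k] C_pos[OF i]
      by (simp add: integrable_density)
    then show ?thesis by (subst (asm) integrable_distr_eq) auto
  qed
  then show ?thesis by (simp add: all_moments_def)
qed

text \<open>This is the Wick recursion: the extra factor \<open>X i\<close> is paired with each
  remaining factor in turn. Four variables are what the covariance of two summands of the Stein
  kernel involves, and indices may coincide. A truncated exponent such as \<open>a - 1\<close> at
  \<open>a = 0\<close> has coefficient 0.\<close>

lemma mixed_moment_Suc:
  assumes J: "i \<in> J" "j \<in> J" "k \<in> J" "l \<in> J"
  shows "(\<integral>w. X i w ^ Suc a * X j w ^ b * X k w ^ c * X l w ^ d \<partial>M)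
    = real a * C i i * (\<integral>w. X i w ^ (a - 1) * X j w ^ b * X k w ^ c * X l w ^ d \<partial>M)
    + real b * C i j * (\<integral>w. X i w ^ a * X j w ^ (b - 1) * X k w ^ c * X l w ^ d \<partial>M)
    + real c * C i k * (\<integral>w. X i w ^ a * X j w ^ b * X k w ^ (c - 1) * X l w ^ d \<partial>M)
    + real d * C i l * (\<integral>w. X i w ^ a * X j w ^ b * X k w ^ c * X l w ^ (d - 1) \<partial>M)"
proof -
  define \<psi> :: "('i \<Rightarrow> real) \<Rightarrow> real" where "\<psi> y = y i ^ a * y j ^ b * y k ^ c * y l ^ d" for y
  define D :: "('i \<Rightarrow> real) \<Rightarrow> real" where "D y = real a * C i i * (y i ^ (a - 1) * y j ^ b * y k ^ c * y l ^ d)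
    + real b * C i j * (y i ^ a * y j ^ (b - 1) * y k ^ c * y l ^ d)
    + real c * C i k * (y i ^ a * y j ^ b * y k ^ (c - 1) * y l ^ d)
    + real d * C i l * (y i ^ a * y j ^ b * y k ^ c * y l ^ (d - 1))" for y
  have m: "all_moments M (\<lambda>w. X i w ^ a * X j w ^ b * X k w ^ c * X l w ^ d)" for a b c d
    by (intro all_moments_mult all_moments_power all_moments_X J)
  note mi = all_moments_integrable[OF m]
  have "(\<integral>w. X i w * \<psi> (\<lambda>j\<in>J. X j w) \<partial>M) = (\<integral>w. D (\<lambda>j\<in>J. X j w) \<partial>M)"
  proof (rule integration_by_parts[OF J(1)])
    show "\<psi> \<in> borel_measurable (PiM J (\<lambda>_. borel))" "D \<in> borel_measurable (PiM J (\<lambda>_. borel))"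
      unfolding \<psi>_def D_def using J by measurable
    show "((\<lambda>x. \<psi> (\<lambda>j\<in>J. y j + x * C i j)) has_real_derivative D (\<lambda>j\<in>J. y j + x * C i j)) (at x)" for y x
    proof -
      have "((\<lambda>x. (y j + x * C i j) ^ n) has_real_derivative real n * C i j * (y j + x * C i j) ^ (n - 1)) (at x)" for j n
        by (auto intro!: derivative_eq_intros)
      from DERIV_mult4[OF this[of i a] this[of j b] this[of k c] this[of l d]]
      show ?thesis unfolding \<psi>_def D_def using J by (simp only: restrict_apply' mult_ac)
    qed
    show "continuous_on UNIV (\<lambda>x. D (\<lambda>j\<in>J. y j + x * C i j))" for y
      unfolding D_def using J by (auto intro!: continuous_intros)
    show "integrable M (\<lambda>w. X i w * \<psi> (\<lambda>j\<in>J. X j w))"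
      using mi[of "Suc a" b c d] J by (simp add: \<psi>_def mult_ac)
    show "integrable M (\<lambda>w. \<psi> (\<lambda>j\<in>J. X j w))" "integrable M (\<lambda>w. D (\<lambda>j\<in>J. X j w))"
      using mi J by (simp_all add: \<psi>_def D_def)
  qed
  then show ?thesis using J mi by (simp add: \<psi>_def D_def mult.assoc)
qed

text \<open>The recursion lowers the total degree by two; the factorial generously counts the
  pairings. The indices are generalised in the induction because the recursion acts on the first
  factor, and any factor with positive exponent can be moved there.\<close>

lemma mixed_moment_bound:
  assumes J: "i \<in> J" "j \<in> J" "k \<in> J" "l \<in> J" and B: "B \<ge> 1" and CB: "\<And>i j. i \<in> J \<Longrightarrow> j \<in> J \<Longrightarrow> \<bar>C i j\<bar> \<le> B"
  shows "\<bar>\<integral>w. X i w ^ a * X j w ^ b * X k w ^ c * X l w ^ d \<partial>M\<bar> \<le> fact (a + b + c + d) * B ^ (a + b + c + d)"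
  using J
proof (induction "a + b + c + d" arbitrary: a b c d i j k l rule: less_induct)
  case less
  define m where "m i j k l a b c d = (\<integral>w. X i w ^ a * X j w ^ b * X k w ^ c * X l w ^ d \<partial>M)" for i j k l a b c d
  define n where "n = a + b + c + d"
  have step: "\<bar>m i j k l (Suc a) b c d\<bar> \<le> fact n * B ^ n"
    if n: "n = Suc a + b + c + d" and J: "i \<in> J" "j \<in> J" "k \<in> J" "l \<in> J" for i j k l a b c d
  proof -
    define f where "f = (fact (n - 2) * B ^ (n - 2) :: real)"
    have f0: "f \<ge> 0" using B by (simp add: f_def)
    have IH: "\<bar>m i j k l a' b' c' d'\<bar> \<le> f" if "Suc (Suc (a' + b' + c' + d')) = n" for a' b' c' d'
    proof -
      have "a' + b' + c' + d' = n - 2" "a' + b' + c' + d' < n" using that by auto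
      then show ?thesis unfolding f_def m_def using less.hyps[OF _ J, of a' b' c' d'] n_def by simp
    qed
    have t: "\<bar>real p * C i x * m i j k l a' b' c' d'\<bar> \<le> real p * (B * f)"
      if "x \<in> J" "p > 0 \<Longrightarrow> Suc (Suc (a' + b' + c' + d')) = n" for p x a' b' c' d'
    proof (cases "p = 0")
      case False
      then show ?thesis using CB[OF J(1) that(1)] IH[OF that(2)] B
        by (auto simp: abs_mult mult.assoc intro!: mult_left_mono mult_mono)
    qed simp
    have "\<bar>m i j k l (Suc a) b c d\<bar> \<le> real a * (B * f) + real b * (B * f) + real c * (B * f) + real d * (B * f)"
      unfolding m_def mixed_moment_Suc[OF J] unfolding m_def[symmetric]
      by (intro order_trans[OF abs_triangle_ineq] add_mono t) (use J n in auto)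
    also have "\<dots> = real (n - 1) * (B * f)" using n by (simp add: algebra_simps)
    also have "\<dots> \<le> fact n * B ^ n" unfolding f_def by (rule factorial_power_step[OF B])
    finally show ?thesis .
  qed
  have *: "\<bar>m i j k l a b c d\<bar> \<le> fact n * B ^ n"
  proof (cases "a = 0 \<and> b = 0 \<and> c = 0 \<and> d = 0")
    case True
    then show ?thesis by (simp add: m_def n_def prob_space)
  next
    case False
    then consider a' where "a = Suc a'" | b' where "b = Suc b'" | c' where "c = Suc c'" | d' where "d = Suc d'"
      using not0_implies_Suc by blast
    then show ?thesis
    proof cases
      case 1
      then show ?thesis using step[of a' b c d i j k l] less.prems n_def by simp
    next
      case 2
      have "m i j k l a b c d = m j i k l (Suc b') a c d" by (simp only: m_def 2 mult_ac)
      then show ?thesis using step[of b' a c d j i k l] less.prems n_def 2 by simp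
    next
      case 3
      have "m i j k l a b c d = m k j i l (Suc c') b a d" by (simp only: m_def 3 mult_ac)
      then show ?thesis using step[of c' b a d k j i l] less.prems n_def 3 by simp
    next
      case 4
      have "m i j k l a b c d = m l j k i (Suc d') b c a" by (simp only: m_def 4 mult_ac)
      then show ?thesis using step[of d' b c a l j k i] less.prems n_def 4 by simp
    qed
  qed
  then show ?case by (simp add: m_def n_def)
qed

text \<open>Pairing a factor of the first group \<open>i, j\<close> inside that group gives the same
  difference in lower degree, and pairing it with the second group \<open>k, l\<close> gives a
  factor bounded by \<open>\<delta>\<close>. Hence the induction runs on \<open>a + b\<close> only,
  until the first group is empty and the difference is 0.\<close>

lemma mixed_covariance_bound:
  assumes J: "i \<in> J" "j \<in> J" "k \<in> J" "l \<in> J" and B: "B \<ge> 1" and CB: "\<And>i j. i \<in> J \<Longrightarrow> j \<in> J \<Longrightarrow> \<bar>C i j\<bar> \<le> B"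
    and \<delta>: "\<bar>C i k\<bar> \<le> \<delta>" "\<bar>C i l\<bar> \<le> \<delta>" "\<bar>C j k\<bar> \<le> \<delta>" "\<bar>C j l\<bar> \<le> \<delta>"
  shows "\<bar>(\<integral>w. X i w ^ a * X j w ^ b * X k w ^ c * X l w ^ d \<partial>M)
      - (\<integral>w. X i w ^ a * X j w ^ b \<partial>M) * (\<integral>w. X k w ^ c * X l w ^ d \<partial>M)\<bar>
    \<le> fact (a + b + c + d) * B ^ (a + b + c + d) * \<delta>"
  using J \<delta>
proof (induction "a + b" arbitrary: a b i j rule: less_induct)
  case less
  define m where "m i j a b c d = (\<integral>w. X i w ^ a * X j w ^ b * X k w ^ c * X l w ^ d \<partial>M)" for i j a b c d
  define q where "q = m k k 0 0 c d"
  define n where "n = a + b + c + d"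
  have \<delta>0: "\<delta> \<ge> 0" using less.prems(5) by linarith
  have step: "\<bar>m i j (Suc a) b c d - m i j (Suc a) b 0 0 * q\<bar> \<le> fact n * B ^ n * \<delta>"
    if n: "n = Suc a + b + c + d" and J: "i \<in> J" "j \<in> J" and \<delta>: "\<bar>C i k\<bar> \<le> \<delta>" "\<bar>C i l\<bar> \<le> \<delta>" "\<bar>C j k\<bar> \<le> \<delta>" "\<bar>C j l\<bar> \<le> \<delta>" for i j a b
  proof -
    note J' = J less.prems(3,4)
    define f where "f = (fact (n - 2) * B ^ (n - 2) :: real)"
    have f0: "f \<ge> 0" using B by (simp add: f_def)
    have IH: "\<bar>m i j a' b' c d - m i j a' b' 0 0 * q\<bar> \<le> f * \<delta>" if "Suc (Suc (a' + b' + c + d)) = n" for a' b'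
    proof -
      have e: "a' + b' + c + d = n - 2" "a' + b' < Suc a + b" using that n by auto
      have "a' + b' < a + b" if "n = a + b + c + d" for a b using e(2) that n by simp
      then show ?thesis unfolding f_def m_def q_def e(1)[symmetric] using less.hyps[OF _ J' \<delta>, of a' b'] n_def by simp
    qed
    have mb: "\<bar>m i j a' b' c' d'\<bar> \<le> f" if "Suc (Suc (a' + b' + c' + d')) = n" for a' b' c' d'
    proof -
      have "a' + b' + c' + d' = n - 2" using that by auto
      then show ?thesis unfolding f_def m_def using mixed_moment_bound[OF J' B CB, of a' b' c' d'] by simp
    qed
    have t: "\<bar>real p * C i x * (m i j a' b' c d - m i j a' b' 0 0 * q)\<bar> \<le> real p * (B * f * \<delta>)"
      if "x \<in> J" "p > 0 \<Longrightarrow> Suc (Suc (a' + b' + c + d)) = n" for p x a' b'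
    proof (cases "p = 0")
      case False
      then show ?thesis using CB[OF J(1) that(1)] IH[OF that(2)] B
        by (auto simp: abs_mult mult.assoc intro!: mult_left_mono mult_mono)
    qed simp
    have t2: "\<bar>real p * C i x * m i j a' b' c' d'\<bar> \<le> real p * (B * f * \<delta>)"
      if "\<bar>C i x\<bar> \<le> \<delta>" "p > 0 \<Longrightarrow> Suc (Suc (a' + b' + c' + d')) = n" for p x a' b' c' d'
    proof (cases "p = 0")
      case False
      then have "\<bar>C i x\<bar> * \<bar>m i j a' b' c' d'\<bar> \<le> \<delta> * f" using that(1) mb[OF that(2)] \<delta>0
        by (intro mult_mono) auto
      also have "\<dots> \<le> B * (f * \<delta>)" using mult_right_mono[OF B, of "f * \<delta>"] f0 \<delta>0 by (simp add: mult.commute)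
      finally show ?thesis by (simp add: abs_mult mult.assoc mult_left_mono)
    qed simp
    \<comment> \<open>The recursion is applied to both moments. The two cross terms, with
      \<open>C i k\<close> and \<open>C i l\<close>, have no counterpart in the product, where their
      coefficients are 0.\<close>
    have "m i j (Suc a) b c d - m i j (Suc a) b 0 0 * q
      = real a * C i i * (m i j (a - 1) b c d - m i j (a - 1) b 0 0 * q)
      + real b * C i j * (m i j a (b - 1) c d - m i j a (b - 1) 0 0 * q)
      + real c * C i k * m i j a b (c - 1) d + real d * C i l * m i j a b c (d - 1)"
      unfolding m_def mixed_moment_Suc[OF J'] by (simp add: algebra_simps)
    also have "\<bar>\<dots>\<bar> \<le> real a * (B * f * \<delta>) + real b * (B * f * \<delta>) + real c * (B * f * \<delta>) + real d * (B * f * \<delta>)"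
      by (intro order_trans[OF abs_triangle_ineq] add_mono t t2) (use J' n \<delta> in auto)
    also have "\<dots> = real (n - 1) * (B * f) * \<delta>" using n by (simp add: algebra_simps)
    also have "\<dots> \<le> fact n * B ^ n * \<delta>"
      unfolding f_def by (intro mult_right_mono factorial_power_step[OF B] \<delta>0)
    finally show ?thesis .
  qed
  have *: "\<bar>m i j a b c d - m i j a b 0 0 * q\<bar> \<le> fact n * B ^ n * \<delta>"
  proof (cases "a = 0 \<and> b = 0")
    case True
    then show ?thesis using B \<delta>0 by (simp add: m_def n_def q_def prob_space)
  next
    case False
    then consider a' where "a = Suc a'" | b' where "b = Suc b'"
      using not0_implies_Suc by blast
    then show ?thesis
    proof cases
      case 1
      then show ?thesis using step[of a' b i j] less.prems n_def by simp
    next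
      case 2
      have "m i j a b c d = m j i (Suc b') a c d" for c d by (simp only: m_def 2 mult_ac)
      then show ?thesis using step[of b' a j i] less.prems n_def 2 by simp
    qed
  qed
  then show ?case by (simp add: m_def n_def q_def)
qed

end

section \<open>The Stein identity for quartic sums\<close>

context gaussian_family
begin

definition quartic_fluct :: "real \<Rightarrow> 'a \<Rightarrow> real" where
  "quartic_fluct \<kappa> w = \<kappa> * (\<Sum>i\<in>J. X i w ^ 4 - 3 * (C i i)\<^sup>2)"

text \<open>This is the kernel \<open><DF, - D L^{-1} F>\<close> of the Malliavin-Stein method. The
  derivative of \<open>F\<close> along the covariance row \<open>C i\<close> is
  \<open>4 * \<kappa> * (\<Sum>j. C i j * X j ^ 3)\<close>, and \<open>x ^ 3 + 3 * v * x\<close>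
  with \<open>v = C i i\<close> is minus the derivative of the inverse Ornstein-Uhlenbeck operator
  applied to \<open>x ^ 4 - 3 * v\<^sup>2\<close>.\<close>

definition stein_kernel :: "real \<Rightarrow> 'a \<Rightarrow> real" where
  "stein_kernel \<kappa> w = 4 * \<kappa>\<^sup>2 * (\<Sum>i\<in>J. \<Sum>j\<in>J. C i j * ((X i w ^ 3 + 3 * C i i * X i w) * X j w ^ 3))"

lemma all_moments_quartic_fluct: "all_moments M (quartic_fluct \<kappa>)"
  unfolding quartic_fluct_def
  by (intro all_moments_mult all_moments_const all_moments_sum all_moments_diff all_moments_power all_moments_X)

lemma all_moments_stein_kernel: "all_moments M (stein_kernel \<kappa>)"
  unfolding stein_kernel_def
  by (intro all_moments_mult all_moments_const all_moments_sum all_moments_add all_moments_power all_moments_X)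

text \<open>With \<open>v = C i i\<close> and \<open>g x = x ^ 3 + 3 v x\<close> one has \<open>x ^ 4 - 3 v\<^sup>2 = x g x - v g' x\<close>, so
  integration by parts only differentiates the test function.\<close>
lemma stein_identity:
  assumes deriv: "\<And>x. (\<Phi> has_real_derivative \<Phi>' x) (at x)" and cont: "continuous_on UNIV \<Phi>'"
    and m: "all_moments M (\<lambda>w. \<Phi> (quartic_fluct \<kappa> w))" and m': "all_moments M (\<lambda>w. \<Phi>' (quartic_fluct \<kappa> w))"
  shows "(\<integral>w. quartic_fluct \<kappa> w * \<Phi> (quartic_fluct \<kappa> w) \<partial>M) = (\<integral>w. stein_kernel \<kappa> w * \<Phi>' (quartic_fluct \<kappa> w) \<partial>M)"
proof -
  let ?F = "quartic_fluct \<kappa>"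
  have c\<Phi>: "continuous_on UNIV \<Phi>" by (rule DERIV_continuous_on) (rule has_field_derivative_at_within[OF deriv])
  have [measurable]: "\<Phi> \<in> borel_measurable borel" "\<Phi>' \<in> borel_measurable borel"
    using c\<Phi> cont by (auto intro: borel_measurable_continuous_onI)
  let ?A = "\<lambda>i w. (X i w ^ 4 - 3 * (C i i)\<^sup>2) * \<Phi> (?F w)"
    and ?B = "\<lambda>i w. 4 * \<kappa> * (\<Sum>j\<in>J. C i j * ((X i w ^ 3 + 3 * C i i * X i w) * X j w ^ 3)) * \<Phi>' (?F w)"
  have single: "(\<integral>w. ?A i w \<partial>M)
    = (\<integral>w. ?B i w \<partial>M)"
    if i: "i \<in> J" for i
  proof -
    define v where "v = C i i"
    define f :: "('i \<Rightarrow> real) \<Rightarrow> real" where "f y = \<kappa> * (\<Sum>j\<in>J. y j ^ 4 - 3 * (C j j)\<^sup>2)" for y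
    define f' :: "('i \<Rightarrow> real) \<Rightarrow> real" where "f' y = \<kappa> * (\<Sum>j\<in>J. 4 * C i j * y j ^ 3)" for y
    define \<psi> where "\<psi> y = (y i ^ 3 + 3 * v * y i) * \<Phi> (f y)" for y
    define D where "D y = v * (3 * y i ^ 2 + 3 * v) * \<Phi> (f y) + (y i ^ 3 + 3 * v * y i) * (\<Phi>' (f y) * f' y)" for y
    have fF: "f (\<lambda>j\<in>J. X j w) = ?F w" for w by (simp add: f_def quartic_fluct_def)
    have [measurable]: "f \<in> borel_measurable (PiM J (\<lambda>_. borel))" "f' \<in> borel_measurable (PiM J (\<lambda>_. borel))"
      unfolding f_def f'_def by measurable
    have DF: "D (\<lambda>j\<in>J. X j w) = v * (3 * X i w ^ 2 + 3 * v) * \<Phi> (?F w)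
        + 4 * \<kappa> * (\<Sum>j\<in>J. C i j * ((X i w ^ 3 + 3 * v * X i w) * X j w ^ 3)) * \<Phi>' (?F w)" for w
      using i unfolding D_def fF by (simp add: f'_def sum_distrib_left sum_distrib_right mult_ac)
    have a1: "all_moments M (\<lambda>w. v * (3 * X i w ^ 2 + 3 * v) * \<Phi> (?F w))"
      using i by (intro all_moments_mult all_moments_const all_moments_add all_moments_power all_moments_X m)
    have a2: "all_moments M (\<lambda>w. 4 * \<kappa> * (\<Sum>j\<in>J. C i j * ((X i w ^ 3 + 3 * v * X i w) * X j w ^ 3)) * \<Phi>' (?F w))"
      using i by (intro all_moments_mult all_moments_const all_moments_add all_moments_sum all_moments_power all_moments_X m')
    have a3: "all_moments M (\<lambda>w. (X i w ^ 3 + 3 * v * X i w) * \<Phi> (?F w))"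
      using i by (intro all_moments_mult all_moments_const all_moments_add all_moments_power all_moments_X m)
    have "(\<integral>w. X i w * \<psi> (\<lambda>j\<in>J. X j w) \<partial>M) = (\<integral>w. D (\<lambda>j\<in>J. X j w) \<partial>M)"
    proof (rule integration_by_parts[OF i])
      show "\<psi> \<in> borel_measurable (PiM J (\<lambda>_. borel))" "D \<in> borel_measurable (PiM J (\<lambda>_. borel))"
        unfolding \<psi>_def D_def using i by measurable
      fix y :: "'i \<Rightarrow> real"
      have fr: "f (\<lambda>j\<in>J. y j + x * C i j) = \<kappa> * (\<Sum>j\<in>J. (y j + x * C i j) ^ 4 - 3 * (C j j)\<^sup>2)"
        "f' (\<lambda>j\<in>J. y j + x * C i j) = \<kappa> * (\<Sum>j\<in>J. 4 * C i j * (y j + x * C i j) ^ 3)" for x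
        by (simp_all add: f_def f'_def)
      have df: "((\<lambda>x. f (\<lambda>j\<in>J. y j + x * C i j)) has_real_derivative f' (\<lambda>j\<in>J. y j + x * C i j)) (at x)" for x
        unfolding fr
      proof (intro DERIV_cmult DERIV_sum)
        show "((\<lambda>x. (y j + x * C i j) ^ 4 - 3 * (C j j)\<^sup>2) has_real_derivative 4 * C i j * (y j + x * C i j) ^ 3) (at x)" for j
          by (auto intro!: derivative_eq_intros simp: mult_ac)
      qed
      have cf: "continuous_on UNIV (\<lambda>x. f (\<lambda>j\<in>J. y j + x * C i j))" "continuous_on UNIV (\<lambda>x. f' (\<lambda>j\<in>J. y j + x * C i j))"
        unfolding fr by (intro continuous_intros)+
      have g: "((\<lambda>x. (y i + x * v) ^ 3 + 3 * v * (y i + x * v)) has_real_derivative v * (3 * (y i + x * v) ^ 2 + 3 * v)) (at x)" for x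
        by (auto intro!: derivative_eq_intros simp: algebra_simps)
      show "((\<lambda>x. \<psi> (\<lambda>j\<in>J. y j + x * C i j)) has_real_derivative D (\<lambda>j\<in>J. y j + x * C i j)) (at x)" for x
        using DERIV_mult[OF g DERIV_chain2[OF deriv df], of x] i
        by (simp add: \<psi>_def D_def v_def mult_ac add_ac)
      have "continuous_on UNIV (\<lambda>x. \<Phi> (f (\<lambda>j\<in>J. y j + x * C i j)))" "continuous_on UNIV (\<lambda>x. \<Phi>' (f (\<lambda>j\<in>J. y j + x * C i j)))"
        by (rule continuous_on_compose2[OF c\<Phi> cf(1)], simp) (rule continuous_on_compose2[OF cont cf(1)], simp)
      then show "continuous_on UNIV (\<lambda>x. D (\<lambda>j\<in>J. y j + x * C i j))"
        unfolding D_def using i cf(2) by (simp only: restrict_apply') (intro continuous_intros; assumption)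
    next
      have eq: "X i w * \<psi> (\<lambda>j\<in>J. X j w) = X i w * ((X i w ^ 3 + 3 * v * X i w) * \<Phi> (?F w))" for w
        using i by (simp add: \<psi>_def fF)
      show "integrable M (\<lambda>w. X i w * \<psi> (\<lambda>j\<in>J. X j w))"
        unfolding eq using i a3 by (intro all_moments_integrable all_moments_mult[OF all_moments_X])
      show "integrable M (\<lambda>w. \<psi> (\<lambda>j\<in>J. X j w))"
        using all_moments_integrable[OF a3] i by (simp add: \<psi>_def fF)
      show "integrable M (\<lambda>w. D (\<lambda>j\<in>J. X j w))"
        unfolding DF using a1 a2 by (intro all_moments_integrable all_moments_add)
    qed
    \<comment> \<open>The last term is \<open>v\<close> times the derivative of
      \<open>x ^ 3 + 3 * v * x\<close>, times the test function. It also occurs in \<open>D\<close>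
      and cancels there.\<close>
    moreover have "X i w * \<psi> (\<lambda>j\<in>J. X j w) = (X i w ^ 4 - 3 * v\<^sup>2) * \<Phi> (?F w) + v * (3 * X i w ^ 2 + 3 * v) * \<Phi> (?F w)" for w
      using i by (simp add: \<psi>_def fF algebra_simps power2_eq_square power3_eq_cube power4_eq_xxxx)
    moreover have "integrable M (\<lambda>w. (X i w ^ 4 - 3 * v\<^sup>2) * \<Phi> (?F w))"
      using i by (intro all_moments_integrable all_moments_mult all_moments_const all_moments_diff all_moments_power all_moments_X m)
    ultimately show ?thesis
      unfolding DF v_def[symmetric]
      using all_moments_integrable[OF a1] all_moments_integrable[OF a2]
      by (simp add: Bochner_Integration.integral_add)
  qed
  have b1: "integrable M (\<lambda>w. ?A i w)" if "i \<in> J" for i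
    using that by (intro all_moments_integrable all_moments_mult all_moments_const all_moments_diff all_moments_power all_moments_X m)
  have b2: "integrable M (\<lambda>w. ?B i w)"
    if "i \<in> J" for i
    using that by (intro all_moments_integrable all_moments_mult all_moments_const all_moments_sum all_moments_add all_moments_power all_moments_X m')
  have "(\<integral>w. ?F w * \<Phi> (?F w) \<partial>M) = (\<integral>w. \<kappa> * (\<Sum>i\<in>J. ?A i w) \<partial>M)"
    by (simp add: quartic_fluct_def[of \<kappa> w for w] sum_distrib_right mult.assoc)
  also have "\<dots> = \<kappa> * (\<Sum>i\<in>J. (\<integral>w. ?A i w \<partial>M))"
    using b1 by (subst integral_mult_right_zero) (simp add: Bochner_Integration.integral_sum)
  also have "\<dots> = \<kappa> * (\<Sum>i\<in>J. (\<integral>w. ?B i w \<partial>M))"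
    using single by simp
  also have "\<dots> = (\<integral>w. \<kappa> * (\<Sum>i\<in>J. ?B i w) \<partial>M)"
    using b2 by (subst integral_mult_right_zero) (simp only: Bochner_Integration.integral_sum)
  also have "\<dots> = (\<integral>w. stein_kernel \<kappa> w * \<Phi>' (?F w) \<partial>M)"
    by (intro Bochner_Integration.integral_cong refl)
      (simp add: stein_kernel_def power2_eq_square mult_ac flip: sum_distrib_left sum_distrib_right)
  finally show ?thesis .
qed

lemma quartic_fluct_second_moment: "(\<integral>w. (quartic_fluct \<kappa> w)\<^sup>2 \<partial>M) = (\<integral>w. stein_kernel \<kappa> w \<partial>M)"
  using stein_identity[of "\<lambda>x. x" "\<lambda>_. 1" \<kappa>] all_moments_quartic_fluct[of \<kappa>]
  by (simp add: power2_eq_square)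

text \<open>The Stein identity with \<open>x ^ 3\<close> gives \<open>E F\<^sup>4 = 3 E (G F\<^sup>2) \<le> 9/2 E G\<^sup>2 + 1/2 E F\<^sup>4\<close>.\<close>
lemma quartic_fluct_fourth_moment:
  "(\<integral>w. quartic_fluct \<kappa> w ^ 4 \<partial>M) \<le> 9 * (\<integral>w. (stein_kernel \<kappa> w)\<^sup>2 \<partial>M)"
proof -
  let ?F = "quartic_fluct \<kappa>" and ?G = "stein_kernel \<kappa>"
  note F = all_moments_quartic_fluct[of \<kappa>] and G = all_moments_stein_kernel[of \<kappa>]
  have i1: "integrable M (\<lambda>w. ?F w ^ 4)" and i2: "integrable M (\<lambda>w. (?G w)\<^sup>2)"
    and i3: "integrable M (\<lambda>w. ?G w * (3 * (?F w)\<^sup>2))"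
    by (intro all_moments_integrable all_moments_mult all_moments_const all_moments_power F G)+
  have "(\<integral>w. ?F w * ?F w ^ 3 \<partial>M) = (\<integral>w. ?G w * (3 * (?F w)\<^sup>2) \<partial>M)"
  proof (rule stein_identity)
    show "((\<lambda>x. x ^ 3) has_real_derivative 3 * x\<^sup>2) (at x)" for x :: real
      by (auto intro!: derivative_eq_intros)
    show "continuous_on UNIV (\<lambda>x. 3 * x\<^sup>2 :: real)" by (intro continuous_intros)
  qed (intro all_moments_mult all_moments_const all_moments_power F)+
  also have "\<dots> \<le> (\<integral>w. 9/2 * (?G w)\<^sup>2 + 1/2 * ?F w ^ 4 \<partial>M)"
  proof (rule integral_mono[OF i3])
    show "integrable M (\<lambda>w. 9/2 * (?G w)\<^sup>2 + 1/2 * ?F w ^ 4)" using i1 i2 by simp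
    fix w
    have "0 \<le> (3 * ?G w - (?F w)\<^sup>2)\<^sup>2" by simp
    then show "?G w * (3 * (?F w)\<^sup>2) \<le> 9/2 * (?G w)\<^sup>2 + 1/2 * ?F w ^ 4"
      by (simp add: power2_eq_square power4_eq_xxxx algebra_simps)
  qed
  also have "\<dots> = 9/2 * (\<integral>w. (?G w)\<^sup>2 \<partial>M) + 1/2 * (\<integral>w. ?F w ^ 4 \<partial>M)"
    using i1 i2 by simp
  finally show ?thesis by (simp add: power4_eq_xxxx power3_eq_cube mult.assoc)
qed

text \<open>By \<open>quartic_fluct_second_moment\<close> this is the variance of \<open>F\<close>.
  The Wick recursion for two variables is run up to degree six; 72 and 24 are 4 times the
  coefficients 18 and 6 of a single summand.\<close>

lemma expectation_stein_kernel:
  "(\<integral>w. stein_kernel \<kappa> w \<partial>M) = \<kappa>\<^sup>2 * (\<Sum>i\<in>J. \<Sum>j\<in>J. 72 * (C i j)\<^sup>2 * C i i * C j j + 24 * C i j ^ 4)"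
proof -
  have summand: "(\<integral>w. C i j * ((X i w ^ 3 + 3 * C i i * X i w) * X j w ^ 3) \<partial>M) = 18 * (C i j)\<^sup>2 * C i i * C j j + 6 * C i j ^ 4"
    if J: "i \<in> J" "j \<in> J" for i j
  proof -
    define m where "m a b = (\<integral>w. X i w ^ a * X j w ^ b \<partial>M)" for a b
    have mm: "m (Suc a) b = real a * C i i * m (a - 1) b + real b * C i j * m a (b - 1)" for a b
      using mixed_moment_Suc[OF J(1) J(2) J(1) J(1), of a b 0 0] by (simp add: m_def)
    have m0: "m 0 (Suc b) = real b * C j j * m 0 (b - 1)" for b
      using mixed_moment_Suc[OF J(2) J(1) J(1) J(1), of b 0 0 0] by (simp add: m_def)
    have m00: "m 0 0 = 1" by (simp add: m_def prob_space)
    have m02: "m 0 2 = C j j" using m0[of 1] m00 by (simp add: numeral_2_eq_2)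
    have m13: "m 1 3 = 3 * C i j * C j j" using mm[of 0 3] m02 by simp
    have m11: "m 1 1 = C i j" using mm[of 0 1] m00 by simp
    have m22: "m 2 2 = C i i * C j j + 2 * (C i j)\<^sup>2"
      using mm[of 1 2] m02 m11 by (simp add: numeral_2_eq_2)
    have m33: "m 3 3 = 9 * C i i * C j j * C i j + 6 * C i j ^ 3"
      using mm[of 2 3] m13 m22 by (simp add: numeral_3_eq_3 numeral_2_eq_2 algebra_simps)
    have i1: "integrable M (\<lambda>w. X i w ^ a * X j w ^ b)" for a b
      by (intro all_moments_integrable all_moments_mult all_moments_power all_moments_X J)
    have "(\<integral>w. C i j * ((X i w ^ 3 + 3 * C i i * X i w) * X j w ^ 3) \<partial>M)
      = (\<integral>w. C i j * (X i w ^ 3 * X j w ^ 3) + 3 * C i j * C i i * (X i w ^ 1 * X j w ^ 3) \<partial>M)"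
      by (simp add: algebra_simps)
    also have "\<dots> = C i j * m 3 3 + 3 * C i j * C i i * m 1 3"
      unfolding m_def using i1[of 3 3] i1[of 1 3]
      by (subst Bochner_Integration.integral_add) (simp_all only: integrable_mult_right integral_mult_right_zero)
    also have "\<dots> = 18 * (C i j)\<^sup>2 * C i i * C j j + 6 * C i j ^ 4"
      unfolding m13 m33 by (simp add: power2_eq_square power3_eq_cube power4_eq_xxxx algebra_simps)
    finally show ?thesis .
  qed
  have int: "integrable M (\<lambda>w. C i j * ((X i w ^ 3 + 3 * C i i * X i w) * X j w ^ 3))" if "i \<in> J" "j \<in> J" for i j
    using that by (intro all_moments_integrable all_moments_mult all_moments_const all_moments_add all_moments_power all_moments_X)
  have "(\<integral>w. stein_kernel \<kappa> w \<partial>M) = 4 * \<kappa>\<^sup>2 * (\<Sum>i\<in>J. \<Sum>j\<in>J. 18 * (C i j)\<^sup>2 * C i i * C j j + 6 * C i j ^ 4)"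
    unfolding stein_kernel_def using int
    by (subst integral_mult_right_zero) (simp add: Bochner_Integration.integral_sum summand del: integral_mult_right_zero integrable_mult_right_iff)
  also have "\<dots> = \<kappa>\<^sup>2 * (\<Sum>i\<in>J. \<Sum>j\<in>J. 72 * (C i j)\<^sup>2 * C i i * C j j + 24 * C i j ^ 4)"
    by (simp add: sum_distrib_left algebra_simps)
  finally show ?thesis .
qed

end

section \<open>The variance of the Stein kernel\<close>

text \<open>By symmetry the four sums coincide. In \<open>A i j * A k l * A i k\<close> the indices
  form the path \<open>j - i - k - l\<close>; summing over \<open>l\<close>, then \<open>k\<close>
  and \<open>j\<close>, costs a row sum \<open>R\<close> each time, and only \<open>i\<close>
  remains free.\<close>

lemma symmetric_chain_sums:
  fixes A :: "'i \<Rightarrow> 'i \<Rightarrow> real"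
  assumes sym: "\<And>i j. i \<in> J \<Longrightarrow> j \<in> J \<Longrightarrow> A i j = A j i" and nn: "\<And>i j. A i j \<ge> 0"
    and row: "\<And>i. i \<in> J \<Longrightarrow> (\<Sum>j\<in>J. A i j) \<le> R" and R: "R \<ge> 0"
  shows "(\<Sum>i\<in>J. \<Sum>j\<in>J. \<Sum>k\<in>J. \<Sum>l\<in>J. A i j * A k l * (A i k + A i l + A j k + A j l)) \<le> 4 * (real (card J) * R ^ 3)"
proof -
  define T where "T = (\<Sum>i\<in>J. \<Sum>j\<in>J. \<Sum>k\<in>J. \<Sum>l\<in>J. A i j * A k l * A i k)"
  have T: "T \<le> real (card J) * R ^ 3"
  proof -
    have "T = (\<Sum>i\<in>J. \<Sum>j\<in>J. A i j * (\<Sum>k\<in>J. A i k * (\<Sum>l\<in>J. A k l)))"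
      unfolding T_def by (simp add: sum_distrib_left mult_ac)
    also have "\<dots> = (\<Sum>i\<in>J. (\<Sum>j\<in>J. A i j) * (\<Sum>k\<in>J. A i k * (\<Sum>l\<in>J. A k l)))"
      by (simp add: sum_distrib_right)
    also have "\<dots> \<le> (\<Sum>i\<in>J. R * (R * R))"
    proof (intro sum_mono mult_mono row sum_nonneg mult_nonneg_nonneg nn R)
      fix i assume i: "i \<in> J"
      have "(\<Sum>k\<in>J. A i k * (\<Sum>l\<in>J. A k l)) \<le> (\<Sum>k\<in>J. A i k * R)"
        by (intro sum_mono mult_left_mono row nn)
      also have "\<dots> \<le> R * R" unfolding sum_distrib_right[symmetric] using row[OF i] R by (intro mult_right_mono)
      finally show "(\<Sum>k\<in>J. A i k * (\<Sum>l\<in>J. A k l)) \<le> R * R" .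
    qed
    finally show ?thesis by (simp add: power3_eq_cube)
  qed
  have T2: "(\<Sum>i\<in>J. \<Sum>j\<in>J. \<Sum>k\<in>J. \<Sum>l\<in>J. A i j * A k l * A i l) = T"
  proof -
    have "(\<Sum>k\<in>J. \<Sum>l\<in>J. A i j * A k l * A i l) = (\<Sum>k\<in>J. \<Sum>l\<in>J. A i j * A k l * A i k)" for i j
      by (subst sum.swap) (auto intro!: sum.cong simp: sym)
    then show ?thesis unfolding T_def by simp
  qed
  have T3: "(\<Sum>i\<in>J. \<Sum>j\<in>J. \<Sum>k\<in>J. \<Sum>l\<in>J. A i j * A k l * A j k) = T"
    unfolding T_def by (subst sum.swap) (auto intro!: sum.cong simp: sym)
  have T4: "(\<Sum>i\<in>J. \<Sum>j\<in>J. \<Sum>k\<in>J. \<Sum>l\<in>J. A i j * A k l * A j l) = T"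
    unfolding T2[symmetric] by (subst sum.swap) (auto intro!: sum.cong simp: sym)
  have "(\<Sum>i\<in>J. \<Sum>j\<in>J. \<Sum>k\<in>J. \<Sum>l\<in>J. A i j * A k l * (A i k + A i l + A j k + A j l)) = T + T + T + T"
    unfolding distrib_left sum.distrib T2 T3 T4 T_def ..
  then show ?thesis using T by linarith
qed

context gaussian_family
begin

text \<open>The variance is a sum over pairs of index pairs. Each covariance is bounded by the cross
  covariances linking the two pairs, so every surviving term is a path as in
  \<open>symmetric_chain_sums\<close>, and the sum is linear in \<open>card J\<close>. For
  \<open>\<kappa> = 1 / sqrt n\<close> this is \<open>O(1/n)\<close>. The 12 is the degree of a
  product of two summands, \<open>(1 + 3 * B)\<^sup>2\<close> bounds the coefficients 1 and
  \<open>3 * C i i\<close> of the two polynomials, and \<open>64 = 16 * 4\<close> combines the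
  squared prefactor with the four path sums.\<close>

lemma stein_kernel_variance:
  assumes B: "B \<ge> 1" and CB: "\<And>i j. i \<in> J \<Longrightarrow> j \<in> J \<Longrightarrow> \<bar>C i j\<bar> \<le> B"
    and R: "R \<ge> 0" and row: "\<And>i. i \<in> J \<Longrightarrow> (\<Sum>j\<in>J. \<bar>C i j\<bar>) \<le> R"
  shows "(\<integral>w. (stein_kernel \<kappa> w - (\<integral>w. stein_kernel \<kappa> w \<partial>M))\<^sup>2 \<partial>M)
    \<le> 64 * \<kappa> ^ 4 * (fact 12 * B ^ 12 * (1 + 3 * B)\<^sup>2) * (real (card J) * R ^ 3)"
proof -
  define P where "P p w = (X (fst p) w ^ 3 + 3 * C (fst p) (fst p) * X (fst p) w) * X (snd p) w ^ 3" for p w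
  define eP where "eP p = (\<integral>w. P p w \<partial>M)" for p
  define c where "c p = C (fst p) (snd p)" for p
  define L where "L = (fact 12 * B ^ 12 :: real)"
  define K where "K = L * (1 + 3 * B)\<^sup>2"
  have L0: "L \<ge> 0" unfolding L_def using B by (intro mult_nonneg_nonneg zero_le_power) auto
  have mP: "all_moments M (P p)" if "p \<in> J \<times> J" for p
    unfolding P_def using that
    by (intro all_moments_mult all_moments_const all_moments_add all_moments_power all_moments_X) auto
  have S: "stein_kernel \<kappa> w = 4 * \<kappa>\<^sup>2 * (\<Sum>p\<in>J \<times> J. c p * P p w)" for w
    by (simp add: stein_kernel_def sum.cartesian_product c_def P_def case_prod_beta)
  have ES: "(\<integral>w. stein_kernel \<kappa> w \<partial>M) = 4 * \<kappa>\<^sup>2 * (\<Sum>p\<in>J \<times> J. c p * eP p)"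
  proof -
    have "(\<integral>w. (\<Sum>p\<in>J \<times> J. c p * P p w) \<partial>M) = (\<Sum>p\<in>J \<times> J. c p * eP p)"
      unfolding eP_def using all_moments_integrable[OF mP] by (subst Bochner_Integration.integral_sum) auto
    then show ?thesis unfolding S integral_mult_right_zero by (rule arg_cong)
  qed
  have sq: "(stein_kernel \<kappa> w - (\<integral>w. stein_kernel \<kappa> w \<partial>M))\<^sup>2
    = 16 * \<kappa> ^ 4 * (\<Sum>p\<in>J \<times> J. \<Sum>q\<in>J \<times> J. c p * c q * ((P p w - eP p) * (P q w - eP q)))" for w
  proof -
    have "stein_kernel \<kappa> w - (\<integral>w. stein_kernel \<kappa> w \<partial>M) = 4 * \<kappa>\<^sup>2 * (\<Sum>p\<in>J \<times> J. c p * (P p w - eP p))"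
      unfolding ES unfolding S by (simp add: right_diff_distrib sum_subtractf)
    then have "(stein_kernel \<kappa> w - (\<integral>w. stein_kernel \<kappa> w \<partial>M))\<^sup>2 = 16 * \<kappa> ^ 4 * (\<Sum>p\<in>J \<times> J. c p * (P p w - eP p))\<^sup>2"
      by (simp add: power_mult_distrib)
    also have "(\<Sum>p\<in>J \<times> J. c p * (P p w - eP p))\<^sup>2 = (\<Sum>p\<in>J \<times> J. \<Sum>q\<in>J \<times> J. c p * c q * ((P p w - eP p) * (P q w - eP q)))"
      by (simp add: power2_eq_square sum_product mult_ac)
    finally show ?thesis .
  qed
  have cov: "\<bar>\<integral>w. (P p w - eP p) * (P q w - eP q) \<partial>M\<bar>
      \<le> K * (\<bar>C (fst p) (fst q)\<bar> + \<bar>C (fst p) (snd q)\<bar> + \<bar>C (snd p) (fst q)\<bar> + \<bar>C (snd p) (snd q)\<bar>)"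
    if p: "p \<in> J \<times> J" and q: "q \<in> J \<times> J" for p q
  proof -
    obtain i j k l where pq: "p = (i, j)" "q = (k, l)" by (cases p, cases q)
    have J: "i \<in> J" "j \<in> J" "k \<in> J" "l \<in> J" using p q pq by auto
    \<comment> \<open>The sum is used instead of the maximum because it can be summed over all
      indices afterwards.\<close>
    define \<delta> where "\<delta> = \<bar>C i k\<bar> + \<bar>C i l\<bar> + \<bar>C j k\<bar> + \<bar>C j l\<bar>"
    have \<delta>: "\<bar>C i k\<bar> \<le> \<delta>" "\<bar>C i l\<bar> \<le> \<delta>" "\<bar>C j k\<bar> \<le> \<delta>" "\<bar>C j l\<bar> \<le> \<delta>" "0 \<le> \<delta>" by (auto simp: \<delta>_def)
    define m where "m a b c d = (\<integral>w. X i w ^ a * X j w ^ b * X k w ^ c * X l w ^ d \<partial>M)" for a b c d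
    define m1 where "m1 a b = (\<integral>w. X i w ^ a * X j w ^ b \<partial>M)" for a b
    define m2 where "m2 a b = (\<integral>w. X k w ^ a * X l w ^ b \<partial>M)" for a b
    have bd: "\<bar>m a b c d - m1 a b * m2 c d\<bar> \<le> L * \<delta>" if "a + b + c + d \<le> 12" for a b c d
    proof -
      have "\<bar>m a b c d - m1 a b * m2 c d\<bar> \<le> fact (a + b + c + d) * B ^ (a + b + c + d) * \<delta>"
        unfolding m_def m1_def m2_def by (rule mixed_covariance_bound[OF J B CB \<delta>(1-4)])
      also have "\<dots> \<le> L * \<delta>" unfolding L_def using that \<delta>(5) B
        by (intro mult_right_mono mult_mono fact_mono power_increasing) auto
      finally show ?thesis .
    qed
    have i4: "integrable M (\<lambda>w. X i w ^ a * X j w ^ b * X k w ^ c * X l w ^ d)" for a b c d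
      by (intro all_moments_integrable all_moments_mult all_moments_power all_moments_X J)
    have eP2: "eP (i, j) = (\<integral>w. X i w ^ 3 * X j w ^ 3 \<partial>M) + 3 * C i i * (\<integral>w. X i w ^ 1 * X j w ^ 3 \<partial>M)"
      if "i \<in> J" "j \<in> J" for i j
    proof -
      have i2: "integrable M (\<lambda>w. X i w ^ a * X j w ^ b)" for a b
        by (intro all_moments_integrable all_moments_mult all_moments_power all_moments_X that)
      have "eP (i, j) = (\<integral>w. X i w ^ 3 * X j w ^ 3 + 3 * C i i * (X i w ^ 1 * X j w ^ 3) \<partial>M)"
        unfolding eP_def P_def by (simp add: algebra_simps)
      then show ?thesis using i2[of 3 3] i2[of 1 3]
        by (simp only: Bochner_Integration.integral_add integrable_mult_right integral_mult_right_zero)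
    qed
    have ep: "eP p = m1 3 3 + 3 * C i i * m1 1 3" and eq: "eP q = m2 3 3 + 3 * C k k * m2 1 3"
      using eP2 J by (simp_all only: pq m1_def m2_def)
    let ?m = "\<lambda>a b c d w. X i w ^ a * X j w ^ b * X k w ^ c * X l w ^ d"
    have "(\<integral>w. P p w * P q w \<partial>M) = (\<integral>w. ?m 3 3 3 3 w + 3 * C k k * ?m 3 3 1 3 w + 3 * C i i * ?m 1 3 3 3 w + 9 * C i i * C k k * ?m 1 3 1 3 w \<partial>M)"
      unfolding P_def pq by (simp add: algebra_simps)
    also have "\<dots> = m 3 3 3 3 + 3 * C k k * m 3 3 1 3 + 3 * C i i * m 1 3 3 3 + 9 * C i i * C k k * m 1 3 1 3"
      unfolding m_def using i4[of 3 3 3 3] i4[of 3 3 1 3] i4[of 1 3 3 3] i4[of 1 3 1 3]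
      by (simp only: Bochner_Integration.integral_add Bochner_Integration.integrable_add integrable_mult_right integral_mult_right_zero)
    finally have epq: "(\<integral>w. P p w * P q w \<partial>M) = m 3 3 3 3 + 3 * C k k * m 3 3 1 3 + 3 * C i i * m 1 3 3 3 + 9 * C i i * C k k * m 1 3 1 3" .
    have ip: "integrable M (P p)" "integrable M (P q)" "integrable M (\<lambda>w. P p w * P q w)"
      using mP[OF p] mP[OF q] by (auto intro!: all_moments_integrable)
    have "(\<integral>w. (P p w - eP p) * (P q w - eP q) \<partial>M) = (\<integral>w. P p w * P q w - eP q * P p w - eP p * P q w + eP p * eP q \<partial>M)"
      by (simp add: algebra_simps)
    also have "\<dots> = (\<integral>w. P p w * P q w \<partial>M) - eP p * eP q"
      using ip by (simp add: prob_space eP_def[symmetric])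
    also have "\<dots> = (m 3 3 3 3 - m1 3 3 * m2 3 3) + 3 * C k k * (m 3 3 1 3 - m1 3 3 * m2 1 3)
        + 3 * C i i * (m 1 3 3 3 - m1 1 3 * m2 3 3) + 9 * C i i * C k k * (m 1 3 1 3 - m1 1 3 * m2 1 3)"
      unfolding epq ep eq by (simp add: algebra_simps)
    finally have split: "(\<integral>w. (P p w - eP p) * (P q w - eP q) \<partial>M) = (m 3 3 3 3 - m1 3 3 * m2 3 3) + 3 * C k k * (m 3 3 1 3 - m1 3 3 * m2 1 3)
        + 3 * C i i * (m 1 3 3 3 - m1 1 3 * m2 3 3) + 9 * C i i * C k k * (m 1 3 1 3 - m1 1 3 * m2 1 3)" .
    have "\<bar>\<integral>w. (P p w - eP p) * (P q w - eP q) \<partial>M\<bar> \<le> L * \<delta> + 3 * B * (L * \<delta>) + 3 * B * (L * \<delta>) + 9 * B * B * (L * \<delta>)"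
    proof -
      have mb: "\<bar>x * y\<bar> \<le> a * b" if "\<bar>x\<bar> \<le> a" "\<bar>y\<bar> \<le> b" for x y a b :: real
        unfolding abs_mult using that by (intro mult_mono) auto
      have c1: "\<bar>3 * C k k\<bar> \<le> 3 * B" "\<bar>3 * C i i\<bar> \<le> 3 * B" using CB[of k k] CB[of i i] J by auto
      have c2: "\<bar>9 * C i i * C k k\<bar> \<le> 9 * B * B"
        using CB[of k k] CB[of i i] J B by (simp add: abs_mult mult_mono)
      show ?thesis
        unfolding split using bd[of 3 3 3 3] mb[OF c1(1) bd[of 3 3 1 3]] mb[OF c1(2) bd[of 1 3 3 3]] mb[OF c2 bd[of 1 3 1 3]]
        by linarith
    qed
    also have "\<dots> = K * \<delta>" by (simp add: K_def power2_eq_square algebra_simps)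
    finally show ?thesis by (simp add: \<delta>_def pq)
  qed
  have int: "integrable M (\<lambda>w. c p * c q * ((P p w - eP p) * (P q w - eP q)))" if "p \<in> J \<times> J" "q \<in> J \<times> J" for p q
    using that by (intro all_moments_integrable all_moments_mult all_moments_const all_moments_diff mP)
  have "(\<integral>w. (stein_kernel \<kappa> w - (\<integral>w. stein_kernel \<kappa> w \<partial>M))\<^sup>2 \<partial>M)
    = 16 * \<kappa> ^ 4 * (\<Sum>p\<in>J \<times> J. \<Sum>q\<in>J \<times> J. c p * c q * (\<integral>w. (P p w - eP p) * (P q w - eP q) \<partial>M))"
    unfolding sq using int by (subst integral_mult_right_zero) (simp add: Bochner_Integration.integral_sum)
  also have "\<dots> \<le> 16 * \<kappa> ^ 4 * (\<Sum>p\<in>J \<times> J. \<Sum>q\<in>J \<times> J. K * (\<bar>c p\<bar> * \<bar>c q\<bar> *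
     (\<bar>C (fst p) (fst q)\<bar> + \<bar>C (fst p) (snd q)\<bar> + \<bar>C (snd p) (fst q)\<bar> + \<bar>C (snd p) (snd q)\<bar>)))"
  proof (intro mult_left_mono sum_mono)
    fix p q assume pq: "p \<in> J \<times> J" "q \<in> J \<times> J"
    let ?I = "\<integral>w. (P p w - eP p) * (P q w - eP q) \<partial>M"
    have "c p * c q * ?I \<le> \<bar>c p\<bar> * \<bar>c q\<bar> * \<bar>?I\<bar>" using abs_ge_self[of "c p * c q * ?I"] by (simp only: abs_mult)
    also have "\<dots> \<le> \<bar>c p\<bar> * \<bar>c q\<bar> * (K * (\<bar>C (fst p) (fst q)\<bar> + \<bar>C (fst p) (snd q)\<bar> + \<bar>C (snd p) (fst q)\<bar> + \<bar>C (snd p) (snd q)\<bar>))"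
      by (intro mult_left_mono cov pq) auto
    finally show "c p * c q * ?I \<le> K * (\<bar>c p\<bar> * \<bar>c q\<bar> *
     (\<bar>C (fst p) (fst q)\<bar> + \<bar>C (fst p) (snd q)\<bar> + \<bar>C (snd p) (fst q)\<bar> + \<bar>C (snd p) (snd q)\<bar>))"
      by (simp only: mult_ac)
  qed simp
  also have "\<dots> = 16 * \<kappa> ^ 4 * (K * (\<Sum>i\<in>J. \<Sum>j\<in>J. \<Sum>k\<in>J. \<Sum>l\<in>J. \<bar>C i j\<bar> * \<bar>C k l\<bar> * (\<bar>C i k\<bar> + \<bar>C i l\<bar> + \<bar>C j k\<bar> + \<bar>C j l\<bar>)))"
    by (simp add: sum.cartesian_product[symmetric] c_def sum_distrib_left[symmetric] sum.cartesian_product' )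
  also have "\<dots> \<le> 16 * \<kappa> ^ 4 * (K * (4 * (real (card J) * R ^ 3)))"
  proof (intro mult_left_mono)
    show "(\<Sum>i\<in>J. \<Sum>j\<in>J. \<Sum>k\<in>J. \<Sum>l\<in>J. \<bar>C i j\<bar> * \<bar>C k l\<bar> * (\<bar>C i k\<bar> + \<bar>C i l\<bar> + \<bar>C j k\<bar> + \<bar>C j l\<bar>)) \<le> 4 * (real (card J) * R ^ 3)"
      by (rule symmetric_chain_sums) (use row R C_sym in auto)
    show "0 \<le> K" using L0 by (simp add: K_def)
  qed simp
  also have "\<dots> = 64 * \<kappa> ^ 4 * K * (real (card J) * R ^ 3)" by simp
  finally show ?thesis by (simp only: K_def L_def)
qed

end

section \<open>From the Stein identity to characteristic functions\<close>

text \<open>The Stein identity makes \<open>\<phi>' t = - t * E (G * iexp (t * F))\<close>. With the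
  integrating factor \<open>exp (s * t\<^sup>2 / 2)\<close> only the deviation \<open>G - s\<close>
  is left in the derivative, so the mean value inequality needs \<open>G\<close> to be close to
  \<open>s\<close> merely in mean.\<close>

lemma (in prob_space) char_gaussian_comparison:
  fixes F G :: "'a \<Rightarrow> real"
  assumes F[measurable]: "F \<in> borel_measurable M" and F2: "integrable M (\<lambda>w. (F w)\<^sup>2)"
    and G: "integrable M G" and s: "s \<ge> 0"
    and stein: "\<And>t::real. (\<integral>w. F w * iexp (t * F w) \<partial>M) = \<i> * t * (\<integral>w. G w * iexp (t * F w) \<partial>M)"
  shows "cmod ((\<integral>w. iexp (t * F w) \<partial>M) - complex_of_real (exp (- (s * t\<^sup>2) / 2))) \<le> t\<^sup>2 * (\<integral>w. \<bar>G w - s\<bar> \<partial>M)"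
proof -
  define \<phi> where "\<phi> t = (\<integral>w. iexp (t * F w) \<partial>M)" for t :: real
  define \<delta> where "\<delta> = (\<integral>w. \<bar>G w - s\<bar> \<partial>M)"
  have [measurable]: "G \<in> borel_measurable M" using G by auto
  have F1: "integrable M F" by (rule square_integrable_imp_integrable[OF F F2])
  have ie: "integrable M (\<lambda>w. iexp (t * F w))" for t
    by (intro integrable_const_bound[of _ 1]) auto
  have iFe: "integrable M (\<lambda>w. F w * iexp (t * F w))" for t
    by (rule Bochner_Integration.integrable_bound[OF F1]) (auto simp: norm_mult)
  have iGe: "integrable M (\<lambda>w. G w * iexp (t * F w))" for t
    by (rule Bochner_Integration.integrable_bound[OF G]) (auto simp: norm_mult)
  \<comment> \<open>Differentiation under the integral: the second order Taylor remainder of the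
    exponential is dominated by \<open>h\<^sup>2 * (F w)\<^sup>2 / 2\<close>, which is integrable by
    \<open>F2\<close>.\<close>
  have dphi: "(\<phi> has_vector_derivative (\<i> * (\<integral>w. F w * iexp (t * F w) \<partial>M))) (at t)" for t
  proof -
    define E2 where "E2 = (\<integral>w. (F w)\<^sup>2 \<partial>M)"
    let ?d = "\<i> * (\<integral>w. F w * iexp (t * F w) \<partial>M)"
    let ?r = "\<lambda>h w. iexp ((t + h) * F w) - iexp (t * F w) - h * (\<i> * (F w * iexp (t * F w)))"
    have bound: "cmod (\<phi> (t + h) - \<phi> t - h *\<^sub>R ?d) \<le> h\<^sup>2 * (E2 / 2)" for h
    proof -
      have pt: "cmod (?r h w) \<le> h\<^sup>2 * ((F w)\<^sup>2 / 2)" for w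
      proof -
        have "?r h w
          = iexp (t * F w) * (iexp (h * F w) - (1 + \<i> * (h * F w)))"
          by (simp add: algebra_simps exp_add)
        then have "cmod (?r h w)
          = cmod (iexp (h * F w) - (\<Sum>k \<le> 1. (\<i> * (h * F w)) ^ k / fact k))"
          by (simp add: norm_mult)
        also have "\<dots> \<le> \<bar>h * F w\<bar> ^ Suc 1 / fact (Suc 1)" by (rule iexp_approx1)
        also have "\<dots> = h\<^sup>2 * ((F w)\<^sup>2 / 2)" by (simp add: power2_eq_square abs_mult mult_ac)
        finally show ?thesis .
      qed
      have "\<phi> (t + h) - \<phi> t - h *\<^sub>R ?d = (\<integral>w. ?r h w \<partial>M)"
        unfolding \<phi>_def scaleR_conv_of_real using ie[of "t + h"] ie[of t] iFe[of t]
        by (simp only: Bochner_Integration.integral_diff Bochner_Integration.integrable_diff integrable_mult_right integral_mult_right_zero)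
      also have "cmod \<dots> \<le> (\<integral>w. h\<^sup>2 * ((F w)\<^sup>2 / 2) \<partial>M)"
      proof (rule order_trans[OF integral_norm_bound integral_mono[OF integrable_norm _ pt]])
        show "integrable M (\<lambda>w. ?r h w)"
          by (intro Bochner_Integration.integrable_diff integrable_mult_right ie iFe)
        show "integrable M (\<lambda>w. h\<^sup>2 * ((F w)\<^sup>2 / 2))" using F2 by simp
      qed
      also have "\<dots> = h\<^sup>2 * (E2 / 2)" by (simp add: E2_def)
      finally show ?thesis .
    qed
    show ?thesis
      unfolding has_vector_derivative_def has_derivative_at
    proof (intro conjI bounded_linear_scaleR_left)
      show "(\<lambda>h. norm (\<phi> (t + h) - \<phi> t - h *\<^sub>R ?d) / norm h) \<midarrow>0\<rightarrow> 0"
      proof (rule Lim_null_comparison)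
        show "\<forall>\<^sub>F h in at 0. norm (norm (\<phi> (t + h) - \<phi> t - h *\<^sub>R ?d) / norm h) \<le> \<bar>h\<bar> * (E2 / 2)"
          unfolding eventually_at
        proof (intro exI[of _ 1] conjI ballI impI)
          fix h :: real assume "h \<noteq> 0 \<and> dist h 0 < 1"
          then show "norm (norm (\<phi> (t + h) - \<phi> t - h *\<^sub>R ?d) / norm h) \<le> \<bar>h\<bar> * (E2 / 2)"
            using bound[of h] by (simp add: divide_le_eq power2_eq_square abs_mult_self_eq mult_ac)
        qed simp
        have "((\<lambda>h. \<bar>h\<bar> * (E2 / 2)) \<longlongrightarrow> \<bar>0\<bar> * (E2 / 2)) (at (0::real))" by (intro tendsto_intros)
        then show "((\<lambda>h. \<bar>h\<bar> * (E2 / 2)) \<longlongrightarrow> 0) (at (0::real))" by simp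
      qed
    qed
  qed
  define Q where "Q x = (\<integral>w. (G w - s) * iexp (x * F w) \<partial>M)" for x
  define g where "g t = exp (s * t\<^sup>2 / 2)" for t
  have dw: "((\<lambda>x. g x *\<^sub>R \<phi> x) has_vector_derivative - (g x * x) *\<^sub>R (Q x)) (at x)" for x
  proof -
    have "(g has_real_derivative g x * (s * x)) (at x)"
      unfolding g_def by (auto intro!: derivative_eq_intros)
    from has_vector_derivative_scaleR[OF this dphi[of x]]
    have "((\<lambda>x. g x *\<^sub>R \<phi> x) has_vector_derivative g x *\<^sub>R (\<i> * (\<integral>w. F w * iexp (x * F w) \<partial>M)) + (g x * (s * x)) *\<^sub>R \<phi> x) (at x)" .
    moreover have "Q x = (\<integral>w. G w * iexp (x * F w) \<partial>M) - s * \<phi> x"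
    proof -
      have "Q x = (\<integral>w. G w * iexp (x * F w) - s * iexp (x * F w) \<partial>M)"
        by (simp add: Q_def algebra_simps)
      then show ?thesis unfolding \<phi>_def using iGe[of x] ie[of x]
        by (simp only: Bochner_Integration.integral_diff integrable_mult_right integral_mult_right_zero)
    qed
    moreover have "g x *\<^sub>R (\<i> * (\<i> * x * I)) + (g x * (s * x)) *\<^sub>R \<phi> x = - (g x * x) *\<^sub>R (I - s * \<phi> x)" for I
      by (simp add: scaleR_conv_of_real algebra_simps)
    ultimately show ?thesis unfolding stein by (simp only:)
  qed
  \<comment> \<open>The factor \<open>g\<close> grows with \<open>\<bar>x\<bar>\<close>, so it is
    bounded by its value at the endpoint; dividing by \<open>g t\<close> at the end removes
    it.\<close>
  have nb: "cmod (- (g x * x) *\<^sub>R (Q x)) \<le> g t * \<bar>t\<bar> * \<delta>" if "\<bar>x\<bar> \<le> \<bar>t\<bar>" for x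
  proof -
    have "cmod (Q x) \<le> (\<integral>w. \<bar>G w - s\<bar> \<partial>M)"
      unfolding Q_def by (rule order_trans[OF integral_norm_bound]) (simp add: norm_mult flip: of_real_diff)
    moreover have "g x \<le> g t"
      unfolding g_def using that s by (auto intro!: mult_left_mono simp: abs_le_square_iff)
    ultimately show ?thesis
      unfolding norm_scaleR \<delta>_def using that by (auto simp: abs_mult g_def intro!: mult_mono)
  qed
  have "norm (g t *\<^sub>R \<phi> t - g 0 *\<^sub>R \<phi> 0) \<le> (g t * \<bar>t\<bar> * \<delta>) * norm (t - 0)"
  \<comment> \<open>The symmetric interval treats both signs of \<open>t\<close> at once.\<close>
  proof (rule differentiable_bound[where S="{-\<bar>t\<bar>..\<bar>t\<bar>}" and f'="\<lambda>x h. h *\<^sub>R (- (g x * x) *\<^sub>R (Q x))"])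
    fix x assume x: "x \<in> {-\<bar>t\<bar>..\<bar>t\<bar>}"
    show "((\<lambda>x. g x *\<^sub>R \<phi> x) has_derivative (\<lambda>h. h *\<^sub>R (- (g x * x) *\<^sub>R (Q x)))) (at x within {-\<bar>t\<bar>..\<bar>t\<bar>})"
      using dw[of x] unfolding has_vector_derivative_def by (rule has_derivative_at_withinI)
    have "norm (h *\<^sub>R (- (g x * x) *\<^sub>R (Q x))) \<le> (g t * \<bar>t\<bar> * \<delta>) * norm h" for h
      unfolding norm_scaleR[of h] using mult_right_mono[OF nb, of x "\<bar>h\<bar>"] x by (simp add: mult.commute abs_le_iff)
    then show "onorm (\<lambda>h. h *\<^sub>R (- (g x * x) *\<^sub>R (Q x))) \<le> g t * \<bar>t\<bar> * \<delta>"
      by (intro onorm_bound) (auto simp: g_def \<delta>_def)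
  qed auto
  then have "cmod (g t * \<phi> t - 1) \<le> g t * (t\<^sup>2 * \<delta>)"
    by (simp add: g_def \<phi>_def prob_space scaleR_conv_of_real power2_eq_square abs_mult_self_eq mult_ac)
  moreover have "g t * \<phi> t - 1 = g t * (\<phi> t - complex_of_real (exp (- (s * t\<^sup>2) / 2)))"
    by (simp add: g_def right_diff_distrib flip: of_real_mult exp_add)
  moreover have "g t > 0" by (simp add: g_def)
  ultimately show ?thesis
    by (simp add: norm_mult \<phi>_def \<delta>_def)
qed

context gaussian_family
begin

text \<open>The test functions of \<open>stein_identity\<close> are real, so the exponential is
  split into cosine and sine.\<close>

lemma quartic_fluct_char:
  assumes s: "s \<ge> 0"
  shows "cmod ((\<integral>w. iexp (t * quartic_fluct \<kappa> w) \<partial>M) - complex_of_real (exp (- (s * t\<^sup>2) / 2))) \<le> t\<^sup>2 * (\<integral>w. \<bar>stein_kernel \<kappa> w - s\<bar> \<partial>M)"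
proof (rule char_gaussian_comparison[OF _ _ _ s])
  let ?F = "quartic_fluct \<kappa>" and ?G = "stein_kernel \<kappa>"
  note F = all_moments_quartic_fluct[of \<kappa>] and G = all_moments_stein_kernel[of \<kappa>]
  show [measurable]: "?F \<in> borel_measurable M" using F by (simp add: all_moments_def)
  show "integrable M (\<lambda>w. (?F w)\<^sup>2)" "integrable M ?G"
    using F G by (auto intro!: all_moments_integrable)
  have [measurable]: "?G \<in> borel_measurable M" using G by (simp add: all_moments_def)
  fix t :: real
  have mb: "all_moments M (\<lambda>w. cos (t * ?F w))" "all_moments M (\<lambda>w. sin (t * ?F w))"
    by (rule all_moments_bounded[of _ 1], simp, simp)+
  have c: "(\<integral>w. ?F w * cos (t * ?F w) \<partial>M) = (\<integral>w. ?G w * (- t * sin (t * ?F w)) \<partial>M)"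
  proof (rule stein_identity)
    show "((\<lambda>x. cos (t * x)) has_real_derivative - t * sin (t * x)) (at x)" for x
      by (auto intro!: derivative_eq_intros)
    show "continuous_on UNIV (\<lambda>x. - t * sin (t * x))" by (intro continuous_intros)
  qed (intro mb all_moments_mult all_moments_const)+
  have sn: "(\<integral>w. ?F w * sin (t * ?F w) \<partial>M) = (\<integral>w. ?G w * (t * cos (t * ?F w)) \<partial>M)"
  proof (rule stein_identity)
    show "((\<lambda>x. sin (t * x)) has_real_derivative t * cos (t * x)) (at x)" for x
      by (auto intro!: derivative_eq_intros)
    show "continuous_on UNIV (\<lambda>x. t * cos (t * x))" by (intro continuous_intros)
  qed (intro mb all_moments_mult all_moments_const)+
  have i1: "integrable M (\<lambda>w. ?F w * iexp (t * ?F w))"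
    by (rule Bochner_Integration.integrable_bound[OF all_moments_integrable[OF F]]) (auto simp: norm_mult)
  have i2: "integrable M (\<lambda>w. ?G w * iexp (t * ?F w))"
    by (rule Bochner_Integration.integrable_bound[OF all_moments_integrable[OF G]]) (auto simp: norm_mult)
  show "(\<integral>w. ?F w * iexp (t * ?F w) \<partial>M) = \<i> * t * (\<integral>w. ?G w * iexp (t * ?F w) \<partial>M)"
  proof (rule complex_eqI)
    have ReE: "Re (complex_of_real a * iexp x) = a * cos x" and ImE: "Im (complex_of_real a * iexp x) = a * sin x" for a x :: real
      by (simp_all add: cis_conv_exp[symmetric] flip: of_real_mult)
    have R1: "Re (\<integral>w. ?F w * iexp (t * ?F w) \<partial>M) = (\<integral>w. ?F w * cos (t * ?F w) \<partial>M)"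
      unfolding integral_Re[OF i1, symmetric] ReE ..
    have I1: "Im (\<integral>w. ?F w * iexp (t * ?F w) \<partial>M) = (\<integral>w. ?F w * sin (t * ?F w) \<partial>M)"
      unfolding integral_Im[OF i1, symmetric] ImE ..
    have R2: "Re (\<integral>w. ?G w * iexp (t * ?F w) \<partial>M) = (\<integral>w. ?G w * cos (t * ?F w) \<partial>M)"
      unfolding integral_Re[OF i2, symmetric] ReE ..
    have I2: "Im (\<integral>w. ?G w * iexp (t * ?F w) \<partial>M) = (\<integral>w. ?G w * sin (t * ?F w) \<partial>M)"
      unfolding integral_Im[OF i2, symmetric] ImE ..
    have sw: "(\<integral>w. ?G w * (- t * sin (t * ?F w)) \<partial>M) = - t * (\<integral>w. ?G w * sin (t * ?F w) \<partial>M)"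
      "(\<integral>w. ?G w * (t * cos (t * ?F w)) \<partial>M) = t * (\<integral>w. ?G w * cos (t * ?F w) \<partial>M)"
      by (simp_all only: mult.left_commute[of _ "- t"] mult.left_commute[of _ t] integral_mult_right_zero)
    show "Re (\<integral>w. ?F w * iexp (t * ?F w) \<partial>M) = Re (\<i> * t * (\<integral>w. ?G w * iexp (t * ?F w) \<partial>M))"
      unfolding R1 c sw using I2 by (simp add: mult.assoc)
    show "Im (\<integral>w. ?F w * iexp (t * ?F w) \<partial>M) = Im (\<i> * t * (\<integral>w. ?G w * iexp (t * ?F w) \<partial>M))"
      unfolding I1 sn sw using R2 by (simp add: mult.assoc)
  qed
qed

end

section \<open>Limit theorems for triangular arrays\<close>

context prob_space
begin

lemma expectation_abs_le_sqrt:
  fixes W :: "'a \<Rightarrow> real"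
  assumes "W \<in> borel_measurable M" "integrable M (\<lambda>w. (W w)\<^sup>2)"
  shows "(\<integral>w. \<bar>W w\<bar> \<partial>M) \<le> sqrt (\<integral>w. (W w)\<^sup>2 \<partial>M)"
proof -
  have i: "integrable M W" by (rule square_integrable_imp_integrable[OF assms])
  have "0 \<le> variance (\<lambda>w. \<bar>W w\<bar>)" by (rule variance_positive)
  also have "variance (\<lambda>w. \<bar>W w\<bar>) = (\<integral>w. (W w)\<^sup>2 \<partial>M) - (\<integral>w. \<bar>W w\<bar> \<partial>M)\<^sup>2"
    using i assms(2) by (subst variance_eq) auto
  finally show ?thesis by (intro real_le_rsqrt) simp
qed

text \<open>The expectation of \<open>\<Sum>n. Y n ^ 4\<close> is finite, so this series converges
  almost surely and its terms tend to 0.\<close>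

lemma AE_tendsto_0_fourth_moment:
  fixes Y :: "nat \<Rightarrow> 'a \<Rightarrow> real"
  assumes int: "\<And>n. n \<ge> 1 \<Longrightarrow> integrable M (\<lambda>w. Y n w ^ 4)"
    and bd: "\<And>n. n \<ge> 1 \<Longrightarrow> (\<integral>w. Y n w ^ 4 \<partial>M) \<le> K / (real n)\<^sup>2"
  shows "AE w in M. (\<lambda>n. Y n w) \<longlonglongrightarrow> 0"
proof -
  \<comment> \<open>The shift by one leaves out \<open>n = 0\<close>, for which nothing is
    assumed.\<close>
  define f where "f n w = Y (Suc n) w ^ 4" for n w
  have fi: "integrable M (f n)" for n unfolding f_def by (rule int) simp
  have f0: "f n w \<ge> 0" for n w by (simp add: f_def)
  have [measurable]: "f n \<in> borel_measurable M" for n using fi by auto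
  have K0: "K \<ge> 0"
  proof -
    have "0 \<le> (\<integral>w. Y 1 w ^ 4 \<partial>M)" by simp
    also have "\<dots> \<le> K" using bd[of 1] by simp
    finally show ?thesis .
  qed
  have sm: "summable (\<lambda>n. K / (real (Suc n))\<^sup>2)"
    using summable_mult[OF inverse_squares_sums[THEN sums_summable], of K] by (simp add: add.commute)
  have "(\<integral>\<^sup>+w. (\<Sum>n. ennreal (f n w)) \<partial>M) = (\<Sum>n. \<integral>\<^sup>+w. ennreal (f n w) \<partial>M)"
    by (rule nn_integral_suminf) measurable
  also have "\<dots> \<le> (\<Sum>n. ennreal (K / (real (Suc n))\<^sup>2))"
  proof (intro suminf_le summableI)
    fix n
    have "(\<integral>\<^sup>+w. ennreal (f n w) \<partial>M) = ennreal (\<integral>w. f n w \<partial>M)"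
      using fi f0 by (intro nn_integral_eq_integral) auto
    also have "\<dots> \<le> ennreal (K / (real (Suc n))\<^sup>2)"
      unfolding f_def by (intro ennreal_leI bd) simp
    finally show "(\<integral>\<^sup>+w. ennreal (f n w) \<partial>M) \<le> ennreal (K / (real (Suc n))\<^sup>2)" .
  qed
  also have "\<dots> = ennreal (\<Sum>n. K / (real (Suc n))\<^sup>2)"
    using K0 sm by (intro suminf_ennreal2) auto
  also have "\<dots> < \<infinity>" by simp
  finally have "AE w in M. (\<Sum>n. ennreal (f n w)) \<noteq> \<infinity>"
    by (intro nn_integral_noteq_infinite) auto
  then show ?thesis
  proof eventually_elim
    case (elim w)
    then have "summable (\<lambda>n. f n w)" using f0 by (intro summable_suminf_not_top) (auto simp: top_ennreal_def)
    then have "(\<lambda>n. f n w) \<longlonglongrightarrow> 0" by (rule summable_LIMSEQ_zero)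
    then have "(\<lambda>n. root 4 (f n w)) \<longlonglongrightarrow> root 4 0" by (rule tendsto_real_root)
    moreover have "root 4 (f n w) = \<bar>Y (Suc n) w\<bar>" for n
      using real_root_power_cancel[of 4 "\<bar>Y (Suc n) w\<bar>"] by (simp add: f_def)
    ultimately have "(\<lambda>n. Y (Suc n) w) \<longlonglongrightarrow> 0" by (simp add: tendsto_rabs_zero_iff)
    then show ?case by (rule LIMSEQ_imp_Suc)
  qed
qed

text \<open>The exponentials of \<open>T n\<close> and \<open>a * Z n\<close> differ by at most a
  vanishing multiple of \<open>(Z n)\<^sup>2\<close>: on
  \<open>\<bar>Z n\<bar> \<le> sqrt n / 2\<close> by the linearisation, elsewhere because a
  difference of two phases is at most 2. Bounded second moments then make the expectations close.
  The threshold corresponds to a quartic mean within 1/2 of its limit 1.\<close>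

lemma delta_method_normal:
  fixes Z T :: "nat \<Rightarrow> 'a \<Rightarrow> real"
  assumes Z[measurable]: "\<And>n. Z n \<in> borel_measurable M" and T[measurable]: "\<And>n. T n \<in> borel_measurable M"
    and Z2: "\<And>n. n \<ge> 1 \<Longrightarrow> integrable M (\<lambda>w. (Z n w)\<^sup>2)" and K: "\<And>n. n \<ge> 1 \<Longrightarrow> (\<integral>w. (Z n w)\<^sup>2 \<partial>M) \<le> K"
    and char: "\<And>t. (\<lambda>n. \<integral>w. iexp (t * Z n w) \<partial>M) \<longlonglongrightarrow> complex_of_real (exp (- (s * t\<^sup>2) / 2))"
    and lin: "\<And>n w. n \<ge> 1 \<Longrightarrow> \<bar>Z n w\<bar> \<le> sqrt (real n) / 2 \<Longrightarrow> \<bar>T n w - a * Z n w\<bar> \<le> L * (Z n w)\<^sup>2 / sqrt (real n)"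
    and a: "a \<noteq> 0" and s: "s > 0"
  shows "weak_conv_m (\<lambda>n. distr M borel (T n)) (density lborel (normal_density 0 (sqrt (a\<^sup>2 * s))))"
proof (rule levy_continuity)
  show "real_distribution (distr M borel (T n))" for n by (rule real_distribution_distr) simp
  have pos: "sqrt (a\<^sup>2 * s) > 0" using a s by simp
  then show "real_distribution (density lborel (normal_density 0 (sqrt (a\<^sup>2 * s))))"
    by (rule real_distribution_normal_density)
  fix t :: real
  let ?b = "\<lambda>n. 8 / real n + \<bar>t\<bar> * \<bar>L\<bar> / sqrt (real n)"
  let ?e = "\<lambda>n w. iexp (t * T n w) - iexp ((t * a) * Z n w)"
  have iexp_diff: "cmod (iexp x - iexp y) \<le> \<bar>x - y\<bar>" for x y
  proof -
    have "iexp x - iexp y = iexp y * (iexp (x - y) - 1)" by (simp add: algebra_simps flip: exp_add)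
    then have "cmod (iexp x - iexp y) = cmod (iexp (x - y) - (\<Sum>k\<le>0. (\<i> * (x - y)) ^ k / fact k))"
      by (simp add: norm_mult flip: of_real_diff)
    also have "\<dots> \<le> \<bar>x - y\<bar>" using iexp_approx1[of "x - y" 0] by simp
    finally show ?thesis .
  qed
  have close: "cmod ((\<integral>w. iexp (t * T n w) \<partial>M) - (\<integral>w. iexp ((t * a) * Z n w) \<partial>M)) \<le> ?b n * K"
    if n: "n \<ge> 1" for n
  proof -
    have n0: "real n > 0" using n by simp
    have pt: "cmod (?e n w) \<le> ?b n * (Z n w)\<^sup>2" for w
    proof (cases "\<bar>Z n w\<bar> \<le> sqrt (real n) / 2")
      case True
      have "cmod (?e n w) \<le> \<bar>t * T n w - (t * a) * Z n w\<bar>" by (rule iexp_diff)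
      also have "\<dots> = \<bar>t\<bar> * \<bar>T n w - a * Z n w\<bar>" by (simp add: abs_mult[symmetric] algebra_simps)
      also have "\<dots> \<le> \<bar>t\<bar> * (L * (Z n w)\<^sup>2 / sqrt (real n))" by (intro mult_left_mono lin n True) auto
      also have "\<dots> \<le> \<bar>t\<bar> * (\<bar>L\<bar> * (Z n w)\<^sup>2 / sqrt (real n))"
        by (intro mult_left_mono divide_right_mono mult_right_mono) auto
      also have "\<dots> = (\<bar>t\<bar> * \<bar>L\<bar> / sqrt (real n)) * (Z n w)\<^sup>2" by simp
      also have "\<dots> \<le> ?b n * (Z n w)\<^sup>2"
        by (intro mult_right_mono) auto
      finally show ?thesis .
    next
      case False
      then have "(sqrt (real n) / 2)\<^sup>2 \<le> \<bar>Z n w\<bar>\<^sup>2" by (intro power_mono) auto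
      \<comment> \<open>Outside the threshold \<open>(Z n w)\<^sup>2 \<ge> n / 4\<close>, whence the
        constant 8.\<close>
      then have "2 \<le> (8 / real n) * (Z n w)\<^sup>2" using n0 by (simp add: power_divide field_simps)
      also have "\<dots> \<le> ?b n * (Z n w)\<^sup>2"
        by (intro mult_right_mono) auto
      finally have "2 \<le> ?b n * (Z n w)\<^sup>2" .
      moreover have "cmod (?e n w) \<le> 2"
        by (rule order_trans[OF norm_triangle_ineq4]) simp
      ultimately show ?thesis by linarith
    qed
    have ia: "integrable M (\<lambda>w. iexp (t * T n w))" "integrable M (\<lambda>w. iexp ((t * a) * Z n w))"
      by (intro integrable_const_bound[of _ 1]; simp)+
    have "cmod ((\<integral>w. iexp (t * T n w) \<partial>M) - (\<integral>w. iexp ((t * a) * Z n w) \<partial>M))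
      = cmod (\<integral>w. ?e n w \<partial>M)"
      by (simp only: Bochner_Integration.integral_diff[OF ia])
    also have "\<dots> \<le> (\<integral>w. ?b n * (Z n w)\<^sup>2 \<partial>M)"
      by (rule order_trans[OF integral_norm_bound integral_mono[OF integrable_norm _ pt]])
        (intro Bochner_Integration.integrable_diff ia integrable_mult_right Z2[OF n])+
    also have "\<dots> = ?b n * (\<integral>w. (Z n w)\<^sup>2 \<partial>M)" by (rule integral_mult_right_zero)
    also have "\<dots> \<le> ?b n * K" by (intro mult_left_mono K n) auto
    finally show ?thesis .
  qed
  have "(\<lambda>n. ?b n * K) \<longlonglongrightarrow> (0 + 0) * K"
    by (intro tendsto_intros tendsto_divide_0[OF tendsto_const] filterlim_at_top_imp_at_infinity
      filterlim_real_sequentially filterlim_compose[OF sqrt_at_top filterlim_real_sequentially])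
  then have "(\<lambda>n. ?b n * K) \<longlonglongrightarrow> 0" by simp
  then have "(\<lambda>n. (\<integral>w. iexp (t * T n w) \<partial>M) - (\<integral>w. iexp ((t * a) * Z n w) \<partial>M)) \<longlonglongrightarrow> 0"
    by (rule Lim_null_comparison[rotated]) (use close in \<open>auto simp: eventually_sequentially intro!: exI[of _ 1]\<close>)
  from tendsto_add[OF this char[of "t * a"]]
  have "(\<lambda>n. \<integral>w. iexp (t * T n w) \<partial>M) \<longlonglongrightarrow> complex_of_real (exp (- (s * (t * a)\<^sup>2) / 2))" by simp
  moreover have "char (distr M borel (T n)) t = (\<integral>w. iexp (t * T n w) \<partial>M)" for n
    unfolding char_def by (subst integral_distr) auto
  moreover have "char (density lborel (normal_density 0 (sqrt (a\<^sup>2 * s)))) t = complex_of_real (exp (- (s * (t * a)\<^sup>2) / 2))"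
    using s by (subst char_normal_density[OF pos]) (simp add: power_mult_distrib mult_ac)
  ultimately show "(\<lambda>n. char (distr M borel (T n)) t) \<longlonglongrightarrow> char (density lborel (normal_density 0 (sqrt (a\<^sup>2 * s)))) t"
    by simp
qed

end

section \<open>Limit theorems for the normalised fourth powers\<close>

text \<open>These are the properties of the covariances through which the heat equation enters the
  limit theorems. Different rows may depend on each other arbitrarily: almost sure convergence uses
  summability alone. \<open>bias\<close> says that exchanging the exact means
  \<open>3 * (C n i i)\<^sup>2\<close> for 3 is negligible even at the scale of the central limit
  theorem.\<close>

locale gaussian_array = prob_space M for M :: "'a measure" +
  fixes X :: "nat \<Rightarrow> nat \<Rightarrow> 'a \<Rightarrow> real" and C :: "nat \<Rightarrow> nat \<Rightarrow> nat \<Rightarrow> real" and B R s :: real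
  assumes row_family: "\<And>n. n \<ge> 1 \<Longrightarrow> gaussian_family M {1..n} (X n) (C n)"
    and C_bound: "\<And>n i j. i \<in> {1..n} \<Longrightarrow> j \<in> {1..n} \<Longrightarrow> \<bar>C n i j\<bar> \<le> B" and B: "B \<ge> 1"
    and C_row: "\<And>n i. i \<in> {1..n} \<Longrightarrow> (\<Sum>j=1..n. \<bar>C n i j\<bar>) \<le> R" and R: "R \<ge> 0"
    and var_limit: "(\<lambda>n. (1 / real n) * (\<Sum>i=1..n. \<Sum>j=1..n. 72 * (C n i j)\<^sup>2 * C n i i * C n j j + 24 * C n i j ^ 4)) \<longlonglongrightarrow> s"
    and bias: "(\<lambda>n. (\<Sum>i=1..n. (C n i i)\<^sup>2 - 1) / sqrt (real n)) \<longlonglongrightarrow> 0"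
    and s: "s \<ge> 0"
begin

text \<open>The 3 is the fourth moment of a standard normal variable, so the limit is 1.\<close>

definition mean_quartic :: "nat \<Rightarrow> 'a \<Rightarrow> real" where
  "mean_quartic n w = (\<Sum>i=1..n. X n i w ^ 4) / (3 * real n)"

definition scaled_error :: "nat \<Rightarrow> 'a \<Rightarrow> real" where
  "scaled_error n w = sqrt (real n) * (mean_quartic n w - 1)"

abbreviation var_sum :: "nat \<Rightarrow> real" where
  "var_sum n \<equiv> (1 / real n) * (\<Sum>i=1..n. \<Sum>j=1..n. 72 * (C n i j)\<^sup>2 * C n i i * C n j j + 24 * C n i j ^ 4)"

abbreviation fluct :: "nat \<Rightarrow> 'a \<Rightarrow> real" where
  "fluct n \<equiv> gaussian_family.quartic_fluct {1..n} (X n) (C n) (1 / sqrt (real n))"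

abbreviation kernel :: "nat \<Rightarrow> 'a \<Rightarrow> real" where
  "kernel n \<equiv> gaussian_family.stein_kernel {1..n} (X n) (C n) (1 / sqrt (real n))"

abbreviation drift :: "nat \<Rightarrow> real" where
  "drift n \<equiv> (\<Sum>i=1..n. (C n i i)\<^sup>2 - 1) / sqrt (real n)"

text \<open>Separates the exactly centred random part, to which the Stein identity applies, from the
  deterministic effect of variances different from 1.\<close>

lemma scaled_error_eq:
  assumes n: "n \<ge> 1"
  shows "scaled_error n w = fluct n w / 3 + drift n"
proof -
  interpret gaussian_family M "{1..n}" "X n" "C n" by (rule row_family[OF n])
  have n0: "real n > 0" using n by simp
  have "fluct n w = ((\<Sum>i=1..n. X n i w ^ 4) - 3 * (\<Sum>i=1..n. (C n i i)\<^sup>2)) / sqrt (real n)"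
    unfolding quartic_fluct_def by (simp add: sum_subtractf sum_distrib_left)
  moreover have "drift n = ((\<Sum>i=1..n. (C n i i)\<^sup>2) - real n) / sqrt (real n)"
    by (simp add: sum_subtractf)
  ultimately have "fluct n w / 3 + drift n = ((\<Sum>i=1..n. X n i w ^ 4) / 3 - real n) / sqrt (real n)"
    by (simp add: diff_divide_distrib)
  also have "\<dots> = scaled_error n w"
  proof -
    have "sqrt (real n) = real n / sqrt (real n)" using n0 by (simp add: real_div_sqrt)
    then have "scaled_error n w = real n / sqrt (real n) * (mean_quartic n w - 1)"
      unfolding scaled_error_def by (rule arg_cong[of _ _ "\<lambda>z. z * (mean_quartic n w - 1)"])
    also have "\<dots> = (real n * mean_quartic n w - real n) / sqrt (real n)" by (simp add: algebra_simps)
    also have "real n * mean_quartic n w = (\<Sum>i=1..n. X n i w ^ 4) / 3"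
      using n0 by (simp add: mean_quartic_def)
    finally show ?thesis by simp
  qed
  finally show ?thesis by simp
qed

lemma kernel_variance:
  "\<exists>V\<ge>0. \<forall>n\<ge>1. (\<integral>w. (kernel n w - (\<integral>w. kernel n w \<partial>M))\<^sup>2 \<partial>M) \<le> V / real n"
proof (intro exI conjI allI impI)
  show "64 * (fact 12 * B ^ 12 * (1 + 3 * B)\<^sup>2) * R ^ 3 \<ge> 0"
    using B R by (intro mult_nonneg_nonneg zero_le_power) auto
  fix n :: nat assume n: "n \<ge> 1"
  interpret gaussian_family M "{1..n}" "X n" "C n" by (rule row_family[OF n])
  have n0: "real n > 0" using n by simp
  have "(\<integral>w. (kernel n w - (\<integral>w. kernel n w \<partial>M))\<^sup>2 \<partial>M)
    \<le> 64 * (1 / sqrt (real n)) ^ 4 * (fact 12 * B ^ 12 * (1 + 3 * B)\<^sup>2) * (real (card {1..n}) * R ^ 3)"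
    by (rule stein_kernel_variance[OF B C_bound R C_row])
  also have "\<dots> = 64 * (fact 12 * B ^ 12 * (1 + 3 * B)\<^sup>2) * R ^ 3 * ((1 / sqrt (real n)) ^ 4 * real n)"
    by (simp only: card_atLeastAtMost diff_Suc_1 Suc_eq_plus1[symmetric] mult_ac)
  also have "(1 / sqrt (real n)) ^ 4 * real n = 1 / real n"
  proof -
    have "(1 / sqrt (real n)) ^ 4 = ((1 / sqrt (real n))\<^sup>2)\<^sup>2" by simp
    also have "\<dots> = 1 / (real n)\<^sup>2" by (simp add: power_one_over)
    finally show ?thesis using n0 by (simp add: power2_eq_square)
  qed
  finally show "(\<integral>w. (kernel n w - (\<integral>w. kernel n w \<partial>M))\<^sup>2 \<partial>M)
    \<le> 64 * (fact 12 * B ^ 12 * (1 + 3 * B)\<^sup>2) * R ^ 3 / real n" by (simp only: times_divide_eq_right mult_1_right)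
qed

lemma kernel_mean:
  assumes n: "n \<ge> 1"
  shows "(\<integral>w. kernel n w \<partial>M) = var_sum n"
proof -
  interpret gaussian_family M "{1..n}" "X n" "C n" by (rule row_family[OF n])
  show ?thesis unfolding expectation_stein_kernel by (simp add: power_one_over)
qed

text \<open>The second moment is the mean of the kernel, which converges. The fourth is controlled
  by the second moment of the kernel, that is, by its variance plus its squared mean.\<close>

lemma fluct_bounds:
  "\<exists>K\<ge>0. \<forall>n\<ge>1. (\<integral>w. (fluct n w)\<^sup>2 \<partial>M) \<le> K \<and> (\<integral>w. fluct n w ^ 4 \<partial>M) \<le> K"
proof -
  obtain V where V: "V \<ge> 0"
    "\<And>n. n \<ge> 1 \<Longrightarrow> (\<integral>w. (kernel n w - (\<integral>w. kernel n w \<partial>M))\<^sup>2 \<partial>M) \<le> V / real n"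
    using kernel_variance by blast
  have "Bseq (\<lambda>n. var_sum n)"
    using var_limit by (intro convergent_imp_Bseq convergentI)
  then obtain E where E: "E > 0" "\<And>n. \<bar>var_sum n\<bar> \<le> E"
    by (auto simp: Bseq_def)
  show ?thesis
  proof (intro exI conjI allI impI)
    show "max E (9 * (V + E\<^sup>2)) \<ge> 0" using E by auto
    fix n :: nat assume n: "n \<ge> 1"
    interpret gaussian_family M "{1..n}" "X n" "C n" by (rule row_family[OF n])
    have Em: "\<bar>\<integral>w. kernel n w \<partial>M\<bar> \<le> E" using E(2)[of n] unfolding kernel_mean[OF n] .
    show "(\<integral>w. (fluct n w)\<^sup>2 \<partial>M) \<le> max E (9 * (V + E\<^sup>2))"
      unfolding quartic_fluct_second_moment using Em by linarith
    have G: "integrable M (kernel n)" "integrable M (\<lambda>w. (kernel n w)\<^sup>2)"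
      using all_moments_stein_kernel by (auto intro!: all_moments_integrable)
    have "(\<integral>w. (kernel n w)\<^sup>2 \<partial>M) = variance (kernel n) + (\<integral>w. kernel n w \<partial>M)\<^sup>2"
      using G by (simp add: variance_eq)
    also have "\<dots> \<le> V + E\<^sup>2"
    proof (rule add_mono)
      have "V / real n \<le> V" using V(1) n by (simp add: divide_le_eq mult_le_cancel_left1)
      then show "variance (kernel n) \<le> V" using V(2)[OF n] by linarith
      show "(\<integral>w. kernel n w \<partial>M)\<^sup>2 \<le> E\<^sup>2" using Em E(1) by (simp add: abs_le_square_iff[symmetric])
    qed
    finally show "(\<integral>w. fluct n w ^ 4 \<partial>M) \<le> max E (9 * (V + E\<^sup>2))"
      by (intro order_trans[OF quartic_fluct_fourth_moment] order_trans[OF _ max.cobounded2]) simp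
  qed
qed

lemma AE_mean_quartic: "AE w in M. (\<lambda>n. mean_quartic n w) \<longlonglongrightarrow> 1"
proof -
  obtain K where K: "\<And>n. n \<ge> 1 \<Longrightarrow> (\<integral>w. fluct n w ^ 4 \<partial>M) \<le> K" using fluct_bounds by blast
  have "AE w in M. (\<lambda>n. fluct n w / sqrt (real n)) \<longlonglongrightarrow> 0"
  proof (rule AE_tendsto_0_fourth_moment)
    fix n :: nat assume n: "n \<ge> 1"
    interpret gaussian_family M "{1..n}" "X n" "C n" by (rule row_family[OF n])
    have p4: "sqrt (real n) ^ 4 = (real n)\<^sup>2"
      using power_mult[of "sqrt (real n)" 2 2] by simp
    have "integrable M (\<lambda>w. fluct n w ^ 4)"
      using all_moments_quartic_fluct by (auto intro!: all_moments_integrable)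
    then show "integrable M (\<lambda>w. (fluct n w / sqrt (real n)) ^ 4)" by (simp add: power_divide)
    show "(\<integral>w. (fluct n w / sqrt (real n)) ^ 4 \<partial>M) \<le> K / (real n)\<^sup>2"
      using K[OF n] n by (simp add: power_divide p4 divide_right_mono)
  qed
  then show ?thesis
  proof eventually_elim
    case (elim w)
    have "(\<lambda>n. 1 / sqrt (real n)) \<longlonglongrightarrow> 0"
      by (intro tendsto_divide_0[OF tendsto_const] filterlim_at_top_imp_at_infinity
        filterlim_compose[OF sqrt_at_top filterlim_real_sequentially])
    then have "(\<lambda>n. 1 + (fluct n w / sqrt (real n)) / 3 + (1 / sqrt (real n)) * drift n) \<longlonglongrightarrow> 1 + 0 / 3 + 0 * 0"
      using elim bias by (intro tendsto_intros) auto
    moreover have "\<forall>\<^sub>F n in sequentially. 1 + (fluct n w / sqrt (real n)) / 3 + (1 / sqrt (real n)) * drift n = mean_quartic n w"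
      using eventually_ge_at_top[of 1]
    proof eventually_elim
      case (elim n)
      have "scaled_error n w / sqrt (real n) = mean_quartic n w - 1"
        using elim by (simp add: scaled_error_def)
      moreover have "scaled_error n w / sqrt (real n) = (fluct n w / sqrt (real n)) / 3 + (1 / sqrt (real n)) * drift n"
        unfolding scaled_error_eq[OF elim] by (simp add: add_divide_distrib)
      ultimately show ?case by simp
    qed
    ultimately show ?case by (simp add: tendsto_cong)
  qed
qed

text \<open>The mean distance of the kernel from \<open>s\<close> is at most its standard deviation,
  of order \<open>1 / sqrt n\<close>, plus the distance of its mean from \<open>s\<close>.\<close>

lemma char_fluct: "(\<lambda>n. \<integral>w. iexp (t * fluct n w) \<partial>M) \<longlonglongrightarrow> complex_of_real (exp (- (s * t\<^sup>2) / 2))"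
proof -
  obtain V where V: "V \<ge> 0"
    "\<And>n. n \<ge> 1 \<Longrightarrow> (\<integral>w. (kernel n w - (\<integral>w. kernel n w \<partial>M))\<^sup>2 \<partial>M) \<le> V / real n"
    using kernel_variance by blast
  have bound: "cmod ((\<integral>w. iexp (t * fluct n w) \<partial>M) - complex_of_real (exp (- (s * t\<^sup>2) / 2))) \<le> t\<^sup>2 * (sqrt (V / real n) + \<bar>var_sum n - s\<bar>)"
    if n: "n \<ge> 1" for n
  proof -
    interpret gaussian_family M "{1..n}" "X n" "C n" by (rule row_family[OF n])
    have Em: "(\<integral>w. kernel n w \<partial>M) = var_sum n" by (rule kernel_mean[OF n])
    have am: "all_moments M (kernel n)" by (rule all_moments_stein_kernel)
    have m: "all_moments M (\<lambda>w. kernel n w - var_sum n)" by (intro all_moments_diff am all_moments_const)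
    have i1: "integrable M (\<lambda>w. \<bar>kernel n w - var_sum n\<bar>)" "integrable M (\<lambda>w. (kernel n w - var_sum n)\<^sup>2)"
      using all_moments_integrable[OF m] all_moments_integrable[OF all_moments_power[OF m]] by auto
    have i2: "integrable M (\<lambda>w. \<bar>kernel n w - s\<bar>)"
      using all_moments_integrable[OF am] by auto
    have "(\<integral>w. \<bar>kernel n w - s\<bar> \<partial>M) \<le> (\<integral>w. \<bar>kernel n w - var_sum n\<bar> + \<bar>var_sum n - s\<bar> \<partial>M)"
      using i1 i2 by (intro integral_mono) auto
    also have "\<dots> = (\<integral>w. \<bar>kernel n w - var_sum n\<bar> \<partial>M) + \<bar>var_sum n - s\<bar>"
      using i1 by (simp add: prob_space)
    also have "(\<integral>w. \<bar>kernel n w - var_sum n\<bar> \<partial>M) \<le> sqrt (\<integral>w. (kernel n w - var_sum n)\<^sup>2 \<partial>M)"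
      using m i1 by (intro expectation_abs_le_sqrt) (auto simp: all_moments_def)
    also have "\<dots> \<le> sqrt (V / real n)" using V(2)[OF n] Em by simp
    finally have "(\<integral>w. \<bar>kernel n w - s\<bar> \<partial>M) \<le> sqrt (V / real n) + \<bar>var_sum n - s\<bar>" by simp
    then show ?thesis
      using quartic_fluct_char[OF s, of t "1 / sqrt (real n)"] by (meson mult_left_mono order_trans zero_le_power2)
  qed
  have "(\<lambda>n. V / real n) \<longlonglongrightarrow> 0"
    by (intro tendsto_divide_0[OF tendsto_const] filterlim_at_top_imp_at_infinity filterlim_real_sequentially)
  moreover have "var_sum \<longlonglongrightarrow> s" using var_limit .
  ultimately have "(\<lambda>n. t\<^sup>2 * (sqrt (V / real n) + \<bar>var_sum n - s\<bar>)) \<longlonglongrightarrow> t\<^sup>2 * (sqrt 0 + \<bar>s - s\<bar>)"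
    by (intro tendsto_intros)
  then have "(\<lambda>n. t\<^sup>2 * (sqrt (V / real n) + \<bar>var_sum n - s\<bar>)) \<longlonglongrightarrow> 0" by simp
  then have "(\<lambda>n. (\<integral>w. iexp (t * fluct n w) \<partial>M) - complex_of_real (exp (- (s * t\<^sup>2) / 2))) \<longlonglongrightarrow> 0"
    by (rule Lim_null_comparison[rotated]) (use bound in \<open>auto simp: eventually_sequentially intro!: exI[of _ 1]\<close>)
  then show ?thesis by (simp only: LIM_zero_iff)
qed

text \<open>The drift is deterministic and contributes only a phase tending to 1; the factor 1/3 in
  front of \<open>fluct\<close> turns \<open>s\<close> into \<open>s / 9\<close>.\<close>

lemma char_scaled_error: "(\<lambda>n. \<integral>w. iexp (t * scaled_error n w) \<partial>M) \<longlonglongrightarrow> complex_of_real (exp (- (s / 9 * t\<^sup>2) / 2))"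
proof -
  have "(\<lambda>n. iexp (t * drift n) * (\<integral>w. iexp ((t / 3) * fluct n w) \<partial>M)) \<longlonglongrightarrow> iexp (t * 0) * complex_of_real (exp (- (s * (t / 3)\<^sup>2) / 2))"
    by (intro tendsto_intros bias char_fluct)
  moreover have "\<forall>\<^sub>F n in sequentially. iexp (t * drift n) * (\<integral>w. iexp ((t / 3) * fluct n w) \<partial>M) = (\<integral>w. iexp (t * scaled_error n w) \<partial>M)"
    using eventually_ge_at_top[of 1]
  proof eventually_elim
    case (elim n)
    have "iexp (t * scaled_error n w) = iexp (t * drift n) * iexp ((t / 3) * fluct n w)" for w
      unfolding scaled_error_eq[OF elim] exp_add[symmetric]
      by (rule arg_cong[where f=exp]) (simp add: algebra_simps)
    then show ?case by (simp only: integral_mult_right_zero)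
  qed
  ultimately show ?thesis by (simp add: tendsto_cong power_divide)
qed

lemma scaled_error_square:
  "\<exists>K. \<forall>n\<ge>1. integrable M (\<lambda>w. (scaled_error n w)\<^sup>2) \<and> (\<integral>w. (scaled_error n w)\<^sup>2 \<partial>M) \<le> K"
proof -
  obtain K where K: "K \<ge> 0" "\<And>n. n \<ge> 1 \<Longrightarrow> (\<integral>w. (fluct n w)\<^sup>2 \<partial>M) \<le> K" using fluct_bounds by blast
  obtain b where b: "b > 0" "\<And>n. \<bar>drift n\<bar> \<le> b"
    using convergent_imp_Bseq[OF convergentI[OF bias]] by (auto simp: Bseq_def)
  have i: "integrable M (\<lambda>w. (scaled_error n w)\<^sup>2)" and le: "(\<integral>w. (scaled_error n w)\<^sup>2 \<partial>M) \<le> K + 2 * b\<^sup>2" if n: "n \<ge> 1" for n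
  proof -
    interpret gaussian_family M "{1..n}" "X n" "C n" by (rule row_family[OF n])
    have am: "all_moments M (fluct n)" by (rule all_moments_quartic_fluct)
    have "all_moments M (\<lambda>w. 1/3 * fluct n w + drift n)"
      by (intro all_moments_add all_moments_mult am all_moments_const)
    then have "all_moments M (scaled_error n)" by (subst scaled_error_eq[OF n, abs_def]) simp
    then show i: "integrable M (\<lambda>w. (scaled_error n w)\<^sup>2)" by (intro all_moments_integrable all_moments_power)
    have f2: "integrable M (\<lambda>w. (fluct n w)\<^sup>2)" by (intro all_moments_integrable all_moments_power am)
    have "(scaled_error n w)\<^sup>2 \<le> (fluct n w)\<^sup>2 + 2 * b\<^sup>2" for w
    proof -
      have "(x / 3 + y)\<^sup>2 \<le> x\<^sup>2 + 2 * y\<^sup>2" for x y :: real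
      proof -
        have "x\<^sup>2 + 2 * y\<^sup>2 - (x / 3 + y)\<^sup>2 = (x / 3 - y)\<^sup>2 + 7 / 9 * x\<^sup>2" by (simp add: power2_eq_square field_simps)
        also have "\<dots> \<ge> 0" by simp
        finally show ?thesis by simp
      qed
      from this[of "fluct n w" "drift n"] have "(scaled_error n w)\<^sup>2 \<le> (fluct n w)\<^sup>2 + 2 * (drift n)\<^sup>2"
        unfolding scaled_error_eq[OF n] .
      moreover have "(drift n)\<^sup>2 \<le> b\<^sup>2" using b(2)[of n] b(1) by (simp add: abs_le_square_iff[symmetric])
      ultimately show ?thesis by linarith
    qed
    then have "(\<integral>w. (scaled_error n w)\<^sup>2 \<partial>M) \<le> (\<integral>w. (fluct n w)\<^sup>2 + 2 * b\<^sup>2 \<partial>M)"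
      using i f2 by (intro integral_mono) auto
    also have "\<dots> = (\<integral>w. (fluct n w)\<^sup>2 \<partial>M) + 2 * b\<^sup>2" using f2 by (simp add: prob_space)
    also have "\<dots> \<le> K + 2 * b\<^sup>2" using K(2)[OF n] by simp
    finally show "(\<integral>w. (scaled_error n w)\<^sup>2 \<partial>M) \<le> K + 2 * b\<^sup>2" .
  qed
  show ?thesis using i le by blast
qed

end

section \<open>Correlations of the increments\<close>

lemma cesaro_mean:
  fixes a :: "nat \<Rightarrow> real"
  assumes "a \<longlonglongrightarrow> L"
  shows "(\<lambda>n. (\<Sum>k<n. a k) / real n) \<longlonglongrightarrow> L"
proof (rule LIMSEQ_I)
  fix \<epsilon> :: real assume \<epsilon>: "\<epsilon> > 0"
  obtain N where N: "\<And>k. k \<ge> N \<Longrightarrow> \<bar>a k - L\<bar> < \<epsilon> / 2"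
    using LIMSEQ_D[OF assms, of "\<epsilon> / 2"] \<epsilon> by auto
  define S where "S = (\<Sum>k<N. \<bar>a k - L\<bar>)"
  obtain N' :: nat where N': "real N' > 2 * S / \<epsilon>" using reals_Archimedean2 by blast
  show "\<exists>n0. \<forall>n\<ge>n0. norm ((\<Sum>k<n. a k) / real n - L) < \<epsilon>"
  proof (intro exI allI impI)
    fix n assume n: "n \<ge> max 1 (max N N')"
    have n0: "real n > 0" using n by simp
    have "\<bar>\<Sum>k<n. a k - L\<bar> \<le> (\<Sum>k<n. \<bar>a k - L\<bar>)" by (rule sum_abs)
    also have "\<dots> = S + (\<Sum>k\<in>{N..<n}. \<bar>a k - L\<bar>)"
      unfolding S_def lessThan_atLeast0 by (rule sum.atLeastLessThan_concat[symmetric]) (use n in auto)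
    also have "\<dots> \<le> S + (\<Sum>k\<in>{N..<n}. \<epsilon> / 2)"
      using N by (intro add_left_mono sum_mono less_imp_le) auto
    also have "(\<Sum>k\<in>{N..<n}. \<epsilon> / 2) \<le> real n * (\<epsilon> / 2)"
      using \<epsilon> by (simp add: mult_right_mono)
    finally have 1: "\<bar>\<Sum>k<n. a k - L\<bar> \<le> S + real n * (\<epsilon> / 2)" by simp
    have "2 * S / \<epsilon> < real n" using N' n by (simp add: less_le_trans)
    then have 2: "S < real n * (\<epsilon> / 2)" using \<epsilon> by (simp add: field_simps)
    have "(\<Sum>k<n. a k) / real n - L = (\<Sum>k<n. a k - L) / real n"
      using n0 by (simp add: sum_subtractf field_simps)
    then have "norm ((\<Sum>k<n. a k) / real n - L) = \<bar>\<Sum>k<n. a k - L\<bar> / real n" by simp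
    also have "\<dots> < \<epsilon>" using 1 2 n0 by (simp add: divide_less_eq mult.commute)
    finally show "norm ((\<Sum>k<n. a k) / real n - L) < \<epsilon>" .
  qed
qed

text \<open>Distances to indices up to \<open>i\<close> run from 0 to \<open>i - 1\<close>, those to
  later indices from 1 to \<open>n - i\<close>; distance 0 is counted once.\<close>

lemma sum_abs_diff:
  fixes f :: "nat \<Rightarrow> real"
  assumes i: "i \<in> {1..n}"
  shows "(\<Sum>j=1..n. f (nat \<bar>int i - int j\<bar>)) = (\<Sum>m<i. f m) + (\<Sum>m=1..n - i. f m)"
proof -
  have "{1..n} = {1..i} \<union> {i<..n}" using i by auto
  then have "(\<Sum>j=1..n. f (nat \<bar>int i - int j\<bar>)) = (\<Sum>j=1..i. f (nat \<bar>int i - int j\<bar>)) + (\<Sum>j\<in>{i<..n}. f (nat \<bar>int i - int j\<bar>))"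
    by (simp add: sum.union_disjoint ivl_disj_int)
  also have "(\<Sum>j=1..i. f (nat \<bar>int i - int j\<bar>)) = (\<Sum>m<i. f m)"
    by (rule sum.reindex_bij_witness[of _ "\<lambda>m. i - m" "\<lambda>j. i - j"]) (auto simp: nat_diff_distrib)
  also have "(\<Sum>j\<in>{i<..n}. f (nat \<bar>int i - int j\<bar>)) = (\<Sum>m=1..n - i. f m)"
    by (rule sum.reindex_bij_witness[of _ "\<lambda>m. i + m" "\<lambda>j. j - i"]) (auto intro!: arg_cong[of _ _ f])
  finally show ?thesis .
qed

text \<open>Every row sum is a partial sum of \<open>f\<close> to the left plus one to the right
  without \<open>f 0\<close>. Averaging over the rows, after reversing the index on the right, is a
  Cesaro mean of convergent partial sums.\<close>

lemma toeplitz_mean_tendsto: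
  fixes f :: "nat \<Rightarrow> real"
  assumes "summable f"
  shows "(\<lambda>n. (1 / real n) * (\<Sum>i=1..n. \<Sum>j=1..n. f (nat \<bar>int i - int j\<bar>))) \<longlonglongrightarrow> 2 * suminf f - f 0"
proof -
  have lim: "(\<lambda>n. \<Sum>m<n. f m) \<longlonglongrightarrow> suminf f" using assms by (rule summable_LIMSEQ)
  have "(\<Sum>i=1..n. \<Sum>j=1..n. f (nat \<bar>int i - int j\<bar>)) = (\<Sum>k<n. \<Sum>m<Suc k. f m) + (\<Sum>k<n. (\<Sum>m<Suc k. f m) - f 0)" for n
  proof -
    have "(\<Sum>i=1..n. \<Sum>j=1..n. f (nat \<bar>int i - int j\<bar>)) = (\<Sum>i=1..n. (\<Sum>m<i. f m)) + (\<Sum>i=1..n. (\<Sum>m=1..n - i. f m))"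
      by (simp only: sum_abs_diff sum.distrib cong: sum.cong)
    also have "(\<Sum>i=1..n. (\<Sum>m<i. f m)) = (\<Sum>k<n. \<Sum>m<Suc k. f m)"
      by (rule sum.reindex_bij_witness[of _ Suc "\<lambda>i. i - 1"]) auto
    also have "(\<Sum>i=1..n. (\<Sum>m=1..n - i. f m)) = (\<Sum>k<n. (\<Sum>m=1..k. f m))"
      by (rule sum.reindex_bij_witness[of _ "\<lambda>k. n - k" "\<lambda>i. n - i"]) auto
    also have "\<dots> = (\<Sum>k<n. (\<Sum>m<Suc k. f m) - f 0)"
      by (intro sum.cong refl) (simp add: lessThan_Suc_atMost atMost_atLeast0 sum.atLeast_Suc_atMost del: sum.lessThan_Suc)
    finally show ?thesis .
  qed
  then have "(\<lambda>n. (1 / real n) * (\<Sum>i=1..n. \<Sum>j=1..n. f (nat \<bar>int i - int j\<bar>)))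
    = (\<lambda>n. (\<Sum>k<n. \<Sum>m<Suc k. f m) / real n + (\<Sum>k<n. (\<Sum>m<Suc k. f m) - f 0) / real n)"
    by (simp add: add_divide_distrib)
  moreover have "\<dots> \<longlonglongrightarrow> suminf f + (suminf f - f 0)"
    by (intro tendsto_add cesaro_mean tendsto_diff tendsto_const LIMSEQ_Suc[OF lim])
  ultimately show ?thesis by simp
qed

section \<open>The correlation function of fractional increments\<close>

lemma fbm_corr_sqrt: "fbm_corr m = (sqrt \<bar>m + 1\<bar> + sqrt \<bar>m - 1\<bar> - 2 * sqrt \<bar>m\<bar>) / 2"
  by (simp add: fbm_corr_def powr_half_sqrt)

lemma fbm_corr_0 [simp]: "fbm_corr 0 = 1"
  by (simp add: fbm_corr_sqrt)

lemma fbm_corr_minus [simp]: "fbm_corr (- m) = fbm_corr m"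
proof -
  have "\<bar>- m + 1\<bar> = \<bar>m - 1\<bar>" "\<bar>- m - 1\<bar> = \<bar>m + 1\<bar>" by auto
  then show ?thesis by (simp only: fbm_corr_sqrt abs_minus_cancel add.commute)
qed

lemma fbm_corr_abs [simp]: "fbm_corr \<bar>m\<bar> = fbm_corr m"
  by (cases "m \<ge> 0") auto

text \<open>The increments of the square root decrease, so \<open>\<bar>r\<bar>\<close> telescopes.\<close>
lemma sum_abs_fbm_corr: "(\<Sum>m=1..n. \<bar>fbm_corr (real m)\<bar>) \<le> 1 / 2"
proof -
  define d where "d m = sqrt (real m + 1) - sqrt (real m)" for m
  \<comment> \<open>In the rationalised form it is visible that \<open>d\<close> decreases.\<close>
  have d: "d m = 1 / (sqrt (real m + 1) + sqrt (real m))" for m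
  proof -
    have "sqrt (real m + 1) + sqrt (real m) > 0" by (intro add_pos_nonneg) auto
    moreover have "d m * (sqrt (real m + 1) + sqrt (real m)) = 1"
      by (simp add: d_def algebra_simps)
    ultimately show ?thesis by (simp add: field_simps)
  qed
  have dec: "d (Suc m) \<le> d m" for m
    unfolding d by (intro divide_left_mono add_mono mult_pos_pos add_pos_nonneg) auto
  have d0: "d m \<ge> 0" for m by (simp add: d_def)
  have eq: "\<bar>fbm_corr (real (Suc m))\<bar> = (d m - d (Suc m)) / 2" for m
  proof -
    have "fbm_corr (real (Suc m)) = (d (Suc m) - d m) / 2"
      by (simp add: fbm_corr_sqrt d_def)
    then show ?thesis using dec[of m] by simp
  qed
  have "(\<Sum>m=1..n. \<bar>fbm_corr (real m)\<bar>) = (d 0 - d n) / 2"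
  proof (induction n)
    case (Suc n)
    have "(\<Sum>m=1..Suc n. \<bar>fbm_corr (real m)\<bar>) = (\<Sum>m=1..n. \<bar>fbm_corr (real m)\<bar>) + \<bar>fbm_corr (real (Suc n))\<bar>"
      by simp
    then show ?case unfolding Suc eq by (simp add: field_simps)
  qed simp
  also have "\<dots> \<le> 1 / 2" using d0[of n] by (simp add: d_def[of 0])
  finally show ?thesis .
qed

lemma abs_fbm_corr_le_1: "\<bar>fbm_corr (real m)\<bar> \<le> 1"
proof (cases m)
  case (Suc k)
  have "\<bar>fbm_corr (real m)\<bar> \<le> (\<Sum>j=1..m. \<bar>fbm_corr (real j)\<bar>)"
    using Suc by (intro member_le_sum) auto
  then show ?thesis using sum_abs_fbm_corr[of m] by linarith
qed simp

lemma summable_abs_fbm_corr: "summable (\<lambda>m. \<bar>fbm_corr (real m)\<bar>)"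
proof (rule bounded_imp_summable)
  fix n
  have "(\<Sum>m\<le>n. \<bar>fbm_corr (real m)\<bar>) = 1 + (\<Sum>m=1..n. \<bar>fbm_corr (real m)\<bar>)"
    by (simp add: atMost_atLeast0 sum.atLeast_Suc_atMost)
  then show "(\<Sum>m\<le>n. \<bar>fbm_corr (real m)\<bar>) \<le> 3 / 2" using sum_abs_fbm_corr[of n] by simp
qed simp

text \<open>Lag 0 contributes 1 and each of the two sides at most 1/2, uniformly in \<open>i\<close>
  and \<open>n\<close>.\<close>

lemma fbm_corr_row_sum:
  assumes "i \<in> {1..n}"
  shows "(\<Sum>j=1..n. \<bar>fbm_corr (real i - real j)\<bar>) \<le> 2"
proof -
  have e: "\<bar>fbm_corr (real i - real j)\<bar> = \<bar>fbm_corr (real (nat \<bar>int i - int j\<bar>))\<bar>" for j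
    by simp
  have "(\<Sum>j=1..n. \<bar>fbm_corr (real i - real j)\<bar>) = (\<Sum>m<i. \<bar>fbm_corr (real m)\<bar>) + (\<Sum>m=1..n - i. \<bar>fbm_corr (real m)\<bar>)"
    unfolding e by (rule sum_abs_diff[OF assms, of "\<lambda>m. \<bar>fbm_corr (real m)\<bar>"])
  also have "(\<Sum>m<i. \<bar>fbm_corr (real m)\<bar>) = 1 + (\<Sum>m=1..i - 1. \<bar>fbm_corr (real m)\<bar>)"
  proof -
    have "{..<i} = insert 0 {1..i - 1}" using assms by auto
    then show ?thesis by simp
  qed
  finally show ?thesis using sum_abs_fbm_corr[of "i - 1"] sum_abs_fbm_corr[of "n - i"] by linarith
qed

text \<open>\<open>sigma_check_l\<close> is defined by \<open>lim\<close>, so its value has meaning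
  only once convergence is known. Summability of \<open>\<bar>r\<bar> ^ l\<close> follows from that
  of \<open>\<bar>r\<bar>\<close> because \<open>\<bar>r\<bar> \<le> 1\<close>.\<close>

lemma sigma_check_l_tendsto:
  assumes l: "l \<ge> 1"
  shows "(\<lambda>n. (1 / real n) * (\<Sum>i=1..n. \<Sum>j=1..n. fbm_corr (real i - real j) ^ l)) \<longlonglongrightarrow> sigma_check_l l"
proof -
  have e: "fbm_corr (real i - real j) ^ l = fbm_corr (real (nat \<bar>int i - int j\<bar>)) ^ l" for i j by simp
  have "summable (\<lambda>m. fbm_corr (real m) ^ l)"
  proof (rule summable_comparison_test'[OF summable_abs_fbm_corr])
    fix m :: nat
    have "\<bar>fbm_corr (real m)\<bar> ^ l \<le> \<bar>fbm_corr (real m)\<bar> ^ 1"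
      using abs_fbm_corr_le_1 l by (intro power_decreasing) auto
    then show "norm (fbm_corr (real m) ^ l) \<le> \<bar>fbm_corr (real m)\<bar>" by (simp add: power_abs)
  qed
  from toeplitz_mean_tendsto[OF this]
  obtain L where L: "(\<lambda>n. (1 / real n) * (\<Sum>i=1..n. \<Sum>j=1..n. fbm_corr (real i - real j) ^ l)) \<longlonglongrightarrow> L"
    unfolding e by blast
  moreover have "sigma_check_l l = L"
    unfolding sigma_check_l_def fbm_corr_abs by (rule limI[OF L])
  ultimately show ?thesis by simp
qed

text \<open>For even powers the off-diagonal terms are nonnegative and the diagonal alone has mean
  1. This keeps the limiting normal laws nondegenerate.\<close>

lemma sigma_check_l_ge_1:
  assumes "even l" "l \<ge> 1"
  shows "sigma_check_l l \<ge> 1"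
proof (rule LIMSEQ_le_const[OF sigma_check_l_tendsto[OF assms(2)]])
  have "1 \<le> (1 / real n) * (\<Sum>i=1..n. \<Sum>j=1..n. fbm_corr (real i - real j) ^ l)" if "n \<ge> 1" for n
  proof -
    have "(\<Sum>i=1..n. (1::real)) \<le> (\<Sum>i=1..n. \<Sum>j=1..n. fbm_corr (real i - real j) ^ l)"
    proof (rule sum_mono)
      fix i assume i: "i \<in> {1..n}"
      have "fbm_corr (real i - real i) ^ l \<le> (\<Sum>j=1..n. fbm_corr (real i - real j) ^ l)"
        using i assms(1) by (intro member_le_sum) (auto simp: zero_le_even_power)
      then show "1 \<le> (\<Sum>j=1..n. fbm_corr (real i - real j) ^ l)" by simp
    qed
    then show ?thesis using that by (simp add: field_simps)
  qed
  then show "\<exists>N. \<forall>n\<ge>N. 1 \<le> (1 / real n) * (\<Sum>i=1..n. \<Sum>j=1..n. fbm_corr (real i - real j) ^ l)" by blast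
qed

lemma sigma_check_pos: "sigma_check > 0"
  using sigma_check_l_ge_1[of 2] sigma_check_l_ge_1[of 4] by (simp add: sigma_check_def)

section \<open>The normalised covariance of the increments of the solution\<close>

text \<open>Rationalising twice gives the exact value
  \<open>- 2 * h\<^sup>2 / ((p + q) * (q + m) * (p + m))\<close> for the roots
  \<open>p, q, m\<close> at \<open>a + h, a, a - h\<close>, and all three roots are at least
  \<open>sqrt b\<close>.\<close>

lemma sqrt_second_difference:
  assumes h: "h \<ge> 0" and b: "b > 0" and ab: "a - h \<ge> b"
  shows "\<bar>sqrt (a + h) + sqrt (a - h) - 2 * sqrt a\<bar> \<le> 2 * h\<^sup>2 / (2 * sqrt b) ^ 3"
proof -
  define p q m \<mu> where "p = sqrt (a + h)" and "q = sqrt a" and "m = sqrt (a - h)" and "\<mu> = sqrt b"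
  have mu: "\<mu> > 0" "\<mu> \<le> m" "\<mu> \<le> q" "\<mu> \<le> p" using assms by (auto simp: p_def q_def m_def \<mu>_def)
  have sq: "p\<^sup>2 = a + h" "q\<^sup>2 = a" "m\<^sup>2 = a - h" using assms by (auto simp: p_def q_def m_def)
  have pos: "p + q > 0" "q + m > 0" "p + m > 0" using mu by auto
  have "p - q = h / (p + q)" using sq pos by (simp add: eq_divide_eq power2_eq_square algebra_simps)
  moreover have "q - m = h / (q + m)" using sq pos by (simp add: eq_divide_eq power2_eq_square algebra_simps)
  ultimately have "p + m - 2 * q = h / (p + q) - h / (q + m)" by linarith
  also have "\<dots> = h * (m - p) / ((p + q) * (q + m))" using pos by (simp add: field_simps)
  also have "m - p = - (2 * h / (p + m))"
  proof -
    have "p - m = 2 * h / (p + m)" using sq pos by (simp add: eq_divide_eq power2_eq_square algebra_simps)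
    then show ?thesis by linarith
  qed
  finally have "\<bar>p + m - 2 * q\<bar> = 2 * h\<^sup>2 / ((p + q) * (q + m) * (p + m))"
    using pos h by (simp add: abs_mult abs_divide power2_eq_square mult_ac)
  also have "\<dots> \<le> 2 * h\<^sup>2 / ((2 * \<mu>) * (2 * \<mu>) * (2 * \<mu>))"
    using mu pos by (intro divide_left_mono mult_mono mult_pos_pos) auto
  finally show ?thesis by (simp add: p_def q_def m_def \<mu>_def power3_eq_cube)
qed

text \<open>Mixed second difference over \<open>[t - h, t] \<times> [s - h, s]\<close> of the covariance
  \<open>sqrt (t + s) - sqrt \<bar>t - s\<bar>\<close> of the solution (up to a constant factor).\<close>
definition mixed_diff :: "real \<Rightarrow> real \<Rightarrow> real \<Rightarrow> real" where
  "mixed_diff h t s = (sqrt (t + s) - sqrt \<bar>t - s\<bar>) - (sqrt (t - h + s) - sqrt \<bar>t - h - s\<bar>)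
     - (sqrt (t + (s - h)) - sqrt \<bar>t - (s - h)\<bar>) + (sqrt (t - h + (s - h)) - sqrt \<bar>t - h - (s - h)\<bar>)"

text \<open>The divisor \<open>2 * sqrt h\<close> is what the part
  \<open>- sqrt \<bar>t - s\<bar>\<close> contributes to \<open>mixed_diff\<close> on the diagonal,
  so that part is normalised to correlation exactly 1 there. Indices refer to the right endpoints of
  the increments.\<close>

definition incr_corr :: "real \<Rightarrow> real \<Rightarrow> nat \<Rightarrow> nat \<Rightarrow> nat \<Rightarrow> real" where
  "incr_corr c d n i j = mixed_diff ((d - c) / real n) (c + (d - c) / real n * real i) (c + (d - c) / real n * real j)
     / (2 * sqrt ((d - c) / real n))"

text \<open>The part \<open>- sqrt \<bar>t - s\<bar>\<close> is homogeneous in the step and gives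
  \<open>fbm_corr\<close> exactly. The other part depends on \<open>t + s\<close> alone, so its
  mixed difference is an ordinary second difference of the square root, centred at
  \<open>a\<close>.\<close>

lemma incr_corr_eq:
  assumes cd: "c < d" and n: "n \<ge> 1"
    and h_def: "h = (d - c) / real n" and a_def: "a = 2 * c + h * (real i + real j - 1)"
  shows "incr_corr c d n i j = fbm_corr (real i - real j) + (sqrt (a + h) + sqrt (a - h) - 2 * sqrt a) / (2 * sqrt h)"
proof -
  have h: "h > 0" using cd n by (simp add: h_def)
  have sh: "sqrt \<bar>h * y\<bar> = sqrt h * sqrt \<bar>y\<bar>" for y using h by (simp add: abs_mult real_sqrt_mult)
  have e: "c + h * real i + (c + h * real j) = a + h" "c + h * real i - h + (c + h * real j) = a"
    "c + h * real i + (c + h * real j - h) = a" "c + h * real i - h + (c + h * real j - h) = a - h"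
    by (simp_all add: a_def algebra_simps)
  have g: "c + h * real i - (c + h * real j) = h * (real i - real j)" "c + h * real i - h - (c + h * real j) = h * (real i - real j - 1)"
    "c + h * real i - (c + h * real j - h) = h * (real i - real j + 1)" "c + h * real i - h - (c + h * real j - h) = h * (real i - real j)"
    by (simp_all add: algebra_simps)
  have "mixed_diff h (c + h * real i) (c + h * real j)
    = (sqrt (a + h) + sqrt (a - h) - 2 * sqrt a) + 2 * sqrt h * fbm_corr (real i - real j)"
  proof -
    have "2 * sqrt h * fbm_corr (real i - real j) = sqrt h * (sqrt \<bar>real i - real j + 1\<bar> + sqrt \<bar>real i - real j - 1\<bar> - 2 * sqrt \<bar>real i - real j\<bar>)"
      by (simp add: fbm_corr_sqrt)
    then show ?thesis unfolding mixed_diff_def e g sh by (simp only: algebra_simps)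
  qed
  then show ?thesis
    unfolding incr_corr_def h_def[symmetric] using h by (simp add: add_divide_distrib)
qed

context
  fixes c d :: real
  assumes c: "0 < c" and cd: "c < d"
begin

text \<open>The bound of \<open>sqrt_second_difference\<close> with lower bound
  \<open>2 * c\<close>, divided by \<open>2 * sqrt h\<close>, is
  \<open>h * sqrt h / (2 * sqrt (2 * c)) ^ 3\<close>; this constant is what remains after extracting
  \<open>n * sqrt n\<close>.\<close>

definition incr_err :: real where
  "incr_err = sqrt ((d - c) ^ 3) / (2 * sqrt (2 * c)) ^ 3"

lemma incr_err_nonneg: "incr_err \<ge> 0"
  using c cd by (simp add: incr_err_def)

text \<open>Since \<open>c > 0\<close>, the second difference stays away from the singularity of the
  square root at 0 and is of order \<open>h\<^sup>2\<close>, against a normalisation of order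
  \<open>sqrt h\<close>.\<close>

lemma incr_corr_approx:
  assumes i: "i \<in> {1..n}" and j: "j \<in> {1..n}"
  shows "\<bar>incr_corr c d n i j - fbm_corr (real i - real j)\<bar> \<le> incr_err / (real n * sqrt (real n))"
proof -
  define h where "h = (d - c) / real n"
  define a where "a = 2 * c + h * (real i + real j - 1)"
  have n: "n \<ge> 1" "real n > 0" using i by auto
  have h: "h > 0" using cd n by (simp add: h_def)
  have ij: "1 \<le> real i" "1 \<le> real j" using i j by auto
  \<comment> \<open>Indices start at 1, so \<open>a - h\<close>, the sum of the two left endpoints,
    is at least \<open>2 * c\<close>.\<close>
  have "0 \<le> h * (real i + real j - 2)" using h ij by (intro mult_nonneg_nonneg) auto
  then have ah: "a - h \<ge> 2 * c" by (simp add: a_def algebra_simps)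
  have "\<bar>incr_corr c d n i j - fbm_corr (real i - real j)\<bar> = \<bar>sqrt (a + h) + sqrt (a - h) - 2 * sqrt a\<bar> / (2 * sqrt h)"
    unfolding incr_corr_eq[OF cd n(1) h_def a_def] using h by simp
  also have "\<dots> \<le> (2 * h\<^sup>2 / (2 * sqrt (2 * c)) ^ 3) / (2 * sqrt h)"
    using c h ah by (intro divide_right_mono sqrt_second_difference) auto
  also have "\<dots> = (h\<^sup>2 / sqrt h) / (2 * sqrt (2 * c)) ^ 3" by simp
  also have "h\<^sup>2 / sqrt h = h * sqrt h"
    using h by (simp add: power2_eq_square real_div_sqrt flip: times_divide_eq_right)
  also have "h * sqrt h = sqrt ((d - c) ^ 3) / (real n * sqrt (real n))"
  proof -
    have "sqrt ((d - c) ^ 3) = (d - c) * sqrt (d - c)" using cd by (simp add: power3_eq_cube real_sqrt_mult)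
    then show ?thesis by (simp add: h_def real_sqrt_divide)
  qed
  finally show ?thesis by (simp add: incr_err_def mult_ac)
qed

text \<open>Positivity is needed for every \<open>n\<close>, while the approximation is informative
  only for large \<open>n\<close>. Subadditivity of the square root shows instead that the
  perturbation exceeds \<open>- 1\<close>, whereas the fractional part of the variance is 1.\<close>

lemma incr_corr_pos:
  assumes i: "i \<in> {1..n}"
  shows "incr_corr c d n i i > 0"
proof -
  define h where "h = (d - c) / real n"
  define a where "a = 2 * c + h * (real i + real i - 1)"
  have n: "n \<ge> 1" "real n > 0" using i by auto
  have h: "h > 0" using cd n by (simp add: h_def)
  have ij: "1 \<le> real i" using i by auto
  have "0 \<le> h * (real i + real i - 2)" using h ij by (intro mult_nonneg_nonneg) auto
  then have ah: "a - h \<ge> 0" using c by (simp add: a_def algebra_simps)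
  have "sqrt a \<le> sqrt (a - h) + sqrt h" using sqrt_add_le_add_sqrt[of "a - h" h] ah h by simp
  moreover have "sqrt a \<le> sqrt (a + h)" using h by simp
  moreover have "sqrt h > 0" using h by simp
  ultimately have "sqrt (a + h) + sqrt (a - h) - 2 * sqrt a > - (2 * sqrt h)" by linarith
  then have "(sqrt (a + h) + sqrt (a - h) - 2 * sqrt a) / (2 * sqrt h) > - 1"
    using h by (simp add: less_divide_eq)
  then show ?thesis
    unfolding incr_corr_eq[OF cd n(1) h_def a_def] by simp
qed

lemma incr_corr_bound:
  assumes "i \<in> {1..n}" "j \<in> {1..n}"
  shows "\<bar>incr_corr c d n i j\<bar> \<le> 1 + incr_err"
proof -
  have n: "real n \<ge> 1" using assms by auto
  have "1 * 1 \<le> real n * sqrt (real n)" using n by (intro mult_mono) auto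
  then have "incr_err / (real n * sqrt (real n)) \<le> incr_err / 1"
    using incr_err_nonneg by (intro divide_left_mono) auto
  moreover have "\<bar>fbm_corr (real i - real j)\<bar> \<le> 1"
    using abs_fbm_corr_le_1[of "nat \<bar>int i - int j\<bar>"] by simp
  ultimately show ?thesis using incr_corr_approx[OF assms] by linarith
qed

lemma incr_corr_row:
  assumes i: "i \<in> {1..n}"
  shows "(\<Sum>j=1..n. \<bar>incr_corr c d n i j\<bar>) \<le> 2 + incr_err"
proof -
  have n: "real n \<ge> 1" using i by auto
  have "(\<Sum>j=1..n. \<bar>incr_corr c d n i j\<bar>) \<le> (\<Sum>j=1..n. \<bar>fbm_corr (real i - real j)\<bar> + incr_err / (real n * sqrt (real n)))"
  proof (rule sum_mono)
    fix j assume "j \<in> {1..n}"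
    from incr_corr_approx[OF i this]
    show "\<bar>incr_corr c d n i j\<bar> \<le> \<bar>fbm_corr (real i - real j)\<bar> + incr_err / (real n * sqrt (real n))" by linarith
  qed
  also have "\<dots> = (\<Sum>j=1..n. \<bar>fbm_corr (real i - real j)\<bar>) + incr_err / sqrt (real n)"
    using n by (simp add: sum.distrib)
  also have "\<dots> \<le> 2 + incr_err / 1"
    using n incr_err_nonneg by (intro add_mono fbm_corr_row_sum i divide_left_mono) auto
  finally show ?thesis by simp
qed

text \<open>Replacing each covariance by its fractional counterpart changes a summand by
  \<open>O(n powr (-3/2))\<close>; with \<open>n\<^sup>2\<close> summands and the prefactor
  \<open>1 / n\<close> the total change is \<open>O(1 / sqrt n)\<close>.\<close>

lemma incr_corr_variance_limit:
  "(\<lambda>n. (1 / real n) * (\<Sum>i=1..n. \<Sum>j=1..n. 72 * (incr_corr c d n i j)\<^sup>2 * incr_corr c d n i i * incr_corr c d n j j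
      + 24 * incr_corr c d n i j ^ 4)) \<longlonglongrightarrow> sigma_check"
proof -
  define B where "B = 1 + incr_err"
  have B: "B \<ge> 1" using incr_err_nonneg by (simp add: B_def)
  define P where "P n i j = 72 * (incr_corr c d n i j)\<^sup>2 * incr_corr c d n i i * incr_corr c d n j j + 24 * incr_corr c d n i j ^ 4" for n i j
  define Q where "Q i j = 72 * (fbm_corr (real i - real j))\<^sup>2 + 24 * fbm_corr (real i - real j) ^ 4" for i j :: nat
  \<comment> \<open>Factors are exchanged one at a time and lower powers of \<open>B\<close> raised
    to \<open>B ^ 3\<close>. The fourth power contributes \<open>24 * 4\<close>, the square
    \<open>72 * 2\<close>, the two variances 72 each: 384 in total.\<close>
  have PQ: "\<bar>P n i j - Q i j\<bar> \<le> 384 * B ^ 3 * (incr_err / (real n * sqrt (real n)))"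
    if ij: "i \<in> {1..n}" "j \<in> {1..n}" for n i j
  proof -
    define x v w r \<epsilon> where "x = incr_corr c d n i j" and "v = incr_corr c d n i i" and "w = incr_corr c d n j j"
      and "r = fbm_corr (real i - real j)" and "\<epsilon> = incr_err / (real n * sqrt (real n))"
    have xb: "\<bar>x\<bar> \<le> B" "\<bar>v\<bar> \<le> B" "\<bar>w\<bar> \<le> B" unfolding x_def v_def w_def B_def using ij by (auto intro: incr_corr_bound)
    have rb: "\<bar>r\<bar> \<le> 1" unfolding r_def using abs_fbm_corr_le_1[of "nat \<bar>int i - int j\<bar>"] by simp
    have e: "\<bar>x - r\<bar> \<le> \<epsilon>" "\<bar>v - 1\<bar> \<le> \<epsilon>" "\<bar>w - 1\<bar> \<le> \<epsilon>"
      using incr_corr_approx[OF ij] incr_corr_approx[OF ij(1) ij(1)] incr_corr_approx[OF ij(2) ij(2)]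
      by (auto simp: x_def v_def w_def r_def \<epsilon>_def)
    have e0: "\<epsilon> \<ge> 0" using e(1) by linarith
    have m: "\<bar>y * z\<bar> \<le> a * b" if "\<bar>y\<bar> \<le> a" "\<bar>z\<bar> \<le> b" for y z a b :: real
      unfolding abs_mult using that by (intro mult_mono) auto
    have xr: "\<bar>x + r\<bar> \<le> 2 * B" using xb rb B by linarith
    have sq: "\<bar>x\<^sup>2 - r\<^sup>2\<bar> \<le> \<epsilon> * (2 * B)"
      using m[OF e(1) xr] by (simp add: power2_eq_square algebra_simps)
    have x2: "\<bar>x\<^sup>2\<bar> \<le> B\<^sup>2" using m[OF xb(1) xb(1)] by (simp add: power2_eq_square)
    have r1: "\<bar>r\<^sup>2\<bar> \<le> 1" using m[OF rb rb] by (simp add: power2_eq_square)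
    have B2: "1 \<le> B\<^sup>2" "B\<^sup>2 \<le> B ^ 3" using B by (auto intro: power_increasing)
    have s2: "\<bar>x\<^sup>2 + r\<^sup>2\<bar> \<le> 2 * B\<^sup>2" using x2 r1 B2 by linarith
    have "x ^ 4 - r ^ 4 = (x\<^sup>2 - r\<^sup>2) * (x\<^sup>2 + r\<^sup>2)" by (simp add: power2_eq_square power4_eq_xxxx algebra_simps)
    then have t1: "\<bar>x ^ 4 - r ^ 4\<bar> \<le> \<epsilon> * (2 * B) * (2 * B\<^sup>2)" using m[OF sq s2] by simp
    have vw: "\<bar>v * w\<bar> \<le> B * B" by (rule m[OF xb(2,3)])
    have t2: "\<bar>(x\<^sup>2 - r\<^sup>2) * (v * w)\<bar> \<le> \<epsilon> * (2 * B) * (B * B)" by (rule m[OF sq vw])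
    have t3: "\<bar>r\<^sup>2 * ((v - 1) * w)\<bar> \<le> 1 * (\<epsilon> * B)" by (rule m[OF r1 m[OF e(2) xb(3)]])
    have t4: "\<bar>r\<^sup>2 * (w - 1)\<bar> \<le> 1 * \<epsilon>" by (rule m[OF r1 e(3)])
    have PQ_eq: "P n i j - Q i j = 24 * (x ^ 4 - r ^ 4) + 72 * ((x\<^sup>2 - r\<^sup>2) * (v * w)) + 72 * (r\<^sup>2 * ((v - 1) * w)) + 72 * (r\<^sup>2 * (w - 1))"
      by (simp add: P_def Q_def x_def[symmetric] v_def[symmetric] w_def[symmetric] r_def[symmetric] algebra_simps)
    have "\<bar>P n i j - Q i j\<bar> \<le> 24 * (\<epsilon> * (2 * B) * (2 * B\<^sup>2)) + 72 * (\<epsilon> * (2 * B) * (B * B)) + 72 * (1 * (\<epsilon> * B)) + 72 * (1 * \<epsilon>)"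
    proof -
      have "\<bar>24 * y1 + 72 * y2 + 72 * y3 + 72 * y4\<bar> \<le> 24 * a1 + 72 * a2 + 72 * a3 + 72 * a4"
        if "\<bar>y1\<bar> \<le> a1" "\<bar>y2\<bar> \<le> a2" "\<bar>y3\<bar> \<le> a3" "\<bar>y4\<bar> \<le> a4" for y1 y2 y3 y4 a1 a2 a3 a4 :: real
        using that by linarith
      from this[OF t1 t2 t3 t4] show ?thesis unfolding PQ_eq .
    qed
    also have "\<dots> = 240 * (B ^ 3 * \<epsilon>) + 72 * (B * \<epsilon>) + 72 * (1 * \<epsilon>)" by (simp add: power2_eq_square power3_eq_cube)
    also have "\<dots> \<le> 240 * (B ^ 3 * \<epsilon>) + 72 * (B ^ 3 * \<epsilon>) + 72 * (B ^ 3 * \<epsilon>)"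
    proof (intro add_mono mult_left_mono mult_right_mono e0)
      show "B \<le> B ^ 3" using power_increasing[of 1 3 B] B by simp
      show "1 \<le> B ^ 3" using B by simp
    qed (use B in auto)
    finally show ?thesis by (simp add: \<epsilon>_def mult_ac)
  qed
  have diff: "(\<lambda>n. (1 / real n) * (\<Sum>i=1..n. \<Sum>j=1..n. P n i j) - (1 / real n) * (\<Sum>i=1..n. \<Sum>j=1..n. Q i j)) \<longlonglongrightarrow> 0"
  proof (rule Lim_null_comparison)
    show "\<forall>\<^sub>F n in sequentially. norm ((1 / real n) * (\<Sum>i=1..n. \<Sum>j=1..n. P n i j) - (1 / real n) * (\<Sum>i=1..n. \<Sum>j=1..n. Q i j))
       \<le> 384 * B ^ 3 * incr_err / sqrt (real n)"
      using eventually_ge_at_top[of 1]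
    proof eventually_elim
      case (elim n)
      have n: "real n > 0" using elim by simp
      let ?e = "384 * B ^ 3 * (incr_err / (real n * sqrt (real n)))"
      have "\<bar>\<Sum>i=1..n. \<Sum>j=1..n. P n i j - Q i j\<bar> \<le> (\<Sum>i=1..n. \<Sum>j=1..n. ?e)"
        by (rule order_trans[OF sum_abs sum_mono], rule order_trans[OF sum_abs sum_mono], rule PQ)
      also have "\<dots> = real n * (real n * ?e)" by simp
      finally have "(1 / real n) * \<bar>\<Sum>i=1..n. \<Sum>j=1..n. P n i j - Q i j\<bar> \<le> (1 / real n) * (real n * (real n * ?e))"
        by (intro mult_left_mono) auto
      also have "\<dots> = 384 * B ^ 3 * incr_err / sqrt (real n)" using n by (simp add: field_simps)
      finally show ?case using n
        by (simp add: sum_subtractf flip: right_diff_distrib diff_divide_distrib)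
    qed
    show "(\<lambda>n. 384 * B ^ 3 * incr_err / sqrt (real n)) \<longlonglongrightarrow> 0"
      by (intro tendsto_divide_0[OF tendsto_const] filterlim_at_top_imp_at_infinity
        filterlim_compose[OF sqrt_at_top filterlim_real_sequentially])
  qed
  have Qe: "(1 / real n) * (\<Sum>i=1..n. \<Sum>j=1..n. Q i j) = 72 * ((1 / real n) * (\<Sum>i=1..n. \<Sum>j=1..n. fbm_corr (real i - real j) ^ 2))
      + 24 * ((1 / real n) * (\<Sum>i=1..n. \<Sum>j=1..n. fbm_corr (real i - real j) ^ 4))" for n
    unfolding Q_def by (simp add: sum.distrib sum_distrib_left distrib_left add_divide_distrib sum_divide_distrib)
  have "(\<lambda>n. (1 / real n) * (\<Sum>i=1..n. \<Sum>j=1..n. Q i j)) \<longlonglongrightarrow> sigma_check"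
    unfolding Qe sigma_check_def by (intro tendsto_add tendsto_mult tendsto_const sigma_check_l_tendsto) auto
  from tendsto_add[OF diff this] show ?thesis by (simp add: P_def)
qed

text \<open>The \<open>n\<close> summands are \<open>O(n powr (-3/2))\<close>, so the quotient is
  even \<open>O(1/n)\<close>.\<close>

lemma incr_corr_bias: "(\<lambda>n. (\<Sum>i=1..n. (incr_corr c d n i i)\<^sup>2 - 1) / sqrt (real n)) \<longlonglongrightarrow> 0"
proof (rule Lim_null_comparison)
  define B where "B = 1 + incr_err"
  have B: "B \<ge> 1" using incr_err_nonneg by (simp add: B_def)
  show "\<forall>\<^sub>F n in sequentially. norm ((\<Sum>i=1..n. (incr_corr c d n i i)\<^sup>2 - 1) / sqrt (real n)) \<le> incr_err * (2 * B) / real n"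
    using eventually_ge_at_top[of 1]
  proof eventually_elim
    case (elim n)
    have n: "real n > 0" using elim by simp
    have "\<bar>(incr_corr c d n i i)\<^sup>2 - 1\<bar> \<le> incr_err / (real n * sqrt (real n)) * (2 * B)" if i: "i \<in> {1..n}" for i
    proof -
      define v where "v = incr_corr c d n i i"
      have "\<bar>v - 1\<bar> \<le> incr_err / (real n * sqrt (real n))" using incr_corr_approx[OF i i] by (simp add: v_def)
      moreover have "\<bar>v + 1\<bar> \<le> 2 * B" using incr_corr_bound[OF i i] B by (simp add: v_def B_def)
      ultimately have "\<bar>v - 1\<bar> * \<bar>v + 1\<bar> \<le> incr_err / (real n * sqrt (real n)) * (2 * B)" by (intro mult_mono) auto
      moreover have "v\<^sup>2 - 1 = (v - 1) * (v + 1)" by (simp add: power2_eq_square algebra_simps)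
      ultimately show ?thesis by (simp add: v_def abs_mult)
    qed
    then have "\<bar>\<Sum>i=1..n. (incr_corr c d n i i)\<^sup>2 - 1\<bar> \<le> (\<Sum>i=1..n. incr_err / (real n * sqrt (real n)) * (2 * B))"
      by (intro order_trans[OF sum_abs sum_mono])
    also have "\<dots> = incr_err * (2 * B) / sqrt (real n)" using n by simp
    finally have "\<bar>\<Sum>i=1..n. (incr_corr c d n i i)\<^sup>2 - 1\<bar> / sqrt (real n) \<le> incr_err * (2 * B) / sqrt (real n) / sqrt (real n)"
      by (intro divide_right_mono) auto
    then show ?case by simp
  qed
  show "(\<lambda>n. incr_err * (2 * B) / real n) \<longlonglongrightarrow> 0"
    by (intro tendsto_divide_0[OF tendsto_const] filterlim_at_top_imp_at_infinity filterlim_real_sequentially)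
qed

end

section \<open>The stochastic heat equation\<close>

definition she_kernel :: "real \<Rightarrow> real \<Rightarrow> real \<Rightarrow> real \<times> real \<Rightarrow> real" where
  "she_kernel \<theta> x t = (\<lambda>(s, y). if 0 \<le> s \<and> s < t then heat_kernel \<theta> (t - s) (x - y) else 0)"

lemma she_solution_kernel: "she_solution \<theta> \<sigma> W t x w = \<sigma> * W (she_kernel \<theta> x t) w"
  by (simp add: she_solution_def she_kernel_def)

lemma heat_kernel_normal:
  assumes "\<theta> > 0" "s > 0"
  shows "heat_kernel \<theta> s z = normal_density 0 (sqrt (2 * \<theta> * s)) z"
proof -
  have "(4 * pi * \<theta> * s) powr (-1/2) = 1 / sqrt (4 * pi * \<theta> * s)"
    using assms by (simp add: powr_minus_divide powr_half_sqrt)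
  then show ?thesis using assms
    by (simp add: heat_kernel_def normal_density_def mult_ac)
qed

lemma measurable_she_kernel[measurable]: "she_kernel \<theta> x t \<in> borel_measurable borel"
  unfolding she_kernel_def heat_kernel_def
  by (simp only: borel_prod[symmetric]) measurable

lemma she_kernel_nonneg: "she_kernel \<theta> x t z \<ge> 0"
  by (cases z) (simp add: she_kernel_def heat_kernel_def)

text \<open>After reflection this is the convolution of two centred normal densities at 0, hence the
  density at 0 of a normal law with the summed variance.\<close>

lemma nn_integral_normal_product:
  assumes "\<sigma> > 0" "\<tau> > 0"
  shows "(\<integral>\<^sup>+y. ennreal (normal_density 0 \<sigma> (x - y) * normal_density 0 \<tau> (x - y)) \<partial>lborel) = ennreal (1 / sqrt (2 * pi * (\<sigma>\<^sup>2 + \<tau>\<^sup>2)))"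
proof -
  have "(\<integral>\<^sup>+y. ennreal (normal_density 0 \<sigma> (x - y) * normal_density 0 \<tau> (x - y)) \<partial>lborel)
    = (\<integral>\<^sup>+y. ennreal (normal_density 0 \<sigma> (x - (x + (-1) * y)) * normal_density 0 \<tau> (x - (x + (-1) * y))) \<partial>lborel)"
    by (subst nn_integral_real_affine[where c="-1" and t=x]) auto
  also have "\<dots> = (\<integral>\<^sup>+y. ennreal (normal_density 0 \<sigma> (0 - y) * normal_density 0 \<tau> y) \<partial>lborel)"
    by (simp add: normal_density_def)
  also have "\<dots> = normal_density 0 (sqrt (\<sigma>\<^sup>2 + \<tau>\<^sup>2)) 0"
    using fun_cong[OF conv_normal_density_zero_mean[OF assms], of 0] .
  also have "normal_density 0 (sqrt (\<sigma>\<^sup>2 + \<tau>\<^sup>2)) 0 = 1 / sqrt (2 * pi * (\<sigma>\<^sup>2 + \<tau>\<^sup>2))"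
    by (simp add: normal_density_def)
  finally show ?thesis .
qed

text \<open>For \<open>s = t\<close> the integrand is unbounded at \<open>r = s\<close>. The
  fundamental theorem is therefore used on the open interval, with one-sided limits of the
  primitive, which is continuous at both ends.\<close>

lemma nn_integral_inverse_sqrt:
  fixes s t :: real
  assumes s: "0 < s" and st: "s \<le> t"
  shows "(\<integral>\<^sup>+r. ennreal (indicator {0<..<s} r * (1 / sqrt (t + s - 2 * r))) \<partial>lborel) = ennreal (sqrt (t + s) - sqrt (t - s))"
proof -
  define F where "F r = - sqrt (t + s - 2 * r)" for r
  define f where "f r = 1 / sqrt (t + s - 2 * r)" for r
  have pos: "t + s - 2 * r > 0" if "r < s" for r using that st by linarith
  have F: "DERIV F r :> f r" if "r < s" for r
    unfolding F_def f_def using pos[OF that] by (auto intro!: derivative_eq_intros simp: field_simps)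
  have f: "isCont f r" if "r < s" for r
    unfolding f_def using pos[OF that] by (intro continuous_intros) auto
  have cF: "isCont F r" for r unfolding F_def by (intro continuous_intros)
  have ft: "ereal 0 < ereal s" using s by simp
  have lim: "((F \<circ> real_of_ereal) \<longlongrightarrow> F 0) (at_right (ereal 0))" "((F \<circ> real_of_ereal) \<longlongrightarrow> F s) (at_left (ereal s))"
    using cF[of 0] cF[of s] unfolding ereal_tendsto_simps1 isCont_def filterlim_at_split by auto
  have f0: "AE x in lborel. ereal 0 < ereal x \<longrightarrow> ereal x < ereal s \<longrightarrow> 0 \<le> f x"
    using pos by (intro AE_I2) (auto simp: f_def intro: less_imp_le)
  have "set_integrable lborel (einterval (ereal 0) (ereal s)) f" "(LBINT x=ereal 0..ereal s. f x) = F s - F 0"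
    using interval_integral_FTC_nonneg[OF ft _ _ f0 lim] F f by simp_all
  then have int: "integrable lborel (\<lambda>r. indicator {0<..<s} r * f r)" and val: "(\<integral>r. indicator {0<..<s} r * f r \<partial>lborel) = F s - F 0"
    using s by (simp_all add: set_integrable_def interval_lebesgue_integral_def set_lebesgue_integral_def einterval_eq)
  have "(\<integral>\<^sup>+r. ennreal (indicator {0<..<s} r * f r) \<partial>lborel) = ennreal (\<integral>r. indicator {0<..<s} r * f r \<partial>lborel)"
    using pos by (intro nn_integral_eq_integral int AE_I2) (auto simp: f_def indicator_def intro: less_imp_le)
  then show ?thesis unfolding val by (simp add: f_def F_def)
qed

text \<open>Up to \<open>\<sigma>\<^sup>2\<close> this inner product is the covariance of the
  solution at times \<open>t\<close> and \<open>s\<close>. In space the heat kernels convolve to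
  variance \<open>2 * \<theta> * (t + s - 2 * r)\<close>; the remaining time integral is
  \<open>nn_integral_inverse_sqrt\<close>.\<close>

lemma she_kernel_inner_ordered:
  assumes \<theta>: "\<theta> > 0" and s: "0 < s" and st: "s \<le> t"
  shows "has_bochner_integral lborel (\<lambda>z. she_kernel \<theta> x t z * she_kernel \<theta> x s z)
    ((sqrt (t + s) - sqrt \<bar>t - s\<bar>) / sqrt (4 * pi * \<theta>))"
proof (rule has_bochner_integral_nn_integral)
  let ?k = "\<lambda>z. she_kernel \<theta> x t z * she_kernel \<theta> x s z"
  show "(\<lambda>z. ?k z) \<in> borel_measurable lborel" by measurable
  show "AE z in lborel. 0 \<le> ?k z"
    by (intro AE_I2 mult_nonneg_nonneg she_kernel_nonneg)
  show "0 \<le> (sqrt (t + s) - sqrt \<bar>t - s\<bar>) / sqrt (4 * pi * \<theta>)"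
    using \<theta> s st by (intro divide_nonneg_nonneg) auto
  define k where "k = 1 / sqrt (4 * pi * \<theta>)"
  have k: "k > 0" using \<theta> by (simp add: k_def)
  \<comment> \<open>The kernel is nonzero at time \<open>r = 0\<close> while the open interval
    excludes it; this null set is dropped below.\<close>
  have inner: "(\<integral>\<^sup>+y. ennreal (?k (r, y)) \<partial>lborel)
     = ennreal k * ennreal (indicator {0<..<s} r * (1 / sqrt (t + s - 2 * r)))" if r0: "r \<noteq> 0" for r
  proof (cases "0 < r \<and> r < s")
    case True
    have "(\<integral>\<^sup>+y. ennreal (?k (r, y)) \<partial>lborel)
      = (\<integral>\<^sup>+y. ennreal (normal_density 0 (sqrt (2 * \<theta> * (t - r))) (x - y) * normal_density 0 (sqrt (2 * \<theta> * (s - r))) (x - y)) \<partial>lborel)"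
      using True st \<theta> by (simp add: she_kernel_def heat_kernel_normal)
    also have "\<dots> = ennreal (1 / sqrt (2 * pi * ((sqrt (2 * \<theta> * (t - r)))\<^sup>2 + (sqrt (2 * \<theta> * (s - r)))\<^sup>2)))"
      using True st \<theta> by (intro nn_integral_normal_product) auto
    also have "2 * pi * ((sqrt (2 * \<theta> * (t - r)))\<^sup>2 + (sqrt (2 * \<theta> * (s - r)))\<^sup>2) = (4 * pi * \<theta>) * (t + s - 2 * r)"
      using True st \<theta> by (simp add: algebra_simps)
    also have "1 / sqrt ((4 * pi * \<theta>) * (t + s - 2 * r)) = k * (1 / sqrt (t + s - 2 * r))"
      unfolding k_def real_sqrt_mult by simp
    also have "ennreal (k * (1 / sqrt (t + s - 2 * r))) = ennreal k * ennreal (1 / sqrt (t + s - 2 * r))"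
      using True st k by (intro ennreal_mult) auto
    finally show ?thesis using True by simp
  next
    case False
    then show ?thesis using r0 by (auto simp: she_kernel_def)
  qed
  have "(\<integral>\<^sup>+z. ennreal (?k z) \<partial>lborel)
    = (\<integral>\<^sup>+z. ennreal (?k z) \<partial>(lborel \<Otimes>\<^sub>M lborel))"
    by (simp only: lborel_prod)
  also have "\<dots> = (\<integral>\<^sup>+r. (\<integral>\<^sup>+y. ennreal (?k (r, y)) \<partial>lborel) \<partial>lborel)"
    by (rule lborel.nn_integral_fst[symmetric]) (simp add: lborel_prod)
  also have "\<dots> = (\<integral>\<^sup>+r. ennreal k * ennreal (indicator {0<..<s} r * (1 / sqrt (t + s - 2 * r))) \<partial>lborel)"
  proof (rule nn_integral_cong_AE)
    have "AE r in lborel. r \<noteq> (0::real)" by (rule AE_lborel_singleton)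
    then show "AE r in lborel. (\<integral>\<^sup>+y. ennreal (?k (r, y)) \<partial>lborel)
       = ennreal k * ennreal (indicator {0<..<s} r * (1 / sqrt (t + s - 2 * r)))"
      by eventually_elim (rule inner)
  qed
  also have "\<dots> = ennreal k * (\<integral>\<^sup>+r. ennreal (indicator {0<..<s} r * (1 / sqrt (t + s - 2 * r))) \<partial>lborel)"
    by (rule nn_integral_cmult) measurable
  also have "\<dots> = ennreal k * ennreal (sqrt (t + s) - sqrt (t - s))"
    by (simp only: nn_integral_inverse_sqrt[OF s st])
  also have "\<dots> = ennreal ((sqrt (t + s) - sqrt \<bar>t - s\<bar>) / sqrt (4 * pi * \<theta>))"
    using k st s by (simp add: k_def flip: ennreal_mult)
  finally show "(\<integral>\<^sup>+z. ennreal (?k z) \<partial>lborel)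
     = ennreal ((sqrt (t + s) - sqrt \<bar>t - s\<bar>) / sqrt (4 * pi * \<theta>))" .
qed

lemma she_kernel_inner:
  assumes \<theta>: "\<theta> > 0" and s: "0 < s" and t: "0 < t"
  shows "has_bochner_integral lborel (\<lambda>z. she_kernel \<theta> x t z * she_kernel \<theta> x s z)
    ((sqrt (t + s) - sqrt \<bar>t - s\<bar>) / sqrt (4 * pi * \<theta>))"
proof (cases "s \<le> t")
  case True
  then show ?thesis by (rule she_kernel_inner_ordered[OF \<theta> s])
next
  case False
  then show ?thesis using she_kernel_inner_ordered[OF \<theta> t, of s x]
    by (simp add: mult.commute add.commute abs_minus_commute)
qed

lemma sq_int_she_kernel:
  assumes "\<theta> > 0" "0 < t"
  shows "sq_int (she_kernel \<theta> x t)"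
  using she_kernel_inner[OF assms(1) assms(2) assms(2), of x]
  by (auto simp: sq_int_def power2_eq_square has_bochner_integral_iff)

section \<open>Wiener integrals and joint Gaussianity\<close>

lemma sq_int_integrable_mult:
  assumes "sq_int f" "sq_int g"
  shows "integrable lborel (\<lambda>z. f z * g z)"
proof (rule Bochner_Integration.integrable_bound)
  have [measurable]: "f \<in> borel_measurable borel" "g \<in> borel_measurable borel" using assms by (simp_all add: sq_int_def)
  show "integrable lborel (\<lambda>z. (f z)\<^sup>2 + (g z)\<^sup>2)" using assms by (simp add: sq_int_def)
  show "(\<lambda>z. f z * g z) \<in> borel_measurable lborel" by measurable
  have "\<bar>a * b\<bar> \<le> a\<^sup>2 + b\<^sup>2" for a b :: real
  proof -
    have "0 \<le> (\<bar>a\<bar> - \<bar>b\<bar>)\<^sup>2" by simp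
    then have "2 * (\<bar>a\<bar> * \<bar>b\<bar>) \<le> a\<^sup>2 + b\<^sup>2" by (simp add: power2_diff)
    moreover have "0 \<le> \<bar>a\<bar> * \<bar>b\<bar>" by simp
    ultimately show ?thesis unfolding abs_mult by linarith
  qed
  then show "AE z in lborel. norm (f z * g z) \<le> norm ((f z)\<^sup>2 + (g z)\<^sup>2)" by simp
qed

lemma sq_int_lincomb:
  assumes "sq_int f" "sq_int g"
  shows "sq_int (\<lambda>z. a * f z + b * g z)"
proof -
  have "integrable lborel (\<lambda>z. a\<^sup>2 * (f z)\<^sup>2 + 2 * a * b * (f z * g z) + b\<^sup>2 * (g z)\<^sup>2)"
    using assms sq_int_integrable_mult[OF assms] by (intro Bochner_Integration.integrable_add integrable_mult_right) (auto simp: sq_int_def)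
  moreover have "(a * f z + b * g z)\<^sup>2 = a\<^sup>2 * (f z)\<^sup>2 + 2 * a * b * (f z * g z) + b\<^sup>2 * (g z)\<^sup>2" for z
    by (simp add: power2_eq_square algebra_simps)
  moreover have [measurable]: "f \<in> borel_measurable borel" "g \<in> borel_measurable borel" using assms by (simp_all add: sq_int_def)
  ultimately show ?thesis unfolding sq_int_def by simp
qed

lemma sq_int_0: "sq_int (\<lambda>z. 0)"
  by (simp add: sq_int_def)

lemma sq_int_sum:
  assumes "\<And>j. j \<in> J \<Longrightarrow> sq_int (f j)"
  shows "sq_int (\<lambda>z. \<Sum>j\<in>J. a j * f j z)"
  using assms
proof (induction J rule: infinite_finite_induct)
  case (insert k J)
  then show ?case using sq_int_lincomb[of "f k" "\<lambda>z. \<Sum>j\<in>J. a j * f j z" "a k" 1] by simp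
qed (simp_all add: sq_int_0)

text \<open>Linearity holds almost surely for each fixed combination, with its own exceptional set,
  so finite sums are built term by term. The empty sum rests on the degenerate case of
  \<open>white_noise\<close>, which gives \<open>W 0 = 0\<close> almost surely.\<close>

lemma white_noise_sum:
  assumes W: "white_noise M W" and f: "\<And>j. j \<in> J \<Longrightarrow> sq_int (f j)"
  shows "AE w in M. W (\<lambda>z. \<Sum>j\<in>J. a j * f j z) w = (\<Sum>j\<in>J. a j * W (f j) w)"
proof -
  have z: "AE w in M. W (\<lambda>z. 0) w = 0"
  proof -
    have "if (\<integral>z. ((\<lambda>z. 0) z)\<^sup>2 \<partial>(lborel :: (real \<times> real) measure)) = (0::real) then (AE w in M. W (\<lambda>z. 0) w = 0)
         else distributed M lborel (W (\<lambda>z. 0)) (normal_density 0 (sqrt (\<integral>z. ((\<lambda>z. 0) z)\<^sup>2 \<partial>(lborel :: (real \<times> real) measure))))"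
      using W sq_int_0 unfolding white_noise_def by blast
    then show ?thesis by simp
  qed
  show ?thesis using f
  proof (induction J rule: infinite_finite_induct)
    case (insert k J)
    have "AE w in M. W (\<lambda>z. a k * f k z + 1 * (\<Sum>j\<in>J. a j * f j z)) w = a k * W (f k) w + 1 * W (\<lambda>z. \<Sum>j\<in>J. a j * f j z) w"
      using W insert.prems sq_int_sum[of J f a] unfolding white_noise_def by blast
    moreover have "AE w in M. W (\<lambda>z. \<Sum>j\<in>J. a j * f j z) w = (\<Sum>j\<in>J. a j * W (f j) w)"
      using insert by blast
    ultimately show ?case
    proof eventually_elim
      case (elim w)
      then show ?case using insert.hyps by simp
    qed
  qed (use z in simp_all)
qed

text \<open>Unifies the degenerate and the nondegenerate case; both occur among linear combinations
  of kernels.\<close>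

lemma white_noise_char:
  assumes W: "white_noise M W" and f: "sq_int f"
  shows "(\<integral>w. iexp (W f w) \<partial>M) = complex_of_real (exp (- (\<integral>z. (f z)\<^sup>2 \<partial>lborel) / 2))"
proof -
  interpret prob_space M using W by (simp add: white_noise_def)
  have [measurable]: "W f \<in> borel_measurable M" using W f by (simp add: white_noise_def)
  define v where "v = (\<integral>z. (f z)\<^sup>2 \<partial>lborel)"
  have cases: "if v = 0 then (AE w in M. W f w = 0) else distributed M lborel (W f) (normal_density 0 (sqrt v))"
    using W f unfolding white_noise_def v_def by blast
  show ?thesis
  proof (cases "v = 0")
    case True
    then have "AE w in M. iexp (W f w) = 1" using cases by auto
    then have "(\<integral>w. iexp (W f w) \<partial>M) = (\<integral>w. 1 \<partial>M)" by (intro integral_cong_AE) auto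
    then show ?thesis using True by (simp add: v_def prob_space)
  next
    case False
    have "v \<ge> 0" by (simp add: v_def)
    with False have sv: "sqrt v > 0" by simp
    have "distr M lborel (W f) = density lborel (normal_density 0 (sqrt v))"
      using cases False by (simp add: distributed_def)
    then have "distr M borel (W f) = density lborel (normal_density 0 (sqrt v))"
      by (metis distr_cong sets_lborel)
    then have "char (distr M borel (W f)) 1 = complex_of_real (exp (- v / 2))"
      using char_normal_density[OF sv, of 1] \<open>v \<ge> 0\<close> by simp
    moreover have "char (distr M borel (W f)) 1 = (\<integral>w. iexp (W f w) \<partial>M)"
      unfolding char_def by (subst integral_distr) auto
    ultimately show ?thesis by (simp add: v_def)
  qed
qed

text \<open>A linear combination of the variables is almost surely a single Wiener integral, so its
  variance is the squared norm of the combined kernel, a quadratic form in \<open>C\<close>.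
  Agreement of \<open>X j\<close> with \<open>W (f j)\<close> is only almost sure because
  \<open>W\<close> is linear only in that sense.\<close>

lemma white_noise_gaussian_family:
  assumes W: "white_noise M W" and J: "finite J" and f: "\<And>j. j \<in> J \<Longrightarrow> sq_int (f j)"
    and X[measurable]: "\<And>j. j \<in> J \<Longrightarrow> X j \<in> borel_measurable M" and XW: "\<And>j. j \<in> J \<Longrightarrow> AE w in M. X j w = W (f j) w"
    and C: "\<And>i j. i \<in> J \<Longrightarrow> j \<in> J \<Longrightarrow> C i j = (\<integral>z. f i z * f j z \<partial>lborel)" and pos: "\<And>i. i \<in> J \<Longrightarrow> C i i > 0"
  shows "gaussian_family M J X C"
proof -
  interpret prob_space M using W by (simp add: white_noise_def)
  show ?thesis
  proof
    show "C i j = C j i" if "i \<in> J" "j \<in> J" for i j using C that by (simp add: mult.commute)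
    fix a
    define F where "F z = (\<Sum>j\<in>J. a j * f j z)" for z
    have F: "sq_int F" unfolding F_def by (rule sq_int_sum[OF f])
    have [measurable]: "W F \<in> borel_measurable M" using W F by (simp add: white_noise_def)
    have WF: "AE w in M. W F w = (\<Sum>j\<in>J. a j * W (f j) w)"
      unfolding F_def[abs_def] by (rule white_noise_sum[OF W f])
    have "AE w in M. \<forall>j\<in>J. X j w = W (f j) w" using XW J by (intro AE_finite_allI) auto
    then have "AE w in M. iexp (\<Sum>j\<in>J. a j * X j w) = iexp (W F w)"
      using WF
    proof eventually_elim
      case (elim w)
      have "(\<Sum>j\<in>J. a j * X j w) = W F w"
        using elim(1) unfolding elim(2) by (intro sum.cong) auto
      then show ?case by (simp only:)
    qed
    then have "(\<integral>w. iexp (\<Sum>j\<in>J. a j * X j w) \<partial>M) = (\<integral>w. iexp (W F w) \<partial>M)"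
      by (intro integral_cong_AE) (auto simp del: of_real_sum)
    also have "\<dots> = of_real (exp (- (\<integral>z. (F z)\<^sup>2 \<partial>lborel) / 2))" by (rule white_noise_char[OF W F])
    also have "(\<integral>z. (F z)\<^sup>2 \<partial>lborel) = (\<integral>z. (\<Sum>i\<in>J. \<Sum>j\<in>J. a i * a j * (f i z * f j z)) \<partial>lborel)"
      by (simp add: F_def power2_eq_square sum_product mult_ac)
    also have "\<dots> = (\<Sum>i\<in>J. \<Sum>j\<in>J. a i * a j * C i j)"
    proof -
      have i: "integrable lborel (\<lambda>z. a i * a j * (f i z * f j z))" if "i \<in> J" "j \<in> J" for i j
        using that by (intro integrable_mult_right sq_int_integrable_mult f)
      have "(\<integral>z. (\<Sum>i\<in>J. \<Sum>j\<in>J. a i * a j * (f i z * f j z)) \<partial>lborel) = (\<Sum>i\<in>J. \<Sum>j\<in>J. (\<integral>z. a i * a j * (f i z * f j z) \<partial>lborel))"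
        using i by (simp only: Bochner_Integration.integral_sum Bochner_Integration.integrable_sum cong: sum.cong)
      also have "\<dots> = (\<Sum>i\<in>J. \<Sum>j\<in>J. a i * a j * C i j)"
        by (intro sum.cong refl) (simp add: C)
      finally show ?thesis .
    qed
    finally show "(\<integral>w. iexp (\<Sum>j\<in>J. a j * X j w) \<partial>M) = of_real (exp (- (\<Sum>i\<in>J. \<Sum>j\<in>J. a i * a j * C i j) / 2))" .
  qed (use J pos in auto)
qed

section \<open>Normalised increments of the solution\<close>

text \<open>The leading-order standard deviation of an increment over a step \<open>h\<close>:
  \<open>\<sigma>\<^sup>2 / sqrt (4 * pi * \<theta>)\<close> times the fractional variance
  \<open>2 * sqrt h\<close>.\<close>

definition incr_norm :: "real \<Rightarrow> real \<Rightarrow> real \<Rightarrow> real" where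
  "incr_norm \<theta> \<sigma> h = sqrt (2 * \<sigma>\<^sup>2 * sqrt h / sqrt (4 * pi * \<theta>))"

lemma incr_norm_pos: "\<theta> > 0 \<Longrightarrow> \<sigma> > 0 \<Longrightarrow> h > 0 \<Longrightarrow> incr_norm \<theta> \<sigma> h > 0"
  by (simp add: incr_norm_def)

text \<open>The fourth power is linear in the step: variances are of order \<open>sqrt h\<close>.
  This is why the quartic variation has a finite nonzero limit and carries the ratio
  \<open>\<sigma> ^ 4 / \<theta>\<close>.\<close>

lemma incr_norm_power4:
  assumes "\<theta> > 0" "h \<ge> 0"
  shows "incr_norm \<theta> \<sigma> h ^ 4 = \<sigma> ^ 4 * h / (pi * \<theta>)"
proof -
  have "incr_norm \<theta> \<sigma> h ^ 4 = ((incr_norm \<theta> \<sigma> h)\<^sup>2)\<^sup>2" by simp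
  also have "(incr_norm \<theta> \<sigma> h)\<^sup>2 = 2 * \<sigma>\<^sup>2 * sqrt h / sqrt (4 * pi * \<theta>)"
    unfolding incr_norm_def using assms by (intro real_sqrt_pow2) auto
  also have "\<dots>\<^sup>2 = 4 * \<sigma> ^ 4 * h / (4 * pi * \<theta>)"
    using assms by (simp add: power_divide power_mult_distrib)
  finally show ?thesis using assms by simp
qed

lemma she_increments_gaussian:
  fixes M :: "'a measure"
  assumes W: "white_noise M W" and \<theta>: "\<theta> > 0" and \<sigma>: "\<sigma> > 0" and c: "0 < c" and cd: "c < d" and n: "n \<ge> 1"
  shows "gaussian_family M {1..n}
    (\<lambda>i w. (she_solution \<theta> \<sigma> W (c + (d - c) * real i / real n) x w
        - she_solution \<theta> \<sigma> W (c + (d - c) * real (i - 1) / real n) x w) / incr_norm \<theta> \<sigma> ((d - c) / real n))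
    (incr_corr c d n)"
proof -
  define h where "h = (d - c) / real n"
  have h: "h > 0" using cd n by (simp add: h_def)
  define N where "N = incr_norm \<theta> \<sigma> h"
  have N: "N > 0" unfolding N_def using \<theta> \<sigma> h by (rule incr_norm_pos)
  define t where "t i = c + (d - c) * real i / real n" for i :: nat
  have tpos: "t i > 0" for i unfolding t_def using c cd by (intro add_pos_nonneg) auto
  \<comment> \<open>The restriction \<open>i \<ge> 1\<close> matters: at 0 the truncated predecessor
    is 0 itself.\<close>
  have t_pred: "t (i - 1) = t i - h" if "i \<in> {1..n}" for i
  proof -
    have "real (i - 1) = real i - 1" using that by (simp add: of_nat_diff)
    then show ?thesis unfolding t_def h_def by (simp add: right_diff_distrib diff_divide_distrib)
  qed
  define k where "k i = she_kernel \<theta> x (t i)" for i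
  have ksq: "sq_int (k i)" for i unfolding k_def by (rule sq_int_she_kernel[OF \<theta> tpos])
  have kin: "(\<integral>z. k i z * k j z \<partial>lborel) = (sqrt (t i + t j) - sqrt \<bar>t i - t j\<bar>) / sqrt (4 * pi * \<theta>)" for i j
    unfolding k_def using she_kernel_inner[OF \<theta> tpos tpos] by (rule has_bochner_integral_integral_eq)
  \<comment> \<open>The normalised increment is almost surely the Wiener integral of this kernel, so
    covariances reduce to four inner products.\<close>
  define f where "f i z = \<sigma> / N * k i z + (- \<sigma> / N) * k (i - 1) z" for i z
  have f: "sq_int (f i)" for i unfolding f_def by (intro sq_int_lincomb ksq)
  have Wm: "W (k i) \<in> borel_measurable M" for i using W ksq by (simp add: white_noise_def)
  show ?thesis
    unfolding h_def[symmetric] N_def[symmetric] t_def[symmetric] she_solution_kernel k_def[symmetric]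
  proof (rule white_noise_gaussian_family[OF W, where f=f])
    fix i assume i: "i \<in> {1..n}"
    show "(\<lambda>w. (\<sigma> * W (k i) w - \<sigma> * W (k (i - 1)) w) / N) \<in> borel_measurable M" using Wm by measurable
    have "AE w in M. W (\<lambda>z. \<sigma> / N * k i z + (- \<sigma> / N) * k (i - 1) z) w = \<sigma> / N * W (k i) w + (- \<sigma> / N) * W (k (i - 1)) w"
      using W ksq unfolding white_noise_def by blast
    then show "AE w in M. (\<sigma> * W (k i) w - \<sigma> * W (k (i - 1)) w) / N = W (f i) w"
      unfolding f_def[abs_def, symmetric] by eventually_elim (simp add: diff_divide_distrib f_def[abs_def])
  next
    fix i j assume i: "i \<in> {1..n}" and j: "j \<in> {1..n}"
    have ik: "integrable lborel (\<lambda>z. k i z * k j z)" for i j by (intro sq_int_integrable_mult ksq)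
    have "(\<integral>z. f i z * f j z \<partial>lborel) = (\<integral>z. (\<sigma> / N)\<^sup>2 * (k i z * k j z - k (i - 1) z * k j z - k i z * k (j - 1) z + k (i - 1) z * k (j - 1) z) \<partial>lborel)"
      by (intro Bochner_Integration.integral_cong refl) (simp add: f_def power2_eq_square algebra_simps)
    also have "\<dots> = (\<sigma> / N)\<^sup>2 * ((\<integral>z. k i z * k j z \<partial>lborel) - (\<integral>z. k (i - 1) z * k j z \<partial>lborel)
        - (\<integral>z. k i z * k (j - 1) z \<partial>lborel) + (\<integral>z. k (i - 1) z * k (j - 1) z \<partial>lborel))"
      using ik by (simp only: integral_mult_right_zero Bochner_Integration.integral_add Bochner_Integration.integral_diff
        Bochner_Integration.integrable_diff)
    also have "\<dots> = (\<sigma> / N)\<^sup>2 / sqrt (4 * pi * \<theta>) * mixed_diff h (t i) (t j)"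
      unfolding kin t_pred[OF i] t_pred[OF j] mixed_diff_def by (simp add: add_divide_distrib diff_divide_distrib algebra_simps)
    also have "(\<sigma> / N)\<^sup>2 / sqrt (4 * pi * \<theta>) = 1 / (2 * sqrt h)"
    proof -
      have "N\<^sup>2 = 2 * \<sigma>\<^sup>2 * sqrt h / sqrt (4 * pi * \<theta>)"
        unfolding N_def incr_norm_def using h \<theta> by (intro real_sqrt_pow2) auto
      then show ?thesis using \<theta> \<sigma> h by (simp add: power_divide)
    qed
    also have "1 / (2 * sqrt h) * mixed_diff h (t i) (t j) = incr_corr c d n i j"
      by (simp add: incr_corr_def h_def t_def)
    finally show "incr_corr c d n i j = (\<integral>z. f i z * f j z \<partial>lborel)" ..
  qed (use f incr_corr_pos[OF c cd] in auto)
qed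

theorem theorem3p3:
  fixes M :: "'a measure" and W :: "(real \<times> real \<Rightarrow> real) \<Rightarrow> 'a \<Rightarrow> real"
    and \<theta> \<sigma> x c d :: real
  assumes "white_noise M W" and "\<theta> > 0" and "\<sigma> > 0" and "0 < c" and "c < d"
  defines "u \<equiv> she_solution \<theta> \<sigma> W"
  shows "(AE \<omega> in M. (\<lambda>n. theta_hat u \<sigma> x c d n \<omega>) \<longlonglongrightarrow> \<theta>)
    \<and> (AE \<omega> in M. (\<lambda>n. sigma2_hat u \<theta> x c d n \<omega>) \<longlonglongrightarrow> \<sigma>\<^sup>2)
    \<and> weak_conv_m (\<lambda>n. distr M borel (\<lambda>\<omega>. sqrt (real n) * (theta_hat u \<sigma> x c d n \<omega> - \<theta>)))
        (density lborel (normal_density 0 (sqrt (\<theta>\<^sup>2 * sigma_check / 9))))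
    \<and> weak_conv_m (\<lambda>n. distr M borel (\<lambda>\<omega>. sqrt (real n) * (sigma2_hat u \<theta> x c d n \<omega> - \<sigma>\<^sup>2)))
        (density lborel (normal_density 0 (sqrt (\<sigma> ^ 4 * sigma_check / 36))))"
proof -
  note W = assms(1) and \<theta> = assms(2) and \<sigma> = assms(3) and c = assms(4) and cd = assms(5)
  interpret prob_space M using W by (simp add: white_noise_def)
  define X where "X n i w = (u (c + (d - c) * real i / real n) x w - u (c + (d - c) * real (i - 1) / real n) x w)
      / incr_norm \<theta> \<sigma> ((d - c) / real n)" for n i :: nat and w
  interpret A: gaussian_array M X "incr_corr c d" "1 + incr_err c d" "2 + incr_err c d" sigma_check
  proof (rule gaussian_array.intro[OF prob_space_axioms gaussian_array_axioms.intro])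
    show "gaussian_family M {1..n} (X n) (incr_corr c d n)" if "n \<ge> 1" for n
      using she_increments_gaussian[OF W \<theta> \<sigma> c cd that, of x] unfolding X_def[abs_def] u_def .
    show "\<bar>incr_corr c d n i j\<bar> \<le> 1 + incr_err c d" if "i \<in> {1..n}" "j \<in> {1..n}" for n i j
      using incr_corr_bound[OF c cd that] .
    show "(\<Sum>j=1..n. \<bar>incr_corr c d n i j\<bar>) \<le> 2 + incr_err c d" if "i \<in> {1..n}" for n i
      using incr_corr_row[OF c cd that] .
  qed (use incr_err_nonneg[OF c cd] incr_corr_variance_limit[OF c cd] incr_corr_bias[OF c cd] sigma_check_pos in auto)
  let ?T = "\<lambda>n w. sqrt (real n) * (theta_hat u \<sigma> x c d n w - \<theta>)" and ?U = "\<lambda>n w. sqrt (real n) * (sigma2_hat u \<theta> x c d n w - \<sigma>\<^sup>2)"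
  let ?S = A.mean_quartic and ?Z = A.scaled_error
  have um: "u t x \<in> borel_measurable M" if "t > 0" for t
  proof -
    have "W (she_kernel \<theta> x t) \<in> borel_measurable M"
      using W sq_int_she_kernel[OF \<theta> that, of x] by (simp add: white_noise_def)
    then show ?thesis unfolding u_def she_solution_kernel[abs_def] by measurable
  qed
  have tpos: "c + (d - c) * real i / real n > 0" for i n :: nat
    using c cd by (intro add_pos_nonneg) auto
  have qm[measurable]: "quartic_var u x c d n \<in> borel_measurable M" for n
    unfolding quartic_var_def[abs_def] using um[OF tpos] by measurable
  \<comment> \<open>The identity includes \<open>n = 0\<close>, where both sides are 0, so the
    estimators can be rewritten for every \<open>n\<close>.\<close>
  have quartic: "quartic_var u x c d n w = 3 * (d - c) * \<sigma> ^ 4 / (pi * \<theta>) * ?S n w" for n w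
  proof (cases "n = 0")
    case True
    then show ?thesis by (simp add: quartic_var_def A.mean_quartic_def)
  next
    case False
    then have h: "(d - c) / real n > 0" using cd by simp
    have N: "incr_norm \<theta> \<sigma> ((d - c) / real n) ^ 4 = \<sigma> ^ 4 * ((d - c) / real n) / (pi * \<theta>)"
      using h by (intro incr_norm_power4 \<theta>) auto
    have Seq: "?S n w = quartic_var u x c d n w / (\<sigma> ^ 4 * ((d - c) / real n) / (pi * \<theta>)) / (3 * real n)"
      unfolding A.mean_quartic_def quartic_var_def X_def power_divide N sum_divide_distrib ..
    have *: "V = 3 * b * a / p * S" if "S = V / (a * (b / m) / p) / (3 * m)" "a \<noteq> 0" "b \<noteq> 0" "m \<noteq> 0" "p \<noteq> 0"
      for S V a b m p :: real
      unfolding that(1) using that(2-) by (simp add: field_simps)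
    show ?thesis by (rule *[OF Seq]) (use \<theta> \<sigma> cd False in auto)
  qed
  \<comment> \<open>If the quartic mean vanishes, both sides are 0 by the convention for division by
    0; the identity is thus pointwise.\<close>
  have theta: "theta_hat u \<sigma> x c d n w = \<theta> / ?S n w" for n w
  proof -
    have "q / (pi * (q / (pi * \<theta>) * S)) = \<theta> / S" if "q \<noteq> 0" for q S
      using that \<theta> by (cases "S = 0") (simp_all add: field_simps)
    then show ?thesis unfolding theta_hat_def quartic using \<sigma> cd by simp
  qed
  have sigma: "sigma2_hat u \<theta> x c d n w = \<sigma>\<^sup>2 * sqrt (?S n w)" for n w
  proof -
    have "\<theta> * pi / (3 * (d - c)) * (3 * (d - c) * \<sigma> ^ 4 / (pi * \<theta>) * ?S n w) = (\<sigma>\<^sup>2)\<^sup>2 * ?S n w"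
    proof -
      have "\<theta> * pi / (3 * D) * (3 * D * a / (pi * \<theta>) * S) = a * S" if "D \<noteq> 0" for D a S
        using that \<theta> by simp
      from this[of "d - c" "\<sigma> ^ 4"] show ?thesis using cd by simp
    qed
    then show ?thesis unfolding sigma2_hat_def quartic by (simp only: real_sqrt_mult real_sqrt_abs abs_power2)
  qed
  have Sm[measurable]: "?S n \<in> borel_measurable M" for n
  proof -
    have "?S n w = quartic_var u x c d n w / (3 * (d - c) * \<sigma> ^ 4 / (pi * \<theta>))" for w
      unfolding quartic using \<theta> \<sigma> cd by simp
    then have "?S n = (\<lambda>w. quartic_var u x c d n w / (3 * (d - c) * \<sigma> ^ 4 / (pi * \<theta>)))" by (rule ext)
    then show ?thesis by simp
  qed
  have Zm[measurable]: "?Z n \<in> borel_measurable M" for n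
    unfolding A.scaled_error_def[abs_def] by measurable
  have S0: "?S n w \<ge> 0" for n w unfolding A.mean_quartic_def by (intro divide_nonneg_nonneg sum_nonneg) auto
  obtain K where K: "\<And>n. n \<ge> 1 \<Longrightarrow> integrable M (\<lambda>w. (?Z n w)\<^sup>2)" "\<And>n. n \<ge> 1 \<Longrightarrow> (\<integral>w. (?Z n w)\<^sup>2 \<partial>M) \<le> K"
    using A.scaled_error_square by blast
  have spos: "sigma_check / 9 > 0" using sigma_check_pos by simp
  have Zsq: "(?Z n w)\<^sup>2 / sqrt (real n) = sqrt (real n) * (?S n w - 1)\<^sup>2" if "n \<ge> 1" for n w
    using that by (simp add: A.scaled_error_def power_mult_distrib real_div_sqrt flip: times_divide_eq_left)
  have "AE w in M. (\<lambda>n. theta_hat u \<sigma> x c d n w) \<longlonglongrightarrow> \<theta>"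
    using A.AE_mean_quartic
  proof eventually_elim
    case (elim w)
    have "(\<lambda>n. \<theta> / ?S n w) \<longlonglongrightarrow> \<theta> / 1" using elim by (intro tendsto_intros) auto
    then show ?case by (simp add: theta)
  qed
  moreover have "AE w in M. (\<lambda>n. sigma2_hat u \<theta> x c d n w) \<longlonglongrightarrow> \<sigma>\<^sup>2"
    using A.AE_mean_quartic
  proof eventually_elim
    case (elim w)
    have "(\<lambda>n. \<sigma>\<^sup>2 * sqrt (?S n w)) \<longlonglongrightarrow> \<sigma>\<^sup>2 * sqrt 1" using elim by (intro tendsto_intros) auto
    then show ?case by (simp add: sigma)
  qed
  \<comment> \<open>\<open>- \<theta>\<close> is the derivative of \<open>\<theta> / S\<close> at
    \<open>S = 1\<close>. The remainder is exactly \<open>\<theta> * (S - 1)\<^sup>2 / S\<close>,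
    and \<open>S \<ge> 1 / 2\<close> below the threshold gives the constant
    \<open>2 * \<theta>\<close>.\<close>
  moreover have "weak_conv_m (\<lambda>n. distr M borel (?T n))
        (density lborel (normal_density 0 (sqrt ((- \<theta>)\<^sup>2 * (sigma_check / 9)))))"
  proof (rule delta_method_normal[OF Zm _ K A.char_scaled_error, where L="2 * \<theta>"])
    show "(?T n) \<in> borel_measurable M" for n
      unfolding theta by measurable
    fix n :: nat and w assume n: "n \<ge> 1" and small: "\<bar>?Z n w\<bar> \<le> sqrt (real n) / 2"
    have sn: "sqrt (real n) > 0" using n by simp
    have "sqrt (real n) * \<bar>?S n w - 1\<bar> \<le> sqrt (real n) * (1 / 2)"
      using small sn by (simp add: A.scaled_error_def abs_mult)
    then have "\<bar>?S n w - 1\<bar> \<le> 1 / 2" using sn by (simp only: mult_le_cancel_left_pos)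
    then have S: "?S n w \<ge> 1 / 2" by linarith
    have "?T n w - (- \<theta>) * ?Z n w = \<theta> * (sqrt (real n) * (?S n w - 1)\<^sup>2) / ?S n w"
      unfolding theta A.scaled_error_def using S by (simp add: field_simps power2_eq_square)
    then have "\<bar>?T n w - (- \<theta>) * ?Z n w\<bar> = \<theta> * (sqrt (real n) * (?S n w - 1)\<^sup>2) / ?S n w"
      using S \<theta> by (simp add: abs_mult)
    also have "\<dots> \<le> \<theta> * (sqrt (real n) * (?S n w - 1)\<^sup>2) / (1 / 2)"
      using S \<theta> by (intro divide_left_mono mult_nonneg_nonneg) auto
    also have "\<dots> = 2 * \<theta> * ((?Z n w)\<^sup>2 / sqrt (real n))" unfolding Zsq[OF n] by simp
    finally show "\<bar>?T n w - (- \<theta>) * ?Z n w\<bar> \<le> 2 * \<theta> * (?Z n w)\<^sup>2 / sqrt (real n)"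
      by simp
  qed (use \<theta> spos in auto)
  moreover have "weak_conv_m (\<lambda>n. distr M borel (?U n))
        (density lborel (normal_density 0 (sqrt ((\<sigma>\<^sup>2 / 2)\<^sup>2 * (sigma_check / 9)))))"
  proof (rule delta_method_normal[OF Zm _ K A.char_scaled_error, where L="\<sigma>\<^sup>2 / 2"])
    show "(?U n) \<in> borel_measurable M" for n
      unfolding sigma by measurable
    fix n :: nat and w assume n: "n \<ge> 1"
    \<comment> \<open>In terms of \<open>q = sqrt S\<close> the remainder of
      \<open>\<sigma>\<^sup>2 * sqrt S\<close> after its linear part at 1 is exactly
      \<open>- (\<sigma>\<^sup>2 / 2) * (q - 1)\<^sup>2\<close>, and
      \<open>\<bar>q - 1\<bar> \<le> \<bar>q\<^sup>2 - 1\<bar>\<close> since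
      \<open>q \<ge> 0\<close>.\<close>
    define q where "q = sqrt (?S n w)"
    have q: "q \<ge> 0" "?S n w = q\<^sup>2" using S0[of n w] by (auto simp: q_def)
    have "1 * \<bar>q - 1\<bar> \<le> \<bar>q + 1\<bar> * \<bar>q - 1\<bar>" using q by (intro mult_right_mono) auto
    also have "\<dots> = \<bar>q\<^sup>2 - 1\<bar>" by (simp add: power2_eq_square algebra_simps flip: abs_mult)
    finally have q1: "(q - 1)\<^sup>2 \<le> (q\<^sup>2 - 1)\<^sup>2" by (simp add: abs_le_square_iff)
    have "?U n w - \<sigma>\<^sup>2 / 2 * ?Z n w = - (\<sigma>\<^sup>2 / 2 * (sqrt (real n) * (q - 1)\<^sup>2))"
      unfolding sigma q_def[symmetric] unfolding A.scaled_error_def q(2) by (simp add: field_simps power2_eq_square)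
    then have "\<bar>?U n w - \<sigma>\<^sup>2 / 2 * ?Z n w\<bar> = \<sigma>\<^sup>2 / 2 * (sqrt (real n) * (q - 1)\<^sup>2)" by simp
    also have "\<dots> \<le> \<sigma>\<^sup>2 / 2 * (sqrt (real n) * (q\<^sup>2 - 1)\<^sup>2)" using q1 by (intro mult_left_mono) auto
    also have "\<dots> = \<sigma>\<^sup>2 / 2 * ((?Z n w)\<^sup>2 / sqrt (real n))" unfolding Zsq[OF n] q(2) ..
    finally show "\<bar>?U n w - \<sigma>\<^sup>2 / 2 * ?Z n w\<bar> \<le> \<sigma>\<^sup>2 / 2 * (?Z n w)\<^sup>2 / sqrt (real n)"
      by simp
  qed (use \<sigma> spos in auto)
  ultimately show ?thesis by (simp add: power_divide)
qed

end
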